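(* Let $n,k\ge 1$ be integers, let $0<M<1$ and let $M_0,M_1,\dots,M_{k+1}$ be positive constants. Let $r_0>0$ and $x^*$ satisfy $$0<M_1r_0<H\left(\frac{-\ln M}{k+1}\right),\qquad x^*\in\left(x_1(r_0),\frac{-\ln M}{k+1}\right)\subset (x_1(r_0),x_2(r_0)),$$ where $H$, $x_1(r_0)$, $x_2(r_0)$ are defined in the context. Then there exists a constant $\delta$ with $0<\delta\le r_0$ (depending only on the constants above) such that the following holds for every $r$ with $0<r<\delta$. Put $\lambda=x^*/r$ and $\mathcal C=C([-r,0],\mathbb R^n)$, let $L(t):\mathcal C\to\mathbb R^n$ $(t\in\mathbb R)$ be a family of admissible operators (see context) with $\sup_{t\in\mathbb R}|L(t)|=M$, and let $F:\mathbb R\times\mathcal C\to\mathbb R^n$ be a continuous map which is $C^k$ in the second variable and satisfies, for all $t\in\mathbb R$ and $\phi,\psi\in\mathcal C$, $$|F(t,0)|\le M_0e^{\lambda|t|},\qquad |D_2^jF(t,\phi)|\le M_j\ (j=1,\dots,k),\qquad |D_2^kF(t,\phi)-D_2^kF(t,\psi)|\le M_{k+1}|\phi-\psi|.$$ Then there is a continuous map $\Psi:\mathbb R\times\mathbb R^n\to\mathbb R^n$ such that for each $\xi\in\mathbb R^n$, $\Psi(\cdot,\xi)$ is a solution on $\mathbb R$ of $$\frac{d}{dt}\{x(t)-L(t)x_t\}=F(t,x_t)$$ with the condition $x(0)-L(0)x_0=\xi$, and for each $t\in\mathbb R$, $\Psi(t,\cdot)$ is a $C^{k,1}$ map on $\mathbb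 R^n$.
   Context: $|\cdot|$ denotes the norm in each space; $\mathbb R^n$ carries a fixed norm, $\mathcal C=C([-r,0],\mathbb R^n)$ (continuous maps) carries the supremum norm $|\phi|=\sup_{\theta\in[-r,0]}|\phi(\theta)|$, and linear and multilinear maps carry operator norms. $x_t\in\mathcal C$ is $x_t(\theta)=x(t+\theta)$ for $\theta\in[-r,0]$. $D_2^j$ is the $j$-th partial (Fréchet) derivative in the second variable. Admissible operators: $L(t)\phi=\int_{-r}^0 d\eta(t,\theta)\phi(\theta)$, where the kernel $\eta:\mathbb R\times\mathbb R\to\mathbb R^{n\times n}$ is measurable and normalized so that $\eta(t,\theta)=\eta(t,-r)$ for $\theta\le -r$, $\eta(t,\theta)=0$ for $\theta\ge0$, $\eta(t,\cdot)$ is continuous from the left on $(-r,0)$ and has bounded variation uniformly in $t$, such that $t\mapsto L(t)\phi$ is continuous for each $\phi\in\mathcal C$; moreover $\eta$ is uniformly nonatomic at zero: for every $\epsilon>0$ there is $\delta'>0$ such that the total variation of $\eta(t,\cdot)$ on $[-\delta',0]$ is less than $\epsilon$ for all $t\in\mathbb R$. $H(x):=xe^{-x}-Mx$ for $x\in\mathbb R$. For $0<M<1$, $H'$ has a unique positive zero $\hat x\in(0,1)$, and if $0<M_1r_0<H(\hat x)$ then $H(x)=M_1r_0$ has exactly two positive roots $x_1(r_0)<x_2(r_0)$, with $0<x_1(r_0)<\hat x<x_2(r_0)<-\ln M$. A solution on $\mathbb R$ is a continuous $x:\mathbb R\to\mathbb R^n$ such that $t\mapsto x(t)-L(t)x_t$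 is continuously differentiable and satisfies the equation for all $t\in\mathbb R$. A map $\phi$ from an open set $U$ to a Banach space is $C^{k,1}$ if it is $C^k$ and $\sup_{x\ne x'}|D^k\phi(x)-D^k\phi(x')|/|x-x'|<\infty$. *)

theory Defs
  imports "HOL-Analysis.Analysis"
begin

section \<open>The phase space\<close>

text \<open>
  Since \<open>r\<close> is quantified inside the theorem, \<open>C([-r,0], 'a)\<close> cannot be a type.  It is
  represented by the closed subspace of those bounded continuous functions on the real line that
  are constant on \<open>{..-r}\<close> and on \<open>{0..}\<close>.  Restriction to \<open>{-r..0}\<close> is a linear bijection onto
  the continuous functions on \<open>{-r..0}\<close>, and the supremum norm over the line is the one over
  \<open>{-r..0}\<close>; see the lemmas below.
\<close>

definition phase_space :: "real \<Rightarrow> (real \<Rightarrow>\<^sub>C 'a::real_normed_vector) set" where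
  "phase_space r = {\<phi>. \<forall>\<theta>. apply_bcontfun \<phi> (clamp (-r) 0 \<theta>) = apply_bcontfun \<phi> \<theta>}"

definition segment_at :: "real \<Rightarrow> (real \<Rightarrow> 'a::real_normed_vector) \<Rightarrow> real \<Rightarrow> (real \<Rightarrow>\<^sub>C 'a)" where
  "segment_at r x t = Bcontfun (\<lambda>\<theta>. x (t + clamp (-r) 0 \<theta>))"

lemma subspace_phase_space: "subspace (phase_space r)"
  by (auto simp: subspace_def phase_space_def plus_bcontfun.rep_eq scaleR_bcontfun.rep_eq
      zero_bcontfun.rep_eq)

lemma ex1_phase_space:
  fixes f :: "real \<Rightarrow> 'a::real_normed_vector"
  assumes "0 \<le> r" "continuous_on {-r..0} f"
  shows "\<exists>!\<phi>. \<phi> \<in> phase_space r \<and> (\<forall>\<theta>\<in>{-r..0}. apply_bcontfun \<phi> \<theta> = f \<theta>)"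
proof -
  have cl: "clamp (-r) 0 \<theta> \<in> {-r..0}" for \<theta>
    using clamp_in_interval[of "-r" 0 \<theta>] assms(1) by simp
  have id: "clamp (-r) 0 \<theta> = \<theta>" if "\<theta> \<in> {-r..0}" for \<theta>
    using clamp_cancel_cbox[of \<theta> "-r" 0] that by simp
  obtain g :: "real \<Rightarrow>\<^sub>C 'a" where g: "\<And>x. apply_bcontfun g x = f (clamp (-r) 0 x)"
    using continuous_on_cbox_bcontfunE[of "-r" 0 f] assms(2) by auto
  show ?thesis
  proof (rule ex1I[of _ g])
    show "g \<in> phase_space r \<and> (\<forall>\<theta>\<in>{-r..0}. apply_bcontfun g \<theta> = f \<theta>)"
      using g id cl by (auto simp: phase_space_def)
  next
    fix \<phi> assume "\<phi> \<in> phase_space r \<and> (\<forall>\<theta>\<in>{-r..0}. apply_bcontfun \<phi> \<theta> = f \<theta>)"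
    then have "apply_bcontfun \<phi> \<theta> = apply_bcontfun g \<theta>" for \<theta>
      using cl g unfolding phase_space_def by (metis (mono_tags, lifting) mem_Collect_eq)
    then show "\<phi> = g" by (intro bcontfun_eqI) auto
  qed
qed

lemma norm_phase_space:
  assumes "0 \<le> r" "\<phi> \<in> phase_space r"
  shows "norm \<phi> = (SUP \<theta>\<in>{-r..0}. norm (apply_bcontfun \<phi> \<theta>))"
proof -
  have cl: "clamp (-r) 0 \<theta> \<in> {-r..0}" for \<theta>
    using clamp_in_interval[of "-r" 0 \<theta>] assms(1) by simp
  have eq: "apply_bcontfun \<phi> (clamp (-r) 0 \<theta>) = apply_bcontfun \<phi> \<theta>" for \<theta>
    using assms(2) by (simp add: phase_space_def)
  have "range (\<lambda>\<theta>. norm (apply_bcontfun \<phi> \<theta>)) = (\<lambda>\<theta>. norm (apply_bcontfun \<phi> \<theta>)) ` {-r..0}"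
  proof (intro equalityI subsetI)
    fix y assume "y \<in> range (\<lambda>\<theta>. norm (apply_bcontfun \<phi> \<theta>))"
    then obtain \<theta> where "y = norm (apply_bcontfun \<phi> (clamp (-r) 0 \<theta>))" using eq by force
    then show "y \<in> (\<lambda>\<theta>. norm (apply_bcontfun \<phi> \<theta>)) ` {-r..0}" using cl by blast
  qed auto
  then show ?thesis
    by (simp add: norm_bcontfun_def dist_bcontfun_def zero_bcontfun.rep_eq)
qed

lemma segment_at_phase_space:
  fixes x :: "real \<Rightarrow> 'a::real_normed_vector"
  assumes "0 \<le> r" "continuous_on UNIV x"
  shows "segment_at r x t \<in> phase_space r"
    and "\<theta> \<in> {-r..0} \<Longrightarrow> apply_bcontfun (segment_at r x t) \<theta> = x (t + \<theta>)"
proof -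
  have cl: "clamp (-r) 0 \<theta> \<in> {-r..0}" for \<theta>
    using clamp_in_interval[of "-r" 0 \<theta>] assms(1) by simp
  have id: "clamp (-r) 0 \<theta> = \<theta>" if "\<theta> \<in> {-r..0}" for \<theta>
    using clamp_cancel_cbox[of \<theta> "-r" 0] that by simp
  have "continuous_on (cbox (-r) 0) (\<lambda>\<theta>. x (t + \<theta>))"
    by (intro continuous_on_compose2[OF assms(2)] continuous_intros) auto
  then obtain g :: "real \<Rightarrow>\<^sub>C 'a" where g: "\<And>\<theta>. apply_bcontfun g \<theta> = x (t + clamp (-r) 0 \<theta>)"
    using continuous_on_cbox_bcontfunE[of "-r" 0 "\<lambda>\<theta>. x (t + \<theta>)"] by auto
  then have "apply_bcontfun g = (\<lambda>\<theta>. x (t + clamp (-r) 0 \<theta>))" by auto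
  then have seg: "segment_at r x t = g"
    unfolding segment_at_def by (metis apply_bcontfun_inverse)
  show "segment_at r x t \<in> phase_space r"
    using g id[OF cl] by (simp add: seg phase_space_def)
  show "apply_bcontfun (segment_at r x t) \<theta> = x (t + \<theta>)" if "\<theta> \<in> {-r..0}"
    using g id[OF that] by (simp add: seg)
qed


section \<open>Multilinear maps and higher Frechet derivatives\<close>

text \<open>
  Throughout, \<open>V\<close> is a linear subspace of a normed type, regarded as a normed space in its own
  right.  A \<open>j\<close>-linear map on \<open>V\<close> is a function on lists; only its values on lists of length \<open>j\<close>
  with entries in \<open>V\<close> matter.  Norms are \<open>ennreal\<close>-valued, so an infinite supremum is \<open>\<infinity>\<close>.
\<close>

definition op_norm_on :: "'b::real_normed_vector set \<Rightarrow> ('b \<Rightarrow> 'c::real_normed_vector) \<Rightarrow> ennreal"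
  where "op_norm_on V T = (SUP h\<in>{h \<in> V. norm h \<le> 1}. ennreal (norm (T h)))"

definition ml_norm :: "'b::real_normed_vector set \<Rightarrow> nat \<Rightarrow> ('b list \<Rightarrow> 'c::real_normed_vector) \<Rightarrow> ennreal"
  where "ml_norm V j T =
    (SUP hs\<in>{hs. length hs = j \<and> (\<forall>h\<in>set hs. h \<in> V \<and> norm h \<le> 1)}. ennreal (norm (T hs)))"

definition bounded_multilinear_on ::
  "'b::real_normed_vector set \<Rightarrow> nat \<Rightarrow> ('b list \<Rightarrow> 'c::real_normed_vector) \<Rightarrow> bool" where
  "bounded_multilinear_on V j T \<longleftrightarrow>
     (\<forall>hs. length hs = j \<and> set hs \<subseteq> V \<longrightarrow>
        (\<forall>i<j. \<forall>u\<in>V. \<forall>v\<in>V. \<forall>a b.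
           T (hs[i := a *\<^sub>R u + b *\<^sub>R v]) = a *\<^sub>R T (hs[i := u]) + b *\<^sub>R T (hs[i := v]))) \<and>
     ml_norm V j T < \<infinity>"

text \<open>
  \<open>Ck_with V k f D\<close>: the map \<open>f\<close> is \<open>C^k\<close> on \<open>V\<close> and \<open>D j x\<close> is its \<open>j\<close>-th Frechet derivative
  at \<open>x\<close> for \<open>j \<le> k\<close>.  Here \<open>D (Suc j)\<close> is the Frechet derivative of \<open>D j\<close>, as a map into the
  space of bounded \<open>j\<close>-linear maps with the operator norm; a linear map into that space is
  identified with a \<open>Suc j\<close>-linear map whose first argument is the direction of
  differentiation.  These conditions determine \<open>D j x\<close> on lists over \<open>V\<close> uniquely.
\<close>

definition Ck_with ::
  "'b::real_normed_vector set \<Rightarrow> nat \<Rightarrow> ('b \<Rightarrow> 'c::real_normed_vector)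
     \<Rightarrow> (nat \<Rightarrow> 'b \<Rightarrow> 'b list \<Rightarrow> 'c) \<Rightarrow> bool" where
  "Ck_with V k f D \<longleftrightarrow>
     (\<forall>x\<in>V. D 0 x [] = f x) \<and>
     (\<forall>j\<le>k. \<forall>x\<in>V. bounded_multilinear_on V j (D j x)) \<and>
     (\<forall>j<k. \<forall>x\<in>V. \<forall>\<epsilon>>0. \<forall>\<^sub>F y in at x within V.
        ml_norm V j (\<lambda>hs. D j y hs - D j x hs - D (Suc j) x ((y - x) # hs))
          \<le> ennreal (\<epsilon> * norm (y - x))) \<and>
     (\<forall>x\<in>V. ((\<lambda>y. ml_norm V k (\<lambda>hs. D k y hs - D k x hs)) \<longlongrightarrow> 0) (at x within V))"

definition Ck1 :: "'b::real_normed_vector set \<Rightarrow> nat \<Rightarrow> ('b \<Rightarrow> 'c::real_normed_vector) \<Rightarrow> bool" where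
  "Ck1 V k f \<longleftrightarrow>
     (\<exists>D. Ck_with V k f D \<and>
        (\<exists>B. \<forall>x\<in>V. \<forall>y\<in>V. ml_norm V k (\<lambda>hs. D k x hs - D k y hs) \<le> ennreal (B * norm (x - y))))"


section \<open>Admissible operators\<close>

definition total_variation :: "(real \<Rightarrow> 'b::real_normed_vector) \<Rightarrow> real \<Rightarrow> real \<Rightarrow> ennreal" where
  "total_variation g a b =
     (SUP \<D>\<in>{\<D>. \<D> division_of {a..b}}. \<Sum>K\<in>\<D>. ennreal (norm (g (Sup K) - g (Inf K))))"

text \<open>
  Riemann--Stieltjes integral of \<open>f\<close> against an operator-valued integrator \<open>g\<close>, as the limit of
  Riemann--Stieltjes sums when the mesh tends to zero.
\<close>

definition has_RS_integral ::
  "(real \<Rightarrow> 'a::real_normed_vector \<Rightarrow>\<^sub>L 'c::real_normed_vector) \<Rightarrow> (real \<Rightarrow> 'a)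
     \<Rightarrow> real \<Rightarrow> real \<Rightarrow> 'c \<Rightarrow> bool" where
  "has_RS_integral g f a b I \<longleftrightarrow>
     (\<forall>\<epsilon>>0. \<exists>d>0. \<forall>\<D>. \<D> tagged_division_of {a..b} \<and> (\<lambda>s. ball s d) fine \<D> \<longrightarrow>
        norm ((\<Sum>(s, K)\<in>\<D>. blinfun_apply (g (Sup K) - g (Inf K)) (f s)) - I) < \<epsilon>)"

text \<open>
  The \<open>n \<times> n\<close> matrices \<open>\<eta> t \<theta>\<close> are the (automatically bounded) linear endomorphisms of the
  \<open>n\<close>-dimensional space \<open>'a\<close>, with the operator norm.  Only the values of \<open>L t\<close> on
  \<open>phase_space r\<close> are constrained.
\<close>

definition admissible ::
  "real \<Rightarrow> (real \<Rightarrow> (real \<Rightarrow>\<^sub>C 'a) \<Rightarrow> 'a::real_normed_vector) \<Rightarrow> bool" where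
  "admissible r L \<longleftrightarrow>
     (\<exists>\<eta> :: real \<Rightarrow> real \<Rightarrow> 'a \<Rightarrow>\<^sub>L 'a.
        (\<lambda>(t, \<theta>). \<eta> t \<theta>) \<in> borel_measurable lebesgue \<and>
        (\<forall>t. \<forall>\<theta>\<le>-r. \<eta> t \<theta> = \<eta> t (-r)) \<and>
        (\<forall>t. \<forall>\<theta>\<ge>0. \<eta> t \<theta> = 0) \<and>
        (\<forall>t. \<forall>\<theta>\<in>{-r<..<0}. continuous (at_left \<theta>) (\<eta> t)) \<and>
        (\<exists>B::real. \<forall>t. total_variation (\<eta> t) (-r) 0 \<le> ennreal B) \<and>
        (\<forall>\<epsilon>::real. 0 < \<epsilon> \<longrightarrow> (\<exists>d>0. \<forall>t. total_variation (\<eta> t) (-d) 0 < ennreal \<epsilon>)) \<and>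
        (\<forall>t. \<forall>\<phi>\<in>phase_space r. has_RS_integral (\<eta> t) (apply_bcontfun \<phi>) (-r) 0 (L t \<phi>))) \<and>
     (\<forall>\<phi>\<in>phase_space r. continuous_on UNIV (\<lambda>t. L t \<phi>))"


section \<open>The equation\<close>

definition is_solution ::
  "real \<Rightarrow> (real \<Rightarrow> (real \<Rightarrow>\<^sub>C 'a) \<Rightarrow> 'a) \<Rightarrow> (real \<Rightarrow> (real \<Rightarrow>\<^sub>C 'a) \<Rightarrow> 'a)
     \<Rightarrow> (real \<Rightarrow> 'a::real_normed_vector) \<Rightarrow> bool" where
  "is_solution r L F x \<longleftrightarrow>
     continuous_on UNIV x \<and>
     (\<lambda>t. x t - L t (segment_at r x t)) C1_differentiable_on UNIV \<and>
     (\<forall>t. ((\<lambda>t. x t - L t (segment_at r x t)) has_vector_derivative F t (segment_at r x t)) (at t))"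


section \<open>The function \<open>H\<close> and its roots\<close>

definition H :: "real \<Rightarrow> real \<Rightarrow> real" where
  "H M x = x * exp (- x) - M * x"

text \<open>
  The smaller and the larger positive root of \<open>H M x = c\<close>; they are meaningful when there are
  exactly two positive roots, i.e. when \<open>0 < M < 1\<close> and \<open>0 < c\<close> is below the maximum of \<open>H M\<close>
  on the positive half-line.
\<close>

definition H_root1 :: "real \<Rightarrow> real \<Rightarrow> real" where
  "H_root1 M c = Min {x. 0 < x \<and> H M x = c}"

definition H_root2 :: "real \<Rightarrow> real \<Rightarrow> real" where
  "H_root2 M c = Max {x. 0 < x \<and> H M x = c}"

end

theory Submission
  imports Defs
begin

text \<open>
  The equation with the side condition at zero is equivalent to the integrated equation
  \<open>x(t) = \<xi> + L(t) x\<^sub>t + \<integral>\<^sub>0\<^sup>t F(s, x\<^sub>s) ds\<close>.  Measure \<open>x\<close> by the smallest \<open>B\<close> with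
  \<open>|x(t)| \<le> B exp(\<mu>|t|)\<close>.  A shift by at most \<open>r\<close> costs a factor \<open>exp(\<mu>r)\<close> and integration gains
  a factor \<open>1/\<mu>\<close>, so the right-hand side is a contraction with constant
  \<open>M exp(\<mu>r) + M\<^sub>1 exp(\<mu>r)/\<mu>\<close>.  With \<open>\<mu> = j\<lambda>\<close> and \<open>\<lambda> = x\<^sup>*/r\<close> this equals
  \<open>M exp(jx\<^sup>*) + M\<^sub>1 r exp(jx\<^sup>*)/(jx\<^sup>*)\<close>.  Since \<open>(k+1) x\<^sup>* < -ln M\<close>, the first summand is below one
  for all \<open>1 \<le> j \<le> k+1\<close>, and the second is as small as desired once \<open>r\<close> is small.  Hence one \<open>\<kappa> < 1\<close>
  serves all \<open>k+1\<close> weights.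

  Smoothness in \<open>\<xi>\<close> is obtained by constructing the derivatives instead of differentiating the fixed
  point.  If \<open>Y \<xi> hs\<close> denotes the derivative in the directions \<open>hs\<close>, with \<open>Y \<xi> []\<close> the solution
  itself, then formal differentiation of the integrated equation shows that, for nonempty \<open>hs\<close>,
  \<open>Y \<xi> hs\<close> has to solve a linear equation of the same kind: its top-order term is \<open>D\<^sub>2F(s, x\<^sub>s) Y(hs)\<^sub>s\<close>, and its
  inhomogeneity is a sum over set partitions of \<open>hs\<close> (the formula of Faa di Bruno) which involves
  derivatives of lower order only.  So these functions can be found one order after the other, the
  one of order \<open>j\<close> growing at most like \<open>exp(j\<lambda>|t|)\<close>; this is \<open>jet_exists\<close>.

  It remains to see that they really are derivatives.  All the required facts are bounds for
  functions \<open>z\<close> that satisfy \<open>z(t) = q + L(t) z\<^sub>t + \<integral>\<^sub>0\<^sup>t g(s) ds\<close> with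
  \<open>|g(s)| \<le> M\<^sub>1 |z\<^sub>s| + c exp(\<mu>|s|)\<close>, and \<open>weighted_bound\<close> turns such an inequality into a bound
  of \<open>z\<close> by a multiple of \<open>(|q| + c) exp(\<mu>|t|)\<close>.  It is applied to increments \<open>Y \<xi>' hs - Y \<xi> hs\<close>
  (weight \<open>j+1\<close>), to Taylor remainders \<open>Y (\<xi>+u) hs - Y \<xi> hs - Y \<xi> (u # hs)\<close> with
  \<open>c\<close> proportional to \<open>|u|\<^sup>2\<close> (weight \<open>j+2\<close>, for \<open>j < k\<close>), and to the defect of linearity in one
  direction (with \<open>c = 0\<close>).  The hypothesis on \<open>g\<close> comes in each case from a property of Faa di Bruno
  sums, \<open>faa_di_bruno_lipschitz\<close>, \<open>faa_di_bruno_taylor\<close> and \<open>rest_slot_linear\<close>, whose point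
  is that the unknown top-order quantity enters with the constant \<open>M\<^sub>1\<close> of the contraction
  and everything else with powers of quantities already estimated.
\<close>

section \<open>Bounded multilinear maps\<close>

text \<open>
  Recursion on the number of arguments lets estimates peel off the first argument: fixing it leaves
  a multilinear map of one argument less.  The usual slotwise description is \<open>mlin_iff_slots\<close>.
\<close>

primrec mlin :: "'b::real_normed_vector set \<Rightarrow> nat \<Rightarrow> ('b list \<Rightarrow> 'c::real_normed_vector) \<Rightarrow> bool" where
  "mlin V 0 T \<longleftrightarrow> True"
| "mlin V (Suc m) T \<longleftrightarrow> (\<forall>v\<in>V. mlin V m (\<lambda>vs. T (v # vs))) \<and>
     (\<forall>vs. length vs = m \<and> set vs \<subseteq> V \<longrightarrow>
        (\<forall>u\<in>V. \<forall>v\<in>V. \<forall>a b. T ((a *\<^sub>R u + b *\<^sub>R v) # vs) = a *\<^sub>R T (u # vs) + b *\<^sub>R T (v # vs)))"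

abbreviation nprod :: "'b::real_normed_vector list \<Rightarrow> real" where
  "nprod vs \<equiv> prod_list (map norm vs)"

definition bounded_mlin :: "'b::real_normed_vector set \<Rightarrow> nat \<Rightarrow> real \<Rightarrow> ('b list \<Rightarrow> 'c::real_normed_vector) \<Rightarrow> bool" where
  "bounded_mlin V m K T \<longleftrightarrow> mlin V m T \<and>
     (\<forall>vs. length vs = m \<and> set vs \<subseteq> V \<longrightarrow> norm (T vs) \<le> K * nprod vs)"

lemma nprod_nonneg: "0 \<le> nprod vs"
  by (induction vs) auto

lemma mlin_iff_slots:
  "mlin V m T \<longleftrightarrow> (\<forall>hs. length hs = m \<and> set hs \<subseteq> V \<longrightarrow>
        (\<forall>i<m. \<forall>u\<in>V. \<forall>v\<in>V. \<forall>a b.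
           T (hs[i := a *\<^sub>R u + b *\<^sub>R v]) = a *\<^sub>R T (hs[i := u]) + b *\<^sub>R T (hs[i := v])))"
proof (induction m arbitrary: T)
  case 0
  then show ?case by simp
next
  case (Suc m)
  show ?case (is "?L \<longleftrightarrow> ?R")
  proof
    assume L: ?L
    show ?R
    proof (intro allI impI ballI)
      fix hs i u v a b
      assume hs: "length hs = Suc m \<and> set hs \<subseteq> V" and i: "i < Suc m" and uv: "u \<in> V" "v \<in> V"
      obtain h hs' where [simp]: "hs = h # hs'" using hs by (cases hs) auto
      show "T (hs[i := a *\<^sub>R u + b *\<^sub>R v]) = a *\<^sub>R T (hs[i := u]) + b *\<^sub>R T (hs[i := v])"
      proof (cases i)
        case 0
        then show ?thesis using L hs uv by auto
      next
        case (Suc i')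
        have "mlin V m (\<lambda>vs. T (h # vs))" using L hs by auto
        then show ?thesis using Suc.IH[of "\<lambda>vs. T (h # vs)"] Suc hs i uv by auto
      qed
    qed
  next
    assume R: ?R
    have 1: "mlin V m (\<lambda>vs. T (v # vs))" if "v \<in> V" for v
      unfolding Suc.IH
    proof (intro allI impI ballI)
      fix hs i u w a b
      assume "length hs = m \<and> set hs \<subseteq> V" "i < m" "u \<in> V" "w \<in> V"
      then show "T (v # hs[i := a *\<^sub>R u + b *\<^sub>R w]) = a *\<^sub>R T (v # hs[i := u]) + b *\<^sub>R T (v # hs[i := w])"
        using R[rule_format, of "v # hs" "Suc i" u w a b] that by auto
    qed
    have "T ((a *\<^sub>R u + b *\<^sub>R v) # vs) = a *\<^sub>R T (u # vs) + b *\<^sub>R T (v # vs)"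
      if "length vs = m" "set vs \<subseteq> V" "u \<in> V" "v \<in> V" for vs u v a b
      using R[rule_format, of "u # vs" 0 u v a b] that by auto
    then show ?L using 1 by auto
  qed
qed

lemma bounded_multilinear_on_iff:
  "bounded_multilinear_on V m T \<longleftrightarrow> mlin V m T \<and> ml_norm V m T < \<infinity>"
  unfolding bounded_multilinear_on_def mlin_iff_slots by blast

lemma mlin_diff: "mlin V m S \<Longrightarrow> mlin V m T \<Longrightarrow> mlin V m (\<lambda>vs. S vs - T vs)"
  by (induction m arbitrary: S T) (simp_all add: algebra_simps)

lemma mlin_scale:
  assumes "subspace V"
  shows "mlin V (length hs) T \<Longrightarrow> set hs \<subseteq> V \<Longrightarrow> T (map (\<lambda>h. c h *\<^sub>R h) hs) = prod_list (map c hs) *\<^sub>R T hs"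
proof (induction hs arbitrary: T)
  case (Cons h hs)
  let ?hs = "map (\<lambda>h. c h *\<^sub>R h) hs"
  have V: "set ?hs \<subseteq> V" "h \<in> V" using Cons.prems assms by (auto simp: subspace_def)
  have "T ((c h *\<^sub>R h) # ?hs) = T ((c h *\<^sub>R h + 0 *\<^sub>R h) # ?hs)" by simp
  also have "\<dots> = c h *\<^sub>R T (h # ?hs) + 0 *\<^sub>R T (h # ?hs)"
    using Cons.prems(1) V by (simp del: scaleR_zero_left)
  also have "T (h # ?hs) = prod_list (map c hs) *\<^sub>R T (h # hs)"
    using Cons.IH[of "\<lambda>vs. T (h # vs)"] Cons.prems V by simp
  finally show ?case by simp
qed simp

lemma ml_norm_le:
  assumes "\<And>hs. length hs = m \<Longrightarrow> set hs \<subseteq> V \<Longrightarrow> norm (T hs) \<le> K * nprod hs" and "0 \<le> K"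
  shows "ml_norm V m T \<le> ennreal K"
  unfolding ml_norm_def
proof (rule SUP_least, rule ennreal_leI, clarify)
  fix hs assume hs: "\<forall>h\<in>set hs. h \<in> V \<and> norm h \<le> 1" "m = length hs"
  from hs(1) have "nprod hs \<le> 1"
    by (induction hs) (auto intro!: mult_le_one nprod_nonneg)
  then have "K * nprod hs \<le> K" using assms(2) by (simp add: mult_left_le)
  moreover have "norm (T hs) \<le> K * nprod hs" using hs by (intro assms) auto
  ultimately show "norm (T hs) \<le> K" by simp
qed

text \<open>
  Rescale every argument to norm one.  If some argument vanishes, so does the value, by homogeneity.
\<close>

lemma ml_norm_boundD:
  assumes "subspace V" and T: "mlin V m T" and K: "ml_norm V m T \<le> ennreal K" "0 \<le> K"
    and hs: "length hs = m" "set hs \<subseteq> V"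
  shows "norm (T hs) \<le> K * nprod hs"
proof -
  define us where "us = map (\<lambda>h. h /\<^sub>R norm h) hs"
  have us: "length us = m" "\<forall>u\<in>set us. u \<in> V \<and> norm u \<le> 1"
    using hs assms(1) by (auto simp: us_def subspace_def divide_simps)
  then have "ennreal (norm (T us)) \<le> ml_norm V m T"
    unfolding ml_norm_def by (intro SUP_upper) auto
  then have "ennreal (norm (T us)) \<le> ennreal K" using K(1) by simp
  then have b: "norm (T us) \<le> K" using K(2) by (simp add: ennreal_le_iff)
  have c: "T us = prod_list (map (\<lambda>h. inverse (norm h)) hs) *\<^sub>R T hs"
    unfolding us_def by (rule mlin_scale) (use assms in auto)
  have z: "prod_list (map (\<lambda>h. inverse (norm h)) hs) = inverse (nprod hs)"
    by (induction hs) auto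
  have zero: "T hs = 0" if "nprod hs = 0"
  proof -
    from that have "map (\<lambda>h. (if h = 0 then 0 else 1) *\<^sub>R h) hs = hs" by (intro map_idI) auto
    with mlin_scale[OF assms(1), of hs T "\<lambda>h. if h = 0 then 0 else 1"] T hs
    have "T hs = prod_list (map (\<lambda>h. if h = 0 then 0 else (1::real)) hs) *\<^sub>R T hs" by simp
    moreover have "prod_list (map (\<lambda>h. if h = 0 then 0 else (1::real)) hs) = 0"
      using that by (induction hs) auto
    ultimately show ?thesis by simp
  qed
  show ?thesis
  proof (cases "nprod hs = 0")
    case True
    then show ?thesis using zero by simp
  next
    case False
    then have "0 < nprod hs" using nprod_nonneg[of hs] by linarith
    then show ?thesis using b unfolding c z by (simp add: divide_simps)
  qed
qed

lemma bounded_mlin_bound: "bounded_mlin V m K T \<Longrightarrow> length vs = m \<Longrightarrow> set vs \<subseteq> V \<Longrightarrow> norm (T vs) \<le> K * nprod vs"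
  by (auto simp: bounded_mlin_def)

lemma bounded_mlin_Cons: "bounded_mlin V (Suc m) K T \<Longrightarrow> v \<in> V \<Longrightarrow> bounded_mlin V m (K * norm v) (\<lambda>vs. T (v # vs))"
  unfolding bounded_mlin_def
proof (intro conjI allI impI; elim conjE)
  fix vs assume "v \<in> V" "length vs = m" "set vs \<subseteq> V"
    and "\<forall>vs. length vs = Suc m \<and> set vs \<subseteq> V \<longrightarrow> norm (T vs) \<le> K * nprod vs"
  then show "norm (T (v # vs)) \<le> K * norm v * nprod vs"
    by (metis (no_types, lifting) insert_subset length_Cons list.map(2) list.simps(15)
        mult.assoc prod_list.Cons)
qed auto

lemma mlin_head_diff:
  assumes "mlin V (Suc m) T" "length vs = m" "set vs \<subseteq> V" "u \<in> V" "v \<in> V"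
  shows "T ((u - v) # vs) = T (u # vs) - T (v # vs)"
proof -
  have "T ((1 *\<^sub>R u + (-1) *\<^sub>R v) # vs) = 1 *\<^sub>R T (u # vs) + (-1) *\<^sub>R T (v # vs)"
    using assms by (auto simp only: mlin.simps)
  then show ?thesis by simp
qed

text \<open>
  Joint continuity of a family of multilinear maps follows from continuity for constant arguments:
  replacing the first argument by its limit changes the value by a null function, because the other
  arguments stay bounded, and then one argument less is moving.
\<close>

lemma bounded_mlin_tendsto:
  assumes sub: "subspace V" and "\<And>s. bounded_mlin V (length fs) K (T s)"
    and "\<And>vs. length vs = length fs \<Longrightarrow> set vs \<subseteq> V \<Longrightarrow> ((\<lambda>s. T s vs) \<longlongrightarrow> S vs) A"
    and "\<And>f. f \<in> set fs \<Longrightarrow> (f \<longlongrightarrow> l f) A"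
    and "\<And>f s. f \<in> set fs \<Longrightarrow> f s \<in> V" "\<And>f. f \<in> set fs \<Longrightarrow> l f \<in> V"
  shows "((\<lambda>s. T s (map (\<lambda>f. f s) fs)) \<longlongrightarrow> S (map l fs)) A"
  using assms(2-)
proof (induction fs arbitrary: T S K)
  case (Cons f fs)
  have V: "\<And>s. f s \<in> V" "l f \<in> V" "\<And>s. set (map (\<lambda>f. f s) fs) \<subseteq> V" using Cons.prems(4,5) by auto
  have 1: "((\<lambda>s. T s (l f # map (\<lambda>f. f s) fs)) \<longlongrightarrow> S (l f # map l fs)) A"
    using Cons.prems V
    by (intro Cons.IH[where T = "\<lambda>s vs. T s (l f # vs)" and S = "\<lambda>vs. S (l f # vs)" and K = "K * norm (l f)"])
       (auto intro!: bounded_mlin_Cons)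
  have npt: "((\<lambda>s. nprod (map (\<lambda>f. f s) fs)) \<longlongrightarrow> nprod (map l fs)) A"
    using Cons.prems(3) by (induction fs) (auto intro!: tendsto_intros)
  have 2: "((\<lambda>s. T s (f s # map (\<lambda>f. f s) fs) - T s (l f # map (\<lambda>f. f s) fs)) \<longlongrightarrow> 0) A"
  proof (rule Lim_null_comparison)
    show "\<forall>\<^sub>F s in A. norm (T s (f s # map (\<lambda>f. f s) fs) - T s (l f # map (\<lambda>f. f s) fs))
        \<le> \<bar>K\<bar> * (norm (f s - l f) * nprod (map (\<lambda>f. f s) fs))"
    proof (rule always_eventually, rule allI)
      fix s
      let ?v = "map (\<lambda>f. f s) fs"
      have V': "f s \<in> V" "l f \<in> V" "f s - l f \<in> V" "set ?v \<subseteq> V"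
        using Cons.prems(4,5) sub by (auto intro: subspace_diff)
      have T: "bounded_mlin V (Suc (length fs)) K (T s)" "mlin V (Suc (length fs)) (T s)"
        using Cons.prems(1) by (auto simp: bounded_mlin_def)
      have "norm (T s (f s # ?v) - T s (l f # ?v)) = norm (T s ((f s - l f) # ?v))"
        using V' by (subst mlin_head_diff[OF T(2)]) auto
      also have "\<dots> \<le> K * nprod ((f s - l f) # ?v)"
        using V' by (intro bounded_mlin_bound[OF T(1)]) auto
      also have "\<dots> \<le> \<bar>K\<bar> * (norm (f s - l f) * nprod ?v)"
        by (auto intro!: mult_right_mono mult_nonneg_nonneg nprod_nonneg simp del: map_map)
      finally show "norm (T s (f s # ?v) - T s (l f # ?v)) \<le> \<bar>K\<bar> * (norm (f s - l f) * nprod ?v)" .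
    qed
  qed (use Cons.prems(3)[of f] npt in \<open>auto intro!: tendsto_eq_intros LIM_zero\<close>)
  show ?case using tendsto_add[OF 2 1] by simp
qed simp

section \<open>Partitions of a list of directions\<close>

text \<open>
  The product rule: when \<open>D\<^sup>mF[g b\<^sub>1, \<dots>, g b\<^sub>m]\<close> is differentiated in the direction \<open>u\<close> without
  touching \<open>D\<^sup>mF\<close>, the direction joins one of the blocks \<open>b\<^sub>i\<close>.
\<close>

primrec ins_block :: "'x \<Rightarrow> 'x list list \<Rightarrow> 'x list list list" where
  "ins_block u [] = []"
| "ins_block u (b # p) = ((u # b) # p) # map ((#) b) (ins_block u p)"

text \<open>
  Partitions of the positions of a list into at least two blocks; they index the lower-order terms
  of the higher chain rule.  A further direction \<open>u\<close> either opens a block of its own, which raises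
  the order of the outer derivative, or joins a block.  The partition into a single block carries
  the derivative of highest order and is treated separately; differentiating its term yields
  the pair \<open>[u], hs\<close> of blocks and again a single block.
\<close>

primrec proper_partitions :: "'x list \<Rightarrow> 'x list list list" where
  "proper_partitions [] = []"
| "proper_partitions (u # hs) = (if hs = [] then [] else
     [[u], hs] # concat (map (\<lambda>p. ([u] # p) # ins_block u p) (proper_partitions hs)))"

lemma ins_block_props:
  "q \<in> set (ins_block u p) \<Longrightarrow> length q = length p \<and> mset (concat q) = add_mset u (mset (concat p)) \<and>
    (\<forall>b\<in>set q. b \<in> set p \<or> (\<exists>b'\<in>set p. b = u # b'))"
proof (induction p arbitrary: q)
  case (Cons b p)
  then consider "q = (u # b) # p" | q' where "q' \<in> set (ins_block u p)" "q = b # q'" by auto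
  then show ?case
  proof cases
    case 2
    then show ?thesis using Cons.IH[OF 2(1)] by auto
  qed auto
qed simp

lemma proper_partitions_props:
  "p \<in> set (proper_partitions hs) \<Longrightarrow> mset (concat p) = mset hs \<and> length p \<le> length hs \<and> 1 \<le> length p \<and>
     (\<forall>b\<in>set p. b \<noteq> [] \<and> length b < length hs)"
proof (induction hs arbitrary: p)
  case (Cons u hs)
  from Cons.prems have ne: "hs \<noteq> []" by (auto split: if_splits)
  then consider "p = [[u], hs]" | p' where "p' \<in> set (proper_partitions hs)" "p = [u] # p'"
    | p' where "p' \<in> set (proper_partitions hs)" "p \<in> set (ins_block u p')"
    using Cons.prems by (auto split: if_splits)
  then show ?case
  proof cases
    case 1
    then show ?thesis using ne by (cases hs) auto
  next
    case 2
    then show ?thesis using Cons.IH[OF 2(1)] ne by auto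
  next
    case 3
    have IH: "mset (concat p') = mset hs" "length p' \<le> length hs" "1 \<le> length p'"
      "\<And>b. b \<in> set p' \<Longrightarrow> b \<noteq> [] \<and> length b < length hs"
      using Cons.IH[OF 3(1)] by blast+
    have q: "length p = length p'" "mset (concat p) = add_mset u (mset (concat p'))"
      "\<And>b. b \<in> set p \<Longrightarrow> b \<in> set p' \<or> (\<exists>b'\<in>set p'. b = u # b')"
      using ins_block_props[OF 3(2)] by blast+
    have "b \<noteq> [] \<and> length b < length (u # hs)" if "b \<in> set p" for b
      using q(3)[OF that] IH(4) by fastforce
    then show ?thesis using IH(1-3) q(1,2) by simp
  qed
qed simp

lemma map_ins_block: "ins_block (f u) (map (map f) p) = map (map (map f)) (ins_block u p)"
  by (induction p) auto

text \<open>
  Partitions see positions, not entries.  Thus their number depends on the length alone, and any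
  list can be replaced by the list of its indices, whose entries are distinct.
\<close>

lemma map_proper_partitions: "proper_partitions (map f hs) = map (map (map f)) (proper_partitions hs)"
proof (induction hs)
  case (Cons u hs)
  have "concat (map (\<lambda>p. ([f u] # p) # ins_block (f u) p) (map (map (map f)) (proper_partitions hs))) =
     map (map (map f)) (concat (map (\<lambda>p. ([u] # p) # ins_block u p) (proper_partitions hs)))"
    by (simp add: map_concat comp_def map_ins_block[where f = f])
  then show ?case using Cons by simp
qed simp

definition num_partitions :: "nat \<Rightarrow> real" where "num_partitions j = real (length (proper_partitions [0..<j]))"

lemma length_proper_partitions: "real (length (proper_partitions hs)) = num_partitions (length hs)"
proof -
  have "length (proper_partitions (map ((!) hs) [0..<length hs])) = length (proper_partitions [0..<length hs])"
    by (simp only: map_proper_partitions length_map)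
  then show ?thesis by (simp only: map_nth num_partitions_def)
qed

text \<open>
  One factor \<open>w\<close> for each direction: bounds of order-\<open>j\<close> derivatives carry the weight \<open>w\<^sup>j\<close>, and the
  weights of the blocks of a partition multiply up to the weight of the whole list.
\<close>

definition wprod :: "real \<Rightarrow> 'x::real_normed_vector list \<Rightarrow> real" where
  "wprod w b = prod_list (map (\<lambda>h. w * norm h) b)"

lemma wprod_simps [simp]: "wprod w [] = 1" "wprod w (h # b) = (w * norm h) * wprod w b" "wprod w (b @ c) = wprod w b * wprod w c"
  by (auto simp: wprod_def)

lemma wprod_nonneg: "0 \<le> w \<Longrightarrow> 0 \<le> wprod w b"
  by (induction b) auto

lemma wprod_eq: "wprod w b = w ^ length b * nprod b"
  by (induction b) auto

lemma wprod_mset: "mset b = mset c \<Longrightarrow> wprod w b = wprod w c"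
proof -
  assume "mset b = mset c"
  then have "prod_mset (mset (map (\<lambda>h. w * norm h) b)) = prod_mset (mset (map (\<lambda>h. w * norm h) c))"
    by simp
  then show ?thesis unfolding wprod_def prod_mset_prod_list .
qed

lemma wprod_concat: "wprod w (concat p) = prod_list (map (wprod w) p)"
  by (induction p) auto

lemma wprod_proper_partitions: "p \<in> set (proper_partitions hs) \<Longrightarrow> prod_list (map (wprod w) p) = wprod w hs"
  using proper_partitions_props[of p hs] wprod_mset[of "concat p" hs w] by (simp add: wprod_concat)

lemma prod_list_scale: "prod_list (map (\<lambda>b. C * f b) p) = C ^ length p * prod_list (map f p)"
  for C :: real
  by (induction p) auto

lemma prod_list_le:
  fixes f g :: "'x \<Rightarrow> real"
  assumes "\<And>b. b \<in> set p \<Longrightarrow> 0 \<le> f b \<and> f b \<le> g b"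
  shows "0 \<le> prod_list (map f p) \<and> prod_list (map f p) \<le> prod_list (map g p)"
  using assms
proof (induction p)
  case (Cons b p)
  then have "0 \<le> prod_list (map f p)" "prod_list (map f p) \<le> prod_list (map g p)" "0 \<le> f b" "f b \<le> g b" by auto
  then show ?case by (auto intro!: mult_mono)
qed simp

section \<open>Multilinear maps along increments\<close>

text \<open>
  Exchange the arguments one after the other; each exchange costs one factor \<open>\<epsilon>\<close>.
\<close>

lemma bounded_mlin_lipschitz:
  assumes sub: "subspace V" and "bounded_mlin V (length p) K T" "0 \<le> K" "0 \<le> \<epsilon>"
    and "\<And>b. b \<in> set p \<Longrightarrow> g b \<in> V \<and> g' b \<in> V \<and> norm (g b) \<le> A b \<and> norm (g' b) \<le> A b \<and> norm (g' b - g b) \<le> \<epsilon> * A b"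
  shows "norm (T (map g' p) - T (map g p)) \<le> K * (real (length p) * \<epsilon> * prod_list (map A p))"
  using assms(2-)
proof (induction p arbitrary: T K)
  case (Cons b p)
  have b: "g b \<in> V" "g' b \<in> V" "g' b - g b \<in> V" "norm (g b) \<le> A b" "norm (g' b - g b) \<le> \<epsilon> * A b"
    using Cons.prems(4)[of b] sub by (auto intro: subspace_diff)
  have A0: "0 \<le> A b" using b(4) norm_ge_zero[of "g b"] by linarith
  have p: "0 \<le> nprod (map g' p) \<and> nprod (map g' p) \<le> prod_list (map A p)"
    using prod_list_le[of p "\<lambda>b. norm (g' b)" A] Cons.prems(4) by (auto simp: comp_def)
  have sp: "set (map g' p) \<subseteq> V" "set (map g p) \<subseteq> V" using Cons.prems(4) by auto
  have m: "bounded_mlin V (length p) (K * norm (g b)) (\<lambda>vs. T (g b # vs))"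
    using Cons.prems b by (intro bounded_mlin_Cons) auto
  have 1: "norm (T (g b # map g' p) - T (g b # map g p)) \<le> (K * norm (g b)) * (real (length p) * \<epsilon> * prod_list (map A p))"
    using Cons.prems m by (intro Cons.IH[of _ "\<lambda>vs. T (g b # vs)"]) auto
  also have "\<dots> \<le> (K * A b) * (real (length p) * \<epsilon> * prod_list (map A p))"
    using b Cons.prems p by (intro mult_right_mono mult_left_mono mult_nonneg_nonneg) auto
  finally have 1: "norm (T (g b # map g' p) - T (g b # map g p)) \<le> (K * A b) * (real (length p) * \<epsilon> * prod_list (map A p))" .
  have "T (g' b # map g' p) - T (g b # map g' p) = T ((g' b - g b) # map g' p)"
    using Cons.prems(1) b sp by (subst mlin_head_diff) (auto simp: bounded_mlin_def)
  then have "norm (T (g' b # map g' p) - T (g b # map g' p)) \<le> K * (norm (g' b - g b) * nprod (map g' p))"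
    using bounded_mlin_bound[OF Cons.prems(1), of "(g' b - g b) # map g' p"] b sp by (auto simp del: map_map)
  also have "\<dots> \<le> K * ((\<epsilon> * A b) * prod_list (map A p))"
    using b p Cons.prems A0 by (intro mult_left_mono mult_mono) auto
  finally have 2: "norm (T (g' b # map g' p) - T (g b # map g' p)) \<le> K * ((\<epsilon> * A b) * prod_list (map A p))" .
  have "norm (T (map g' (b # p)) - T (map g (b # p))) \<le>
    norm (T (g' b # map g' p) - T (g b # map g' p)) + norm (T (g b # map g' p) - T (g b # map g p))"
    using norm_triangle_ineq[of "T (g' b # map g' p) - T (g b # map g' p)" "T (g b # map g' p) - T (g b # map g p)"]
    by simp
  also have "\<dots> \<le> K * (real (length (b # p)) * \<epsilon> * prod_list (map A (b # p)))"
    using 1 2 by (simp add: algebra_simps)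
  finally show ?case .
qed simp

text \<open>
  The sum over \<open>ins_block u p\<close> is the first variation of \<open>T (map g p)\<close> when \<open>g (u # b)\<close> is the first
  variation of \<open>g b\<close>.  Splitting off the first argument leaves three errors of second order: the
  Taylor error of that argument, the product of its variation with the increment of the other
  arguments, and the error for the other arguments.  With \<open>m\<close> other arguments they contribute
  \<open>1\<close>, \<open>m\<close> and \<open>m\<^sup>2\<close>, together at most \<open>(m + 1)\<^sup>2\<close>.
\<close>

lemma bounded_mlin_taylor:
  assumes sub: "subspace V" and "bounded_mlin V (length p) K T" "0 \<le> K" "0 \<le> \<epsilon>"
    and "\<And>b. b \<in> set p \<Longrightarrow> g b \<in> V \<and> g' b \<in> V \<and> g (u # b) \<in> V \<and>
       norm (g b) \<le> A b \<and> norm (g' b) \<le> A b \<and> norm (g (u # b)) \<le> \<epsilon> * A b \<and>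
       norm (g' b - g b) \<le> \<epsilon> * A b \<and> norm (g' b - g b - g (u # b)) \<le> \<epsilon>\<^sup>2 * A b"
  shows "norm (T (map g' p) - T (map g p) - (\<Sum>q\<leftarrow>ins_block u p. T (map g q)))
     \<le> K * ((real (length p))\<^sup>2 * \<epsilon>\<^sup>2 * prod_list (map A p))"
  using assms(2-)
proof (induction p arbitrary: T K)
  case (Cons b p)
  have b: "g b \<in> V" "g' b \<in> V" "g (u # b) \<in> V" "g' b - g b \<in> V" "g' b - g b - g (u # b) \<in> V"
     "norm (g b) \<le> A b" "norm (g (u # b)) \<le> \<epsilon> * A b" "norm (g' b - g b - g (u # b)) \<le> \<epsilon>\<^sup>2 * A b"
    using Cons.prems(4)[of b] sub by (auto intro: subspace_diff)
  have A0: "0 \<le> A b" using b(6) norm_ge_zero[of "g b"] by linarith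
  have p: "0 \<le> nprod (map g' p) \<and> nprod (map g' p) \<le> prod_list (map A p)"
    using prod_list_le[of p "\<lambda>b. norm (g' b)" A] Cons.prems(4) by (auto simp: comp_def)
  let ?P = "prod_list (map A p)"
  have P: "0 \<le> ?P" using p by linarith
  have sp: "set (map g' p) \<subseteq> V" "set (map g p) \<subseteq> V" using Cons.prems(4) by auto
  have m: "bounded_mlin V (length p) (K * norm (g b)) (\<lambda>vs. T (g b # vs))"
    "bounded_mlin V (length p) (K * norm (g (u # b))) (\<lambda>vs. T (g (u # b) # vs))"
    using Cons.prems b by (auto intro!: bounded_mlin_Cons)
  have "norm (T (g b # map g' p) - T (g b # map g p) - (\<Sum>q\<leftarrow>ins_block u p. T (g b # map g q)))
     \<le> (K * norm (g b)) * ((real (length p))\<^sup>2 * \<epsilon>\<^sup>2 * ?P)"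
    using Cons.prems m by (intro Cons.IH[of _ "\<lambda>vs. T (g b # vs)"]) auto
  also have "\<dots> \<le> (K * A b) * ((real (length p))\<^sup>2 * \<epsilon>\<^sup>2 * ?P)"
    using b Cons.prems P by (intro mult_right_mono mult_left_mono mult_nonneg_nonneg) auto
  finally have 1: "norm (T (g b # map g' p) - T (g b # map g p) - (\<Sum>q\<leftarrow>ins_block u p. T (g b # map g q)))
     \<le> (K * A b) * ((real (length p))\<^sup>2 * \<epsilon>\<^sup>2 * ?P)" .
  have "norm (T (g (u # b) # map g' p) - T (g (u # b) # map g p)) \<le> (K * norm (g (u # b))) * (real (length p) * \<epsilon> * ?P)"
    using Cons.prems m by (intro bounded_mlin_lipschitz[OF sub, of _ _ "\<lambda>vs. T (g (u # b) # vs)"]) auto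
  also have "\<dots> \<le> (K * (\<epsilon> * A b)) * (real (length p) * \<epsilon> * ?P)"
    using b Cons.prems P by (intro mult_right_mono mult_left_mono mult_nonneg_nonneg) auto
  finally have 2: "norm (T (g (u # b) # map g' p) - T (g (u # b) # map g p)) \<le> (K * (\<epsilon> * A b)) * (real (length p) * \<epsilon> * ?P)" .
  have lin: "T (g' b # map g' p) - T (g b # map g' p) - T (g (u # b) # map g' p) = T ((g' b - g b - g (u # b)) # map g' p)"
    using Cons.prems(1) b sp by (simp add: mlin_head_diff[where V = V and m = "length p"] bounded_mlin_def del: mlin.simps)
  have "norm (T ((g' b - g b - g (u # b)) # map g' p)) \<le> K * (norm (g' b - g b - g (u # b)) * nprod (map g' p))"
    using bounded_mlin_bound[OF Cons.prems(1), of "(g' b - g b - g (u # b)) # map g' p"] b sp by (auto simp del: map_map)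
  also have "\<dots> \<le> K * ((\<epsilon>\<^sup>2 * A b) * ?P)"
    using b p Cons.prems A0 by (intro mult_left_mono mult_mono) auto
  finally have 3: "norm (T ((g' b - g b - g (u # b)) # map g' p)) \<le> K * ((\<epsilon>\<^sup>2 * A b) * ?P)" .
  have "T (map g' (b # p)) - T (map g (b # p)) - (\<Sum>q\<leftarrow>ins_block u (b # p). T (map g q)) =
     (T (g b # map g' p) - T (g b # map g p) - (\<Sum>q\<leftarrow>ins_block u p. T (g b # map g q)))
     + (T (g (u # b) # map g' p) - T (g (u # b) # map g p)) + T ((g' b - g b - g (u # b)) # map g' p)"
    by (simp add: comp_def flip: lin)
  then have "norm (T (map g' (b # p)) - T (map g (b # p)) - (\<Sum>q\<leftarrow>ins_block u (b # p). T (map g q)))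
    \<le> (K * A b) * ((real (length p))\<^sup>2 * \<epsilon>\<^sup>2 * ?P) + (K * (\<epsilon> * A b)) * (real (length p) * \<epsilon> * ?P) + K * ((\<epsilon>\<^sup>2 * A b) * ?P)"
    using 1 2 3 by (smt (verit) norm_triangle_ineq)
  also have "\<dots> = (real (length p)^2 + real (length p) + 1) * (K * A b * \<epsilon>\<^sup>2 * ?P)"
    by (simp add: algebra_simps power2_eq_square)
  also have "\<dots> \<le> (real (length (b # p)))\<^sup>2 * (K * A b * \<epsilon>\<^sup>2 * ?P)"
    using P A0 Cons.prems by (intro mult_right_mono mult_nonneg_nonneg) (auto simp: power2_eq_square algebra_simps)
  finally show ?case by (simp add: algebra_simps)
qed simp

section \<open>The formula of Faa di Bruno\<close>

text \<open>
  Let \<open>D m\<close> be the \<open>m\<close>-th derivative of a map \<open>F\<close>, and let \<open>g hs\<close> be the value in the directions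
  \<open>hs\<close> of a derivative of a map into the domain of \<open>F\<close>, \<open>g []\<close> being the point itself.  Then
  \<open>faa_di_bruno D g hs\<close> is the derivative of the composition in the directions \<open>hs\<close>.  Writing it for an
  arbitrary function \<open>g\<close> of lists makes sense of it before \<open>g\<close> is known to consist of derivatives.
\<close>

definition faa_di_bruno_rest :: "(nat \<Rightarrow> 'b \<Rightarrow> 'b list \<Rightarrow> 'c::real_normed_vector) \<Rightarrow> ('x list \<Rightarrow> 'b) \<Rightarrow> 'x list \<Rightarrow> 'c" where
  "faa_di_bruno_rest D g hs = (\<Sum>p\<leftarrow>proper_partitions hs. D (length p) (g []) (map g p))"

definition faa_di_bruno :: "(nat \<Rightarrow> 'b \<Rightarrow> 'b list \<Rightarrow> 'c::real_normed_vector) \<Rightarrow> ('x list \<Rightarrow> 'b) \<Rightarrow> 'x list \<Rightarrow> 'c" where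
  "faa_di_bruno D g hs = (if hs = [] then D 0 (g []) [] else D 1 (g []) [g hs] + faa_di_bruno_rest D g hs)"

lemma norm_sum_list_le:
  fixes f :: "'p \<Rightarrow> 'c::real_normed_vector"
  assumes "\<And>p. p \<in> set ps \<Longrightarrow> norm (f p) \<le> B"
  shows "norm (\<Sum>p\<leftarrow>ps. f p) \<le> real (length ps) * B"
  using assms
proof (induction ps)
  case (Cons p ps)
  then show ?case using norm_triangle_mono[of "f p" B "\<Sum>p\<leftarrow>ps. f p" "real (length ps) * B"]
    by (auto simp: algebra_simps)
qed simp

lemma sum_list_diff: "(\<Sum>p\<leftarrow>ps. f p) - (\<Sum>p\<leftarrow>ps. g p) = (\<Sum>p\<leftarrow>ps. f p - g p)" for f :: "'p \<Rightarrow> 'c::ab_group_add"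
  by (induction ps) auto

lemma sum_list_concat: "(\<Sum>q\<leftarrow>concat pss. f q) = (\<Sum>ps\<leftarrow>pss. \<Sum>q\<leftarrow>ps. f q)" for f :: "'p \<Rightarrow> 'c::monoid_add"
  by (induction pss) auto

text \<open>
  The quantitative content of a map with bounded and Lipschitz derivatives up to order \<open>k\<close>.  The
  first-order constant \<open>K1\<close> is kept apart from the common constant \<open>K\<close>: it decides whether the
  equation is contractive, whereas \<open>K\<close> only enters constants that may be large.
\<close>

locale tower =
  fixes V :: "'b::real_normed_vector set" and k :: nat
    and D :: "nat \<Rightarrow> 'b \<Rightarrow> 'b list \<Rightarrow> 'c::real_normed_vector" and K K1 :: real
  assumes sub: "subspace V" and k1: "1 \<le> k" and K0: "0 \<le> K" "0 \<le> K1"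
    and bounded_mlin: "1 \<le> m \<Longrightarrow> m \<le> k \<Longrightarrow> \<phi> \<in> V \<Longrightarrow> bounded_mlin V m K (D m \<phi>)"
    and bound1: "\<phi> \<in> V \<Longrightarrow> v \<in> V \<Longrightarrow> norm (D 1 \<phi> [v]) \<le> K1 * norm v"
    and lip0: "\<phi> \<in> V \<Longrightarrow> \<psi> \<in> V \<Longrightarrow> norm (D 0 \<psi> [] - D 0 \<phi> []) \<le> K1 * norm (\<psi> - \<phi>)"
    and lip: "1 \<le> m \<Longrightarrow> m \<le> k \<Longrightarrow> \<phi> \<in> V \<Longrightarrow> \<psi> \<in> V \<Longrightarrow> length vs = m \<Longrightarrow> set vs \<subseteq> V \<Longrightarrow>
       norm (D m \<psi> vs - D m \<phi> vs) \<le> K * norm (\<psi> - \<phi>) * nprod vs"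
    and tay: "m < k \<Longrightarrow> \<phi> \<in> V \<Longrightarrow> \<psi> \<in> V \<Longrightarrow> length vs = m \<Longrightarrow> set vs \<subseteq> V \<Longrightarrow>
       norm (D m \<psi> vs - D m \<phi> vs - D (Suc m) \<phi> ((\<psi> - \<phi>) # vs)) \<le> K * (norm (\<psi> - \<phi>))\<^sup>2 * nprod vs"
begin

lemma prod_bound:
  assumes "1 \<le> C" "0 \<le> w" "p \<in> set (proper_partitions hs)" "length hs \<le> k"
  shows "prod_list (map (\<lambda>b. C * wprod w b) p) = C ^ length p * wprod w hs"
    and "C ^ length p * wprod w hs \<le> C ^ k * wprod w hs"
proof -
  show "prod_list (map (\<lambda>b. C * wprod w b) p) = C ^ length p * wprod w hs"
    using wprod_proper_partitions[OF assms(3)] by (simp add: prod_list_scale)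
  show "C ^ length p * wprod w hs \<le> C ^ k * wprod w hs"
    using proper_partitions_props[OF assms(3)] assms
    by (intro mult_right_mono power_increasing wprod_nonneg) auto
qed

text \<open>
  Every block contributes a factor \<open>C\<close> and its weight, and the weights multiply up to that of \<open>hs\<close>.
\<close>

lemma rest_bound:
  assumes C: "1 \<le> C" "0 \<le> w" and hs: "length hs \<le> k"
    and g: "g [] \<in> V" "\<And>b. b \<noteq> [] \<Longrightarrow> length b < length hs \<Longrightarrow> g b \<in> V \<and> norm (g b) \<le> C * wprod w b"
  shows "norm (faa_di_bruno_rest D g hs) \<le> num_partitions (length hs) * (K * C ^ k * wprod w hs)"
  unfolding faa_di_bruno_rest_def length_proper_partitions[symmetric]
proof (rule norm_sum_list_le)
  fix p assume p: "p \<in> set (proper_partitions hs)"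
  note pp = proper_partitions_props[OF p]
  have gp: "\<And>b. b \<in> set p \<Longrightarrow> g b \<in> V \<and> norm (g b) \<le> C * wprod w b" using pp g by auto
  have "norm (D (length p) (g []) (map g p)) \<le> K * nprod (map g p)"
    using pp hs g gp by (intro bounded_mlin_bound[OF bounded_mlin]) auto
  also have "\<dots> \<le> K * prod_list (map (\<lambda>b. C * wprod w b) p)"
    using prod_list_le[of p "\<lambda>b. norm (g b)" "\<lambda>b. C * wprod w b"] gp K0
    by (intro mult_left_mono) (auto simp: comp_def)
  also have "\<dots> \<le> K * C ^ k * wprod w hs"
    using prod_bound[OF C p hs] K0 by (auto simp: mult.assoc intro: mult_left_mono)
  finally show "norm (D (length p) (g []) (map g p)) \<le> K * C ^ k * wprod w hs" .
qed

lemma D1_diff: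
  "\<phi> \<in> V \<Longrightarrow> u \<in> V \<Longrightarrow> v \<in> V \<Longrightarrow> D 1 \<phi> [u - v] = D 1 \<phi> [u] - D 1 \<phi> [v]"
  using bounded_mlin[of 1 \<phi>] k1 mlin_head_diff[of V 0 "D 1 \<phi>" "[]" u v] by (auto simp: bounded_mlin_def)

lemma term_lipschitz:
  assumes C: "1 \<le> C" "0 \<le> w" and hs: "length hs \<le> k" and e: "0 \<le> \<epsilon>"
    and g0: "g [] \<in> V" "g' [] \<in> V" "norm (g' [] - g []) \<le> C * \<epsilon>"
    and g: "\<And>b. b \<noteq> [] \<Longrightarrow> length b < length hs \<Longrightarrow> g b \<in> V \<and> g' b \<in> V \<and>
       norm (g b) \<le> C * wprod w b \<and> norm (g' b) \<le> C * wprod w b \<and> norm (g' b - g b) \<le> \<epsilon> * (C * wprod w b)"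
    and p: "p \<in> set (proper_partitions hs)"
  shows "norm (D (length p) (g' []) (map g' p) - D (length p) (g []) (map g p))
     \<le> K * (real k + 1) * C ^ (k + 1) * (\<epsilon> * wprod w hs)"
proof -
  note pp = proper_partitions_props[OF p]
  let ?A = "\<lambda>b. C * wprod w b" and ?m = "length p"
  have gp: "\<And>b. b \<in> set p \<Longrightarrow> g b \<in> V \<and> g' b \<in> V \<and>
       norm (g b) \<le> ?A b \<and> norm (g' b) \<le> ?A b \<and> norm (g' b - g b) \<le> \<epsilon> * ?A b" using pp g by auto
  have m: "1 \<le> ?m" "?m \<le> k" using pp hs by auto
  have P: "0 \<le> nprod (map g' p) \<and> nprod (map g' p) \<le> C ^ ?m * wprod w hs"
    using prod_list_le[of p "\<lambda>b. norm (g' b)" ?A] gp prod_bound(1)[OF C p hs] by (auto simp: comp_def)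
  have 1: "norm (D ?m (g []) (map g' p) - D ?m (g []) (map g p)) \<le> K * (real ?m * \<epsilon> * (C ^ ?m * wprod w hs))"
    unfolding prod_bound(1)[OF C p hs, symmetric]
    using m g0 gp K0 e by (intro bounded_mlin_lipschitz[OF sub bounded_mlin]) auto
  have "norm (D ?m (g' []) (map g' p) - D ?m (g []) (map g' p)) \<le> K * norm (g' [] - g []) * nprod (map g' p)"
    using m g0 gp by (intro lip) auto
  also have "\<dots> \<le> K * (C * \<epsilon>) * (C ^ ?m * wprod w hs)"
    using P g0 K0 C e by (intro mult_mono mult_left_mono mult_nonneg_nonneg) auto
  finally have "norm (D ?m (g' []) (map g' p) - D ?m (g []) (map g p)) \<le>
     K * (C * \<epsilon>) * (C ^ ?m * wprod w hs) + K * (real ?m * \<epsilon> * (C ^ ?m * wprod w hs))"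
    using 1 norm_triangle_ineq[of "D ?m (g' []) (map g' p) - D ?m (g []) (map g' p)"
        "D ?m (g []) (map g' p) - D ?m (g []) (map g p)"] by simp
  also have "\<dots> = K * (C + real ?m) * (\<epsilon> * (C ^ ?m * wprod w hs))" by (simp add: algebra_simps)
  also have "\<dots> \<le> K * ((real k + 1) * C) * (\<epsilon> * (C ^ k * wprod w hs))"
  proof (intro mult_mono mult_left_mono)
    have "real ?m \<le> real k * C" using m C by (metis mult_left_mono mult_1_right of_nat_0_le_iff of_nat_mono order_trans)
    then show "C + real ?m \<le> (real k + 1) * C" by (simp add: algebra_simps)
  qed (use K0 C e wprod_nonneg[OF C(2)] m in \<open>auto intro!: mult_nonneg_nonneg power_increasing\<close>)
  finally show ?thesis by (simp add: algebra_simps)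
qed

text \<open>
  The increment of \<open>g\<close> at \<open>hs\<close> itself, the highest order present, is an argument of the first
  derivative in the one-block term, or the increment of the point if \<open>hs\<close> is empty; either way it
  enters with the factor \<open>K1\<close>.  All other increments have lower order and are known.
\<close>

lemma faa_di_bruno_lipschitz:
  assumes C: "1 \<le> C" "0 \<le> w" and hs: "length hs \<le> k" and e: "0 \<le> \<epsilon>"
    and gV: "\<And>b. length b \<le> length hs \<Longrightarrow> g b \<in> V \<and> g' b \<in> V"
    and gb: "\<And>b. b \<noteq> [] \<Longrightarrow> length b \<le> length hs \<Longrightarrow> norm (g b) \<le> C * wprod w b \<and> norm (g' b) \<le> C * wprod w b"
    and gl: "\<And>b. length b < length hs \<Longrightarrow> norm (g' b - g b) \<le> \<epsilon> * (C * wprod w b)"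
  shows "norm (faa_di_bruno D g' hs - faa_di_bruno D g hs) \<le> K1 * norm (g' hs - g hs) +
     (num_partitions (length hs) + 1) * (K * (real k + 1) * C ^ (k + 1)) * (\<epsilon> * wprod w hs)"
proof (cases "hs = []")
  case True
  have "0 \<le> (num_partitions (length hs) + 1) * (K * (real k + 1) * C ^ (k + 1)) * (\<epsilon> * wprod w hs)"
    using K0 C e wprod_nonneg[OF C(2)] by (auto simp: num_partitions_def intro!: mult_nonneg_nonneg)
  then show ?thesis using True lip0[of "g []" "g' []"] gV[of "[]"] by (simp add: faa_di_bruno_def)
next
  case False
  let ?B = "K * (real k + 1) * C ^ (k + 1)"
  note W0 = wprod_nonneg[OF C(2)]
  have g0: "norm (g' [] - g []) \<le> C * \<epsilon>" using gl[of "[]"] False by (simp add: mult.commute)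
  have r: "norm (faa_di_bruno_rest D g' hs - faa_di_bruno_rest D g hs) \<le> num_partitions (length hs) * (?B * (\<epsilon> * wprod w hs))"
    unfolding faa_di_bruno_rest_def length_proper_partitions[symmetric] sum_list_diff
    using assms g0 by (intro norm_sum_list_le term_lipschitz) auto
  have V: "g hs \<in> V" "g' hs \<in> V" "g [] \<in> V" "g' [] \<in> V" "g' hs - g hs \<in> V"
    using gV sub by (auto intro: subspace_diff)
  have "D 1 (g' []) [g' hs] - D 1 (g []) [g hs] = D 1 (g []) [g' hs - g hs] + (D 1 (g' []) [g' hs] - D 1 (g []) [g' hs])"
    using V by (simp only: D1_diff) simp
  moreover have "norm (D 1 (g []) [g' hs - g hs]) \<le> K1 * norm (g' hs - g hs)"
    using V by (intro bound1) auto
  moreover have "norm (D 1 (g' []) [g' hs] - D 1 (g []) [g' hs]) \<le> ?B * (\<epsilon> * wprod w hs)"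
  proof -
    have "norm (D 1 (g' []) [g' hs] - D 1 (g []) [g' hs]) \<le> K * norm (g' [] - g []) * nprod [g' hs]"
      using V k1 by (intro lip) auto
    also have "\<dots> \<le> K * (C * \<epsilon>) * (C * wprod w hs)"
      using g0 gb[of hs] False C e K0 by (auto intro!: mult_mono)
    also have "\<dots> = (K * 1 * C ^ 2) * (\<epsilon> * wprod w hs)" by (simp add: power2_eq_square)
    also have "\<dots> \<le> ?B * (\<epsilon> * wprod w hs)"
      using K0 C e W0 k1 by (intro mult_mono power_increasing) auto
    finally show ?thesis .
  qed
  ultimately have "norm (D 1 (g' []) [g' hs] - D 1 (g []) [g hs]) \<le> K1 * norm (g' hs - g hs) + ?B * (\<epsilon> * wprod w hs)"
    by (smt (verit) norm_triangle_ineq)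
  moreover have "faa_di_bruno D g' hs - faa_di_bruno D g hs = (D 1 (g' []) [g' hs] - D 1 (g []) [g hs]) + (faa_di_bruno_rest D g' hs - faa_di_bruno_rest D g hs)"
    using False by (simp add: faa_di_bruno_def)
  ultimately have "norm (faa_di_bruno D g' hs - faa_di_bruno D g hs) \<le> (K1 * norm (g' hs - g hs) + ?B * (\<epsilon> * wprod w hs)) + num_partitions (length hs) * (?B * (\<epsilon> * wprod w hs))"
    using r by (smt (verit) norm_triangle_ineq)
  then show ?thesis by (simp add: algebra_simps)
qed

text \<open>
  Varying one term of the sum: the outer derivative is expanded at \<open>g []\<close>, the increment of \<open>g []\<close> is
  replaced by its first variation \<open>g [u]\<close>, the arguments of the resulting term are frozen, and the
  inner product is expanded by \<open>bounded_mlin_taylor\<close>.  Each of the four errors is of second order.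
\<close>

lemma term_taylor:
  assumes C: "1 \<le> C" "0 \<le> w" and hs: "length hs < k" and e: "0 \<le> \<epsilon>"
    and gV: "\<And>b. length b \<le> length hs \<Longrightarrow> g b \<in> V \<and> g' b \<in> V \<and> g (u # b) \<in> V"
    and gb: "\<And>b. b \<noteq> [] \<Longrightarrow> length b \<le> length hs \<Longrightarrow> norm (g b) \<le> C * wprod w b \<and> norm (g' b) \<le> C * wprod w b"
    and gu: "\<And>b. length b \<le> length hs \<Longrightarrow> norm (g (u # b)) \<le> \<epsilon> * (C * wprod w b)"
    and gl: "\<And>b. length b \<le> length hs \<Longrightarrow> norm (g' b - g b) \<le> \<epsilon> * (C * wprod w b)"
    and gt: "\<And>b. length b < length hs \<Longrightarrow> norm (g' b - g b - g (u # b)) \<le> \<epsilon>\<^sup>2 * (C * wprod w b)"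
    and p: "p \<in> set (proper_partitions hs)"
  shows "norm (D (length p) (g' []) (map g' p) - D (length p) (g []) (map g p)
       - (\<Sum>q\<leftarrow>([u] # p) # ins_block u p. D (length q) (g []) (map g q)))
     \<le> K * (real k + 2)\<^sup>2 * C ^ (k + 2) * (\<epsilon>\<^sup>2 * wprod w hs)"
proof -
  note pp = proper_partitions_props[OF p]
  let ?A = "\<lambda>b. C * wprod w b" and ?m = "length p" and ?v = "map g p" and ?v' = "map g' p"
  let ?P = "C ^ ?m * wprod w hs"
  have ne: "hs \<noteq> []" using p by auto
  have m: "1 \<le> ?m" "?m \<le> k" "?m < k" "Suc ?m \<le> k" using pp hs by auto
  have gp: "g b \<in> V \<and> g' b \<in> V \<and> g (u # b) \<in> V \<and>
       norm (g b) \<le> ?A b \<and> norm (g' b) \<le> ?A b \<and> norm (g (u # b)) \<le> \<epsilon> * ?A b \<and>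
       norm (g' b - g b) \<le> \<epsilon> * ?A b \<and> norm (g' b - g b - g (u # b)) \<le> \<epsilon>\<^sup>2 * ?A b" if "b \<in> set p" for b
    using pp that gV[of b] gb[of b] gu[of b] gl[of b] gt[of b] by auto
  have hs': "length hs \<le> k" using hs by simp
  note pb = prod_bound[OF C p hs']
  have P: "0 \<le> nprod ?v'" "nprod ?v' \<le> ?P"
    using prod_list_le[of p "\<lambda>b. norm (g' b)" ?A] gp pb(1) by (auto simp: comp_def)
  have P0: "0 \<le> ?P" using P by linarith
  define d where "d = g' [] - g []"
  define z where "z = d - g [u]"
  have V: "g [] \<in> V" "g' [] \<in> V" "g [u] \<in> V" "d \<in> V" "z \<in> V" "set ?v' \<subseteq> V" "set ?v \<subseteq> V"
    using gV[of "[]"] sub gp by (auto simp: d_def z_def intro!: subspace_diff)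
  have d: "norm d \<le> C * \<epsilon>" and gu1: "norm (g [u]) \<le> C * \<epsilon>" and z: "norm z \<le> C * \<epsilon>\<^sup>2"
    using gl[of "[]"] gu[of "[]"] gt[of "[]"] ne by (auto simp: d_def z_def mult.commute)
  note M = bounded_mlin[OF m(1,2) V(1)] and M' = bounded_mlin[of "Suc ?m", OF _ m(4) V(1)]
  \<comment> \<open>The four errors in turn: outer Taylor error, increment against first variation of the point,
      freezing of the arguments, inner product rule.\<close>
  have a: "norm (D ?m (g' []) ?v' - D ?m (g []) ?v' - D (Suc ?m) (g []) (d # ?v')) \<le> K * C\<^sup>2 * (\<epsilon>\<^sup>2 * ?P)"
  proof -
    have "norm (D ?m (g' []) ?v' - D ?m (g []) ?v' - D (Suc ?m) (g []) (d # ?v')) \<le> K * (norm d)\<^sup>2 * nprod ?v'"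
      unfolding d_def using m V by (intro tay) auto
    also have "\<dots> \<le> K * (C * \<epsilon>)\<^sup>2 * ?P"
      using P d K0 C e by (intro mult_mono mult_left_mono power_mono) auto
    finally show ?thesis by (simp add: power_mult_distrib)
  qed
  have b: "norm (D (Suc ?m) (g []) (z # ?v')) \<le> K * C * (\<epsilon>\<^sup>2 * ?P)"
  proof -
    have "norm (D (Suc ?m) (g []) (z # ?v')) \<le> K * (norm z * nprod ?v')"
      using bounded_mlin_bound[OF M', of "z # ?v'"] V by (auto simp del: map_map)
    also have "\<dots> \<le> K * ((C * \<epsilon>\<^sup>2) * ?P)"
      using P z K0 C e by (intro mult_mono mult_left_mono) auto
    finally show ?thesis by (simp add: mult.assoc)
  qed
  have c: "norm (D (Suc ?m) (g []) (g [u] # ?v') - D (Suc ?m) (g []) (g [u] # ?v)) \<le> K * (C * real ?m) * (\<epsilon>\<^sup>2 * ?P)"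
  proof -
    have "norm (D (Suc ?m) (g []) (g [u] # ?v') - D (Suc ?m) (g []) (g [u] # ?v))
        \<le> K * norm (g [u]) * (real ?m * \<epsilon> * prod_list (map ?A p))"
      using V gp K0 e by (intro bounded_mlin_lipschitz[OF sub bounded_mlin_Cons[OF M']]) auto
    also have "\<dots> \<le> K * (C * \<epsilon>) * (real ?m * \<epsilon> * ?P)"
      unfolding pb(1) using gu1 K0 C e P0 by (intro mult_right_mono mult_left_mono) auto
    finally show ?thesis by (simp add: power2_eq_square algebra_simps)
  qed
  have t: "norm (D ?m (g []) ?v' - D ?m (g []) ?v - (\<Sum>q\<leftarrow>ins_block u p. D ?m (g []) (map g q)))
     \<le> K * (real ?m)\<^sup>2 * (\<epsilon>\<^sup>2 * ?P)"
    using bounded_mlin_taylor[OF sub M K0(1) e, where A = ?A and g = g and g' = g' and u = u] gp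
    by (simp add: pb(1) mult.assoc)
  have "D (Suc ?m) (g []) (d # ?v') = D (Suc ?m) (g []) (z # ?v') + D (Suc ?m) (g []) (g [u] # ?v')"
    unfolding z_def using M' V by (subst mlin_head_diff[where V = V and m = ?m]) (auto simp: bounded_mlin_def)
  moreover have "(\<Sum>q\<leftarrow>ins_block u p. D (length q) (g []) (map g q)) = (\<Sum>q\<leftarrow>ins_block u p. D ?m (g []) (map g q))"
    using ins_block_props[of _ u p] by (intro arg_cong[where f = sum_list] map_cong) auto
  ultimately have "D ?m (g' []) ?v' - D ?m (g []) ?v - (\<Sum>q\<leftarrow>([u] # p) # ins_block u p. D (length q) (g []) (map g q)) =
     (D ?m (g' []) ?v' - D ?m (g []) ?v' - D (Suc ?m) (g []) (d # ?v')) + D (Suc ?m) (g []) (z # ?v') +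
     (D (Suc ?m) (g []) (g [u] # ?v') - D (Suc ?m) (g []) (g [u] # ?v)) +
     (D ?m (g []) ?v' - D ?m (g []) ?v - (\<Sum>q\<leftarrow>ins_block u p. D ?m (g []) (map g q)))"
    by simp
  then have "norm (D ?m (g' []) ?v' - D ?m (g []) ?v - (\<Sum>q\<leftarrow>([u] # p) # ins_block u p. D (length q) (g []) (map g q)))
     \<le> K * C\<^sup>2 * (\<epsilon>\<^sup>2 * ?P) + K * C * (\<epsilon>\<^sup>2 * ?P) + K * (C * real ?m) * (\<epsilon>\<^sup>2 * ?P) + K * (real ?m)\<^sup>2 * (\<epsilon>\<^sup>2 * ?P)"
    using a b c t by (smt (verit) norm_triangle_ineq)
  also have "\<dots> = K * (C\<^sup>2 + C + C * real ?m + (real ?m)\<^sup>2) * (\<epsilon>\<^sup>2 * ?P)" by (simp add: algebra_simps)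
  also have "\<dots> \<le> K * ((real k + 2)\<^sup>2 * C\<^sup>2) * (\<epsilon>\<^sup>2 * (C ^ k * wprod w hs))"
  proof (intro mult_mono mult_left_mono)
    have "C \<le> C\<^sup>2" "1 \<le> C\<^sup>2" using C by (auto simp: power2_eq_square mult_ge1_I)
    have "C * real ?m \<le> C\<^sup>2 * real ?m" using \<open>C \<le> C\<^sup>2\<close> by (intro mult_right_mono) auto
    moreover have "(real ?m)\<^sup>2 \<le> C\<^sup>2 * (real ?m)\<^sup>2" using \<open>1 \<le> C\<^sup>2\<close> by (simp add: mult_le_cancel_right1)
    ultimately have "C\<^sup>2 + C + C * real ?m + (real ?m)\<^sup>2 \<le> C\<^sup>2 * (2 + real ?m + (real ?m)\<^sup>2)"
      using \<open>C \<le> C\<^sup>2\<close> by (simp add: algebra_simps)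
    also have "\<dots> \<le> C\<^sup>2 * (real k + 2)\<^sup>2"
    proof (intro mult_left_mono)
      have "2 + real ?m + (real ?m)\<^sup>2 \<le> (real ?m + 2)\<^sup>2" by (simp add: power2_eq_square algebra_simps)
      also have "\<dots> \<le> (real k + 2)\<^sup>2" using m by (intro power_mono) auto
      finally show "2 + real ?m + (real ?m)\<^sup>2 \<le> (real k + 2)\<^sup>2" .
    qed auto
    finally show "C\<^sup>2 + C + C * real ?m + (real ?m)\<^sup>2 \<le> (real k + 2)\<^sup>2 * C\<^sup>2" by (simp add: mult.commute)
  qed (use K0 C e wprod_nonneg[OF C(2)] m in \<open>auto intro!: mult_nonneg_nonneg power_increasing\<close>)
  finally show ?thesis by (simp add: algebra_simps power_add power2_eq_square)
qed

text \<open>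
  By the recursion for partitions, \<open>faa_di_bruno D g (u # hs)\<close> is the formal derivative of
  \<open>faa_di_bruno D g hs\<close> in the direction \<open>u\<close>.  Therefore the difference is of second order, apart from
  the still unknown Taylor remainder of \<open>g\<close> at \<open>hs\<close>, which the first derivative passes on
  with the factor \<open>K1\<close>.
\<close>

lemma faa_di_bruno_taylor:
  assumes C: "1 \<le> C" "0 \<le> w" and hs: "length hs < k" and e: "0 \<le> \<epsilon>"
    and gV: "\<And>b. length b \<le> length hs \<Longrightarrow> g b \<in> V \<and> g' b \<in> V \<and> g (u # b) \<in> V"
    and gb: "\<And>b. b \<noteq> [] \<Longrightarrow> length b \<le> length hs \<Longrightarrow> norm (g b) \<le> C * wprod w b \<and> norm (g' b) \<le> C * wprod w b"
    and gu: "\<And>b. length b \<le> length hs \<Longrightarrow> norm (g (u # b)) \<le> \<epsilon> * (C * wprod w b)"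
    and gl: "\<And>b. length b \<le> length hs \<Longrightarrow> norm (g' b - g b) \<le> \<epsilon> * (C * wprod w b)"
    and gt: "\<And>b. length b < length hs \<Longrightarrow> norm (g' b - g b - g (u # b)) \<le> \<epsilon>\<^sup>2 * (C * wprod w b)"
  shows "norm (faa_di_bruno D g' hs - faa_di_bruno D g hs - faa_di_bruno D g (u # hs)) \<le> K1 * norm (g' hs - g hs - g (u # hs)) +
     (num_partitions (length hs) + 1) * (K * (real k + 2)\<^sup>2 * C ^ (k + 2)) * (\<epsilon>\<^sup>2 * wprod w hs)"
proof -
  let ?B = "K * (real k + 2)\<^sup>2 * C ^ (k + 2)"
  define d where "d = g' [] - g []"
  define z where "z = d - g [u]"
  have V: "g [] \<in> V" "g' [] \<in> V" "g [u] \<in> V" "d \<in> V" "z \<in> V" "g hs \<in> V" "g' hs \<in> V" "g (u # hs) \<in> V"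
     "g' hs - g hs \<in> V" "g' hs - g hs - g (u # hs) \<in> V"
    using gV[of "[]"] gV[of hs] sub by (auto simp: d_def z_def intro!: subspace_diff)
  have d: "norm d \<le> C * \<epsilon>" and gu1: "norm (g [u]) \<le> C * \<epsilon>"
    using gl[of "[]"] gu[of "[]"] by (auto simp: d_def z_def mult.commute)
  have B: "K * c * C ^ j * (\<epsilon>\<^sup>2 * wprod w hs) \<le> ?B * (\<epsilon>\<^sup>2 * wprod w hs)" if "c \<le> 9" "0 \<le> c" "j \<le> k + 2" for c j
  proof -
    have "(9::real) = 3\<^sup>2" by simp
    also have "\<dots> \<le> (real k + 2)\<^sup>2" using k1 by (intro power_mono) auto
    finally show ?thesis using that K0 C e wprod_nonneg[OF C(2)]
      by (intro mult_right_mono mult_mono power_increasing mult_nonneg_nonneg) auto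
  qed
  have z1: "norm (D 1 (g []) [g' hs - g hs - g (u # hs)]) \<le> K1 * norm (g' hs - g hs - g (u # hs))"
    using V by (intro bound1) auto
  have z2: "D 1 (g []) [g' hs - g hs - g (u # hs)] = D 1 (g []) [g' hs] - D 1 (g []) [g hs] - D 1 (g []) [g (u # hs)]"
    using V by (simp only: D1_diff)
  show ?thesis
  proof (cases "hs = []")
    case True
    have "norm (D 0 (g' []) [] - D 0 (g []) [] - D (Suc 0) (g []) [d]) \<le> K * (norm d)\<^sup>2"
      using tay[of 0 "g []" "g' []" "[]"] V k1 by (auto simp: d_def)
    also have "\<dots> \<le> K * (C * \<epsilon>)\<^sup>2"
      using d K0 C e by (auto intro!: mult_mono mult_left_mono power_mono)
    also have "\<dots> \<le> ?B * (\<epsilon>\<^sup>2 * wprod w hs)"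
      using B[of 1 2] by (simp add: True power_mult_distrib mult_ac)
    finally have "norm (D 0 (g' []) [] - D 0 (g []) [] - D (Suc 0) (g []) [d]) \<le> ?B * (\<epsilon>\<^sup>2 * wprod w hs)" .
    moreover have "D 1 (g []) [d] = D 1 (g []) [g' []] - D 1 (g []) [g []]"
      unfolding d_def using V by (intro D1_diff) auto
    moreover have "faa_di_bruno D g' hs - faa_di_bruno D g hs - faa_di_bruno D g (u # hs) =
      (D 0 (g' []) [] - D 0 (g []) [] - D (Suc 0) (g []) [d]) + (D 1 (g []) [d] - D 1 (g []) [g [u]])"
      using True by (simp add: faa_di_bruno_def faa_di_bruno_rest_def)
    ultimately have "norm (faa_di_bruno D g' hs - faa_di_bruno D g hs - faa_di_bruno D g (u # hs)) \<le> ?B * (\<epsilon>\<^sup>2 * wprod w hs) + K1 * norm (g' hs - g hs - g (u # hs))"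
      using z1 z2 True by (smt (verit) norm_triangle_ineq)
    moreover have "num_partitions 0 = 0" by (simp add: num_partitions_def)
    ultimately show ?thesis using True by simp
  next
    case False
    have z: "norm z \<le> C * \<epsilon>\<^sup>2"
      using gt[of "[]"] False by (auto simp: d_def z_def mult.commute)
    define S where "S = (\<lambda>p. D (length p) (g' []) (map g' p) - D (length p) (g []) (map g p)
       - (\<Sum>q\<leftarrow>([u] # p) # ins_block u p. D (length q) (g []) (map g q)))"
    have Sb: "norm (\<Sum>p\<leftarrow>proper_partitions hs. S p) \<le> num_partitions (length hs) * (?B * (\<epsilon>\<^sup>2 * wprod w hs))"
      unfolding length_proper_partitions[symmetric]
      by (rule norm_sum_list_le) (unfold S_def, rule term_taylor, use assms in auto)
    \<comment> \<open>The recursion of the partitions of \<open>u # hs\<close>: the pair \<open>[u], hs\<close> stems from the one-block term.\<close>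
    have "faa_di_bruno_rest D g (u # hs) = D 2 (g []) [g [u], g hs] +
        (\<Sum>p\<leftarrow>proper_partitions hs. \<Sum>q\<leftarrow>([u] # p) # ins_block u p. D (length q) (g []) (map g q))"
      using False by (simp add: faa_di_bruno_rest_def sum_list_concat comp_def numeral_2_eq_2 del: map_concat)
    then have r: "faa_di_bruno_rest D g' hs - faa_di_bruno_rest D g hs - faa_di_bruno_rest D g (u # hs) =
       (\<Sum>p\<leftarrow>proper_partitions hs. S p) - D 2 (g []) [g [u], g hs]"
      unfolding S_def sum_list_diff[symmetric] by (simp add: faa_di_bruno_rest_def)
    have k2: "2 \<le> k" using False hs by (cases hs) auto
    note M2 = bounded_mlin[of 2, OF _ k2 V(1)]
    have lin2: "D 2 (g []) [d, g' hs] = D 2 (g []) [z, g' hs] + D 2 (g []) [g [u], g' hs]"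
      unfolding z_def using M2 V by (subst mlin_head_diff[where V = V and m = 1]) (auto simp: bounded_mlin_def numeral_2_eq_2)
    have lin2': "D 2 (g []) [g [u], g' hs - g hs] = D 2 (g []) [g [u], g' hs] - D 2 (g []) [g [u], g hs]"
    proof -
      have "bounded_mlin V 1 (K * norm (g [u])) (\<lambda>vs. D 2 (g []) (g [u] # vs))"
        using M2 V by (intro bounded_mlin_Cons) (auto simp: numeral_2_eq_2)
      then show ?thesis
        using mlin_head_diff[of V 0 "\<lambda>vs. D 2 (g []) (g [u] # vs)" "[]" "g' hs" "g hs"] V
        by (auto simp: bounded_mlin_def)
    qed
    have gh: "norm (g' hs) \<le> C * wprod w hs" "norm (g' hs - g hs) \<le> \<epsilon> * (C * wprod w hs)"
      using gb[of hs] gl[of hs] False by auto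
    have CW: "0 \<le> C * wprod w hs" using C wprod_nonneg[OF C(2), of hs] by (intro mult_nonneg_nonneg) linarith+
    have a: "norm (D 1 (g' []) [g' hs] - D 1 (g []) [g' hs] - D 2 (g []) [d, g' hs]) \<le> K * C ^ 3 * (\<epsilon>\<^sup>2 * wprod w hs)"
    proof -
      have "norm (D 1 (g' []) [g' hs] - D 1 (g []) [g' hs] - D (Suc 1) (g []) [d, g' hs]) \<le> K * (norm d)\<^sup>2 * nprod [g' hs]"
        unfolding d_def using V k2 by (intro tay) auto
      also have "\<dots> \<le> K * (C * \<epsilon>)\<^sup>2 * (C * wprod w hs)"
        using d gh K0 C e by (intro mult_mono mult_left_mono power_mono) auto
      finally show ?thesis by (simp add: power_mult_distrib numeral_eq_Suc algebra_simps)
    qed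
    have b: "norm (D 2 (g []) [z, g' hs]) \<le> K * C ^ 2 * (\<epsilon>\<^sup>2 * wprod w hs)"
    proof -
      have "norm (D 2 (g []) [z, g' hs]) \<le> K * (norm z * norm (g' hs))"
        using bounded_mlin_bound[OF M2, of "[z, g' hs]"] V by auto
      also have "\<dots> \<le> K * ((C * \<epsilon>\<^sup>2) * (C * wprod w hs))"
        using z gh K0 C e by (intro mult_mono mult_left_mono) auto
      finally show ?thesis by (simp add: numeral_eq_Suc algebra_simps)
    qed
    have c: "norm (D 2 (g []) [g [u], g' hs - g hs]) \<le> K * C ^ 2 * (\<epsilon>\<^sup>2 * wprod w hs)"
    proof -
      have "norm (D 2 (g []) [g [u], g' hs - g hs]) \<le> K * (norm (g [u]) * norm (g' hs - g hs))"
        using bounded_mlin_bound[OF M2, of "[g [u], g' hs - g hs]"] V by auto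
      also have "\<dots> \<le> K * ((C * \<epsilon>) * (\<epsilon> * (C * wprod w hs)))"
        using gu1 gh K0 C e by (intro mult_mono mult_left_mono) auto
      finally show ?thesis by (simp add: numeral_eq_Suc algebra_simps)
    qed
    have C23: "K * C ^ 2 * (\<epsilon>\<^sup>2 * wprod w hs) \<le> K * C ^ 3 * (\<epsilon>\<^sup>2 * wprod w hs)"
      using K0 C wprod_nonneg[OF C(2)] by (intro mult_right_mono mult_left_mono power_increasing) (auto intro!: mult_nonneg_nonneg)
    have "K * 3 * C ^ 3 * (\<epsilon>\<^sup>2 * wprod w hs) \<le> ?B * (\<epsilon>\<^sup>2 * wprod w hs)"
      using k1 by (intro B) auto
    then have abc: "K * C ^ 3 * (\<epsilon>\<^sup>2 * wprod w hs) + K * C ^ 2 * (\<epsilon>\<^sup>2 * wprod w hs) + K * C ^ 2 * (\<epsilon>\<^sup>2 * wprod w hs) \<le> ?B * (\<epsilon>\<^sup>2 * wprod w hs)"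
      using C23 by linarith
    have "faa_di_bruno D g' hs - faa_di_bruno D g hs - faa_di_bruno D g (u # hs) =
      (faa_di_bruno_rest D g' hs - faa_di_bruno_rest D g hs - faa_di_bruno_rest D g (u # hs)) +
      (D 1 (g' []) [g' hs] - D 1 (g []) [g hs] - D 1 (g []) [g (u # hs)])"
      using False by (simp add: faa_di_bruno_def)
    also have "\<dots> = (\<Sum>p\<leftarrow>proper_partitions hs. S p) + D 1 (g []) [g' hs - g hs - g (u # hs)] +
       (D 1 (g' []) [g' hs] - D 1 (g []) [g' hs] - D 2 (g []) [d, g' hs]) +
       D 2 (g []) [z, g' hs] + D 2 (g []) [g [u], g' hs - g hs]"
      unfolding r z2 lin2 lin2' by simp
    finally have "norm (faa_di_bruno D g' hs - faa_di_bruno D g hs - faa_di_bruno D g (u # hs)) \<le>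
      num_partitions (length hs) * (?B * (\<epsilon>\<^sup>2 * wprod w hs)) + K1 * norm (g' hs - g hs - g (u # hs)) + ?B * (\<epsilon>\<^sup>2 * wprod w hs)"
      using Sb z1 a b c abc by (smt (verit) norm_triangle_ineq)
    then show ?thesis by (simp add: algebra_simps)
  qed
qed

end

section \<open>Segments and antiderivatives\<close>

lemma seg_apply:
  fixes x :: "real \<Rightarrow> 'a::real_normed_vector"
  assumes "0 \<le> r" "continuous_on UNIV x"
  shows "apply_bcontfun (segment_at r x t) \<theta> = x (t + clamp (-r) 0 \<theta>)"
proof -
  have cl: "clamp (-r) 0 \<theta> \<in> {-r..0}"
    using clamp_in_interval[of "-r" 0 \<theta>] assms(1) by simp
  have "apply_bcontfun (segment_at r x t) \<theta> = apply_bcontfun (segment_at r x t) (clamp (-r) 0 \<theta>)"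
    using segment_at_phase_space(1)[OF assms, of t] by (simp add: phase_space_def)
  then show ?thesis using segment_at_phase_space(2)[OF assms cl] by simp
qed

lemma seg_diff:
  fixes x y :: "real \<Rightarrow> 'a::real_normed_vector"
  assumes "0 \<le> r" "continuous_on UNIV x" "continuous_on UNIV y"
  shows "segment_at r (\<lambda>t. x t - y t) t = segment_at r x t - segment_at r y t"
  by (rule bcontfun_eqI) (use assms in \<open>simp add: seg_apply minus_bcontfun.rep_eq continuous_on_diff\<close>)

lemma seg_scale:
  fixes x :: "real \<Rightarrow> 'a::real_normed_vector"
  assumes "0 \<le> r" "continuous_on UNIV x"
  shows "segment_at r (\<lambda>t. c *\<^sub>R x t) t = c *\<^sub>R segment_at r x t"
  by (rule bcontfun_eqI) (use assms in \<open>simp add: seg_apply scaleR_bcontfun.rep_eq continuous_on_scaleR\<close>)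

lemma norm_seg_le:
  fixes x :: "real \<Rightarrow> 'a::real_normed_vector"
  assumes "0 \<le> r" "continuous_on UNIV x" "\<And>s. norm (x s) \<le> C * exp (\<mu> * \<bar>s\<bar>)" "0 \<le> \<mu>" "0 \<le> C"
  shows "norm (segment_at r x t) \<le> C * exp (\<mu> * (\<bar>t\<bar> + r))"
proof (rule norm_bound)
  fix \<theta>
  have cl: "clamp (-r) 0 \<theta> \<in> {-r..0}"
    using clamp_in_interval[of "-r" 0 \<theta>] assms(1) by simp
  have "norm (x (t + clamp (-r) 0 \<theta>)) \<le> C * exp (\<mu> * \<bar>t + clamp (-r) 0 \<theta>\<bar>)" by (rule assms)
  also have "\<dots> \<le> C * exp (\<mu> * (\<bar>t\<bar> + r))"
    using cl assms by (intro mult_left_mono) (auto intro!: mult_left_mono)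
  finally show "norm (apply_bcontfun (segment_at r x t) \<theta>) \<le> C * exp (\<mu> * (\<bar>t\<bar> + r))"
    using assms by (simp add: seg_apply)
qed

lemma continuous_seg:
  fixes x :: "real \<Rightarrow> 'a::real_normed_vector"
  assumes r: "0 \<le> r" and x: "continuous_on UNIV x"
  shows "continuous_on UNIV (segment_at r x)"
  unfolding continuous_on_iff
proof (intro ballI allI impI)
  fix t e :: real assume e: "0 < e"
  have "uniformly_continuous_on {t - r - 1..t + 1} x"
    by (intro compact_uniformly_continuous continuous_on_subset[OF x]) auto
  then obtain d where d: "0 < d" "\<And>s s'. s \<in> {t - r - 1..t + 1} \<Longrightarrow> s' \<in> {t - r - 1..t + 1} \<Longrightarrow> dist s' s < d \<Longrightarrow> dist (x s') (x s) < e/2"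
    unfolding uniformly_continuous_on_def using e by (metis half_gt_zero)
  show "\<exists>d>0. \<forall>t'\<in>UNIV. dist t' t < d \<longrightarrow> dist (segment_at r x t') (segment_at r x t) < e"
  proof (intro exI[of _ "min d 1"] conjI ballI impI)
    fix t' assume t': "dist t' t < min d 1"
    have "dist (segment_at r x t') (segment_at r x t) \<le> e/2"
    proof (rule dist_bound)
      fix \<theta>
      have cl: "clamp (-r) 0 \<theta> \<in> {-r..0}"
        using clamp_in_interval[of "-r" 0 \<theta>] r by simp
      have "dist (x (t' + clamp (-r) 0 \<theta>)) (x (t + clamp (-r) 0 \<theta>)) < e/2"
        by (rule d(2)) (use cl t' in \<open>auto simp: dist_real_def\<close>)
      then show "dist (apply_bcontfun (segment_at r x t') \<theta>) (apply_bcontfun (segment_at r x t) \<theta>) \<le> e/2"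
        using r x by (simp add: seg_apply)
    qed
    then show "dist (segment_at r x t') (segment_at r x t) < e" using e by simp
  qed (use d in auto)
qed

definition antideriv :: "(real \<Rightarrow> 'a::banach) \<Rightarrow> real \<Rightarrow> 'a" where
  "antideriv g t = (if 0 \<le> t then integral {0..t} g else - integral {t..0} g)"

lemma antideriv_shift:
  assumes g: "continuous_on UNIV g" and "a \<le> 0" "a \<le> t"
  shows "antideriv g t = integral {a..t} g - integral {a..0} g"
proof -
  have i: "g integrable_on {c..d}" for c d
    by (intro integrable_continuous_real continuous_on_subset[OF g]) auto
  show ?thesis
  proof (cases "0 \<le> t")
    case True
    then show ?thesis using Henstock_Kurzweil_Integration.integral_combine[of a 0 t g] i assms by (simp add: antideriv_def algebra_simps)
  next
    case False
    then show ?thesis using Henstock_Kurzweil_Integration.integral_combine[of a t 0 g] i assms by (simp add: antideriv_def algebra_simps)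
  qed
qed

lemma antideriv_derivative:
  assumes g: "continuous_on UNIV g"
  shows "(antideriv g has_vector_derivative g t) (at t)"
proof -
  define a b where "a = min 0 t - 1" and "b = t + 1"
  have "((\<lambda>u. integral {a..u} g) has_vector_derivative g t) (at t within {a..b})"
    by (intro integral_has_vector_derivative continuous_on_subset[OF g]) (auto simp: a_def b_def)
  then have "((\<lambda>u. integral {a..u} g) has_vector_derivative g t) (at t)"
    by (simp add: at_within_Icc_at a_def b_def)
  then have "((\<lambda>u. integral {a..u} g - integral {a..0} g) has_vector_derivative g t) (at t)"
    by (auto intro!: derivative_eq_intros)
  then show ?thesis
    by (rule has_vector_derivative_transform_within_open[where S = "{a<..}"])
       (use antideriv_shift[OF g, of a] in \<open>auto simp: a_def\<close>)
qed

lemma antideriv_0 [simp]: "antideriv g 0 = 0"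
  by (simp add: antideriv_def)

lemma antideriv_diff: "continuous_on UNIV f \<Longrightarrow> continuous_on UNIV g \<Longrightarrow> antideriv (\<lambda>s. f s - g s) t = antideriv f t - antideriv g t"
proof -
  assume "continuous_on UNIV f" "continuous_on UNIV g"
  then have "integral {c..d} (\<lambda>s. f s - g s) = integral {c..d} f - integral {c..d} g" for c d
    by (intro Henstock_Kurzweil_Integration.integral_diff integrable_continuous_real)
       (auto intro: continuous_on_subset)
  then show ?thesis by (simp add: antideriv_def)
qed

lemma antideriv_scale: "antideriv (\<lambda>s. c *\<^sub>R f s) t = c *\<^sub>R antideriv f t"
  by (simp add: antideriv_def)

lemma continuous_antideriv: "continuous_on UNIV g \<Longrightarrow> continuous_on UNIV (antideriv g)"
  using antideriv_derivative by (metis continuous_at_imp_continuous_on has_vector_derivative_continuous)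

text \<open>
  Integrating an exponential bound gains the factor \<open>1/\<mu>\<close>, which for \<open>\<mu>\<close> proportional to \<open>1/r\<close> makes
  the contribution of \<open>F\<close> small for short delays.
\<close>

lemma norm_antideriv_le:
  assumes g: "continuous_on UNIV g" and b: "\<And>s. norm (g s) \<le> c * exp (\<mu> * \<bar>s\<bar>)" and \<mu>: "0 < \<mu>"
  shows "norm (antideriv g t) \<le> c / \<mu> * exp (\<mu> * \<bar>t\<bar>)"
proof -
  have c: "0 \<le> c" using b[of 0] norm_ge_zero[of "g 0"] by (simp del: norm_ge_zero)
  have i: "g integrable_on {c..d}" for c d
    by (intro integrable_continuous_real continuous_on_subset[OF g]) auto
  show ?thesis
  proof (cases "0 \<le> t")
    case True
    have h: "((\<lambda>s. c * exp (\<mu> * s)) has_integral (c / \<mu> * exp (\<mu> * t) - c / \<mu> * exp (\<mu> * 0))) {0..t}"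
      by (rule fundamental_theorem_of_calculus)
         (use True \<mu> in \<open>auto intro!: derivative_eq_intros simp flip: has_real_derivative_iff_has_vector_derivative\<close>)
    have "norm (integral {0..t} g) \<le> integral {0..t} (\<lambda>s. c * exp (\<mu> * s))"
    proof (rule integral_norm_bound_integral)
      show "norm (g s) \<le> c * exp (\<mu> * s)" if "s \<in> {0..t}" for s using b[of s] that by simp
    qed (use i h in auto)
    also have "\<dots> = c / \<mu> * exp (\<mu> * t) - c / \<mu>" unfolding integral_unique[OF h] by simp
    finally show ?thesis using True c \<mu> by (simp add: antideriv_def) (smt (verit) divide_nonneg_pos)
  next
    case False
    have h: "((\<lambda>s. c * exp (- (\<mu> * s))) has_integral (- (c / \<mu>) * exp (- (\<mu> * 0)) - - (c / \<mu>) * exp (- (\<mu> * t)))) {t..0}"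
      by (rule fundamental_theorem_of_calculus)
         (use False \<mu> in \<open>auto intro!: derivative_eq_intros simp flip: has_real_derivative_iff_has_vector_derivative\<close>)
    have "norm (integral {t..0} g) \<le> integral {t..0} (\<lambda>s. c * exp (- (\<mu> * s)))"
    proof (rule integral_norm_bound_integral)
      show "norm (g s) \<le> c * exp (- (\<mu> * s))" if "s \<in> {t..0}" for s using b[of s] that by simp
    qed (use i h in auto)
    also have "\<dots> = c / \<mu> * exp (- (\<mu> * t)) - c / \<mu>" unfolding integral_unique[OF h] by simp
    finally show ?thesis using False c \<mu> by (simp add: antideriv_def) (smt (verit) divide_nonneg_pos)
  qed
qed

text \<open>
  The Lipschitz constant is uniform in \<open>t\<close>, so moving the argument and moving \<open>t\<close> can be separated.
\<close>

lemma continuous_lipschitz_family: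
  fixes G :: "real \<Rightarrow> 'b::real_normed_vector \<Rightarrow> 'c::real_normed_vector"
  assumes lip: "\<And>t \<phi> \<psi>. \<phi> \<in> V \<Longrightarrow> \<psi> \<in> V \<Longrightarrow> norm (G t \<phi> - G t \<psi>) \<le> K * norm (\<phi> - \<psi>)"
    and ct: "\<And>\<phi>. \<phi> \<in> V \<Longrightarrow> continuous_on UNIV (\<lambda>t. G t \<phi>)"
    and f: "continuous_on UNIV f" "\<And>t. f t \<in> V"
  shows "continuous_on UNIV (\<lambda>t. G t (f t))"
proof -
  have "((\<lambda>t. G t (f t)) \<longlongrightarrow> G t0 (f t0)) (at t0)" for t0
  proof -
    have ft: "(f \<longlongrightarrow> f t0) (at t0)" using f(1) by (simp add: continuous_on_def)
    have "((\<lambda>t. G t (f t) - G t (f t0)) \<longlongrightarrow> 0) (at t0)"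
    proof (rule Lim_null_comparison)
      show "\<forall>\<^sub>F t in at t0. norm (G t (f t) - G t (f t0)) \<le> K * norm (f t - f t0)"
        using lip f by (intro always_eventually) auto
      show "((\<lambda>t. K * norm (f t - f t0)) \<longlongrightarrow> 0) (at t0)"
        using ft by (auto intro!: tendsto_eq_intros LIM_zero)
    qed
    moreover have "((\<lambda>t. G t (f t0)) \<longlongrightarrow> G t0 (f t0)) (at t0)"
      using ct[OF f(2)[of t0]] by (simp add: continuous_on_def)
    ultimately show ?thesis using tendsto_add by fastforce
  qed
  then show ?thesis by (simp add: continuous_on_def)
qed

section \<open>Weighted estimates for the integrated equation\<close>

locale delay_op =
  fixes r M :: real and L :: "real \<Rightarrow> (real \<Rightarrow>\<^sub>C 'a::banach) \<Rightarrow> 'a"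
  assumes r: "0 < r" and M0: "0 \<le> M"
    and L_diff: "\<phi> \<in> phase_space r \<Longrightarrow> \<psi> \<in> phase_space r \<Longrightarrow> L t (\<phi> - \<psi>) = L t \<phi> - L t \<psi>"
    and L_scale: "\<phi> \<in> phase_space r \<Longrightarrow> L t (c *\<^sub>R \<phi>) = c *\<^sub>R L t \<phi>"
    and L_bound: "\<phi> \<in> phase_space r \<Longrightarrow> norm (L t \<phi>) \<le> M * norm \<phi>"
    and L_cont: "\<phi> \<in> phase_space r \<Longrightarrow> continuous_on UNIV (\<lambda>t. L t \<phi>)"
begin

abbreviation "V \<equiv> phase_space r :: (real \<Rightarrow>\<^sub>C 'a) set"
abbreviation "seg \<equiv> segment_at r :: (real \<Rightarrow> 'a) \<Rightarrow> real \<Rightarrow> (real \<Rightarrow>\<^sub>C 'a)"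

lemma r0: "0 \<le> r" using r by simp

lemma seg_V: "continuous_on UNIV x \<Longrightarrow> seg x t \<in> V"
  using segment_at_phase_space(1)[OF r0] .

lemma continuous_Lseg:
  assumes "continuous_on UNIV x"
  shows "continuous_on UNIV (\<lambda>t. L t (seg x t))"
proof (rule continuous_lipschitz_family[where G = L and V = V and K = M])
  show "norm (L t \<phi> - L t \<psi>) \<le> M * norm (\<phi> - \<psi>)" if "\<phi> \<in> V" "\<psi> \<in> V" for t \<phi> \<psi>
    using L_bound[of "\<phi> - \<psi>" t] L_diff[OF that, of t] subspace_diff[OF subspace_phase_space that] by simp
qed (use assms in \<open>auto intro: L_cont continuous_seg[OF r0] seg_V\<close>)

text \<open>
  The integrated equation with a given right-hand side \<open>g\<close>, which may depend on \<open>z\<close>.  These triples are closed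
  under differences and multiples, so increments, Taylor remainders and linearity defects of solutions
  are again solutions in this sense.
\<close>

definition sol :: "(real \<Rightarrow> 'a) \<Rightarrow> 'a \<Rightarrow> (real \<Rightarrow> 'a) \<Rightarrow> bool" where
  "sol z q g \<longleftrightarrow> continuous_on UNIV z \<and> continuous_on UNIV g \<and> (\<forall>t. z t = q + L t (seg z t) + antideriv g t)"

lemma solI: "continuous_on UNIV z \<Longrightarrow> continuous_on UNIV g \<Longrightarrow> (\<And>t. z t = q + L t (seg z t) + antideriv g t) \<Longrightarrow> sol z q g"
  unfolding sol_def by blast

lemma solD:
  assumes "sol z q g"
  shows "continuous_on UNIV z" "continuous_on UNIV g" "z t = q + L t (seg z t) + antideriv g t"
  using assms unfolding sol_def by blast+

lemma sol_diff:
  assumes "sol z q g" "sol z' q' g'"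
  shows "sol (\<lambda>t. z t - z' t) (q - q') (\<lambda>t. g t - g' t)"
proof -
  have c: "continuous_on UNIV z" "continuous_on UNIV z'" "continuous_on UNIV g" "continuous_on UNIV g'"
    and eq: "z t = q + L t (seg z t) + antideriv g t" "z' t = q' + L t (seg z' t) + antideriv g' t" for t
    using solD[OF assms(1)] solD[OF assms(2)] by blast+
  have "z t - z' t = q - q' + L t (seg (\<lambda>t. z t - z' t) t) + antideriv (\<lambda>t. g t - g' t) t" for t
    using eq[of t] c by (simp add: seg_diff[OF r0] L_diff seg_V antideriv_diff)
  then show ?thesis using c by (intro solI continuous_on_diff)
qed

lemma sol_scale:
  assumes "sol z q g"
  shows "sol (\<lambda>t. c *\<^sub>R z t) (c *\<^sub>R q) (\<lambda>t. c *\<^sub>R g t)"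
proof -
  have z: "continuous_on UNIV z" "continuous_on UNIV g"
    and eq: "z t = q + L t (seg z t) + antideriv g t" for t
    using solD[OF assms] by blast+
  have "c *\<^sub>R z t = c *\<^sub>R q + L t (seg (\<lambda>t. c *\<^sub>R z t) t) + antideriv (\<lambda>t. c *\<^sub>R g t) t" for t
    using arg_cong[OF eq[of t], of "scaleR c"] z
    by (simp add: seg_scale[OF r0] L_scale seg_V antideriv_scale scaleR_add_right)
  then show ?thesis using z by (intro solI continuous_intros)
qed

lemma weighted_step:
  assumes z: "continuous_on UNIV z" and g: "continuous_on UNIV g" and \<mu>: "0 < \<mu>" and K1: "0 \<le> K1"
    and zb: "\<And>t. norm (z t) \<le> B * exp (\<mu> * \<bar>t\<bar>)"
    and gb: "\<And>s. norm (g s) \<le> K1 * norm (seg z s) + c * exp (\<mu> * \<bar>s\<bar>)"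
  shows "norm (q + L t (seg z t) + antideriv g t) \<le>
     (norm q + (M * exp (\<mu> * r) + K1 * exp (\<mu> * r) / \<mu>) * B + c / \<mu>) * exp (\<mu> * \<bar>t\<bar>)"
proof -
  have B: "0 \<le> B" using zb[of 0] norm_ge_zero[of "z 0"] by (simp del: norm_ge_zero)
  have zs: "norm (seg z s) \<le> B * exp (\<mu> * (\<bar>s\<bar> + r))" for s
    using z zb \<mu> B by (intro norm_seg_le r0) auto
  have g1: "norm (g s) \<le> (K1 * exp (\<mu> * r) * B + c) * exp (\<mu> * \<bar>s\<bar>)" for s
  proof -
    have "norm (g s) \<le> K1 * (B * exp (\<mu> * (\<bar>s\<bar> + r))) + c * exp (\<mu> * \<bar>s\<bar>)"
      using gb[of s] mult_left_mono[OF zs[of s] K1] by linarith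
    then show ?thesis by (simp add: algebra_simps exp_add)
  qed
  have "norm (antideriv g t) \<le> (K1 * exp (\<mu> * r) * B + c) / \<mu> * exp (\<mu> * \<bar>t\<bar>)"
    by (rule norm_antideriv_le[OF g g1 \<mu>])
  moreover have "norm (L t (seg z t)) \<le> M * (B * exp (\<mu> * (\<bar>t\<bar> + r)))"
    using L_bound[OF seg_V[OF z], of t t] mult_left_mono[OF zs[of t] M0] by linarith
  moreover have "norm q \<le> norm q * exp (\<mu> * \<bar>t\<bar>)" using \<mu> by (simp add: mult_le_cancel_left1)
  ultimately have "norm (q + L t (seg z t) + antideriv g t) \<le>
    norm q * exp (\<mu> * \<bar>t\<bar>) + M * (B * exp (\<mu> * (\<bar>t\<bar> + r))) + (K1 * exp (\<mu> * r) * B + c) / \<mu> * exp (\<mu> * \<bar>t\<bar>)"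
    by (smt (verit) norm_triangle_ineq)
  also have "\<dots> = (norm q + (M * exp (\<mu> * r) + K1 * exp (\<mu> * r) / \<mu>) * B + c / \<mu>) * exp (\<mu> * \<bar>t\<bar>)"
    by (simp add: algebra_simps exp_add add_divide_distrib)
  finally show ?thesis .
qed

text \<open>
  Some exponential bound being known, there is a least one, \<open>S\<close>; feeding it into \<open>weighted_step\<close> shows
  \<open>S \<le> |q| + \<kappa> S + c/\<mu>\<close>, which bounds \<open>S\<close> in terms of the data alone.
\<close>

lemma weighted_bound:
  assumes s: "sol z q g" and \<mu>: "0 < \<mu>" and K1: "0 \<le> K1"
    and zb: "\<exists>B. \<forall>t. norm (z t) \<le> B * exp (\<mu> * \<bar>t\<bar>)"
    and gb: "\<And>s. norm (g s) \<le> K1 * norm (seg z s) + c * exp (\<mu> * \<bar>s\<bar>)"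
    and \<kappa>: "M * exp (\<mu> * r) + K1 * exp (\<mu> * r) / \<mu> \<le> \<kappa>" "\<kappa> < 1"
  shows "norm (z t) \<le> (norm q + c / \<mu>) / (1 - \<kappa>) * exp (\<mu> * \<bar>t\<bar>)"
proof -
  obtain B0 where B0: "\<And>t. norm (z t) \<le> B0 * exp (\<mu> * \<bar>t\<bar>)" using zb by blast
  define n where "n = (\<lambda>t. norm (z t) / exp (\<mu> * \<bar>t\<bar>))"
  define S where "S = (SUP t. n t)"
  have "bdd_above (range n)"
    by (rule bdd_aboveI[of _ B0]) (use B0 in \<open>auto simp: n_def divide_le_eq\<close>)
  then have nS: "n t \<le> S" for t unfolding S_def by (rule cSUP_upper2) auto
  then have zS: "norm (z t) \<le> S * exp (\<mu> * \<bar>t\<bar>)" for t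
    by (simp add: n_def divide_le_eq)
  have S0: "0 \<le> S" using nS[of 0] by (simp add: n_def) (meson norm_ge_zero order_trans)
  have "n t \<le> norm q + \<kappa> * S + c / \<mu>" for t
  proof -
    have "norm (z t) \<le> (norm q + (M * exp (\<mu> * r) + K1 * exp (\<mu> * r) / \<mu>) * S + c / \<mu>) * exp (\<mu> * \<bar>t\<bar>)"
      using weighted_step[OF solD(1,2)[OF s] \<mu> K1 zS gb, of q t] unfolding solD(3)[OF s, symmetric] .
    also have "\<dots> \<le> (norm q + \<kappa> * S + c / \<mu>) * exp (\<mu> * \<bar>t\<bar>)"
      using \<kappa> S0 by (intro mult_right_mono add_mono) auto
    finally show ?thesis by (simp add: n_def divide_le_eq)
  qed
  then have "S \<le> norm q + \<kappa> * S + c / \<mu>" unfolding S_def by (intro cSUP_least) auto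
  then have "S * (1 - \<kappa>) \<le> norm q + c / \<mu>" by (simp add: algebra_simps)
  then have "S \<le> (norm q + c / \<mu>) / (1 - \<kappa>)" using \<kappa> by (simp add: pos_le_divide_eq)
  then show ?thesis using zS[of t] by (meson exp_ge_zero mult_right_mono order_trans)
qed

text \<open>
  The weight is divided out, so that the contraction principle can be applied in the Banach space of
  bounded continuous functions on the line.
\<close>

lemma solution_exists:
  assumes \<mu>: "0 < \<mu>" and K1: "0 \<le> K1"
    and lip: "\<And>t \<phi> \<psi>. \<phi> \<in> V \<Longrightarrow> \<psi> \<in> V \<Longrightarrow> norm (G t \<phi> - G t \<psi>) \<le> K1 * norm (\<phi> - \<psi>)"
    and ct: "\<And>\<phi>. \<phi> \<in> V \<Longrightarrow> continuous_on UNIV (\<lambda>t. G t \<phi>)"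
    and G0: "\<And>t. norm (G t 0) \<le> c * exp (\<mu> * \<bar>t\<bar>)"
    and \<kappa>: "M * exp (\<mu> * r) + K1 * exp (\<mu> * r) / \<mu> \<le> \<kappa>" "\<kappa> < 1"
  shows "\<exists>z. sol z q (\<lambda>s. G s (seg z s)) \<and> (\<exists>B. \<forall>t. norm (z t) \<le> B * exp (\<mu> * \<bar>t\<bar>))"
proof -
  define e where "e = (\<lambda>t. exp (\<mu> * \<bar>t\<bar>))"
  have e0: "e t > 0" for t by (simp add: e_def)
  define X where "X = (\<lambda>(u :: real \<Rightarrow>\<^sub>C 'a) t. e t *\<^sub>R apply_bcontfun u t)"
  define Q where "Q = (\<lambda>z t. q + L t (seg z t) + antideriv (\<lambda>s. G s (seg z s)) t)"
  have Gc: "continuous_on UNIV (\<lambda>s. G s (seg z s))" if "continuous_on UNIV z" for z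
    using that by (intro continuous_lipschitz_family[OF lip ct]) (auto intro: continuous_seg[OF r0] seg_V)
  have Qc: "continuous_on UNIV (Q z)" if "continuous_on UNIV z" for z
    unfolding Q_def using that by (intro continuous_intros continuous_Lseg continuous_antideriv Gc)
  have Xc: "continuous_on UNIV (X u)" for u
    unfolding X_def e_def by (intro continuous_intros continuous_on_apply_bcontfun)
  have Xb: "norm (X u t) \<le> norm u * exp (\<mu> * \<bar>t\<bar>)" for u t
    using norm_bounded[of u t] by (simp add: X_def e_def mult.commute)
  have V0: "0 \<in> V" by (simp add: subspace_0 subspace_phase_space)
  have Qb: "norm (Q (X u) t) \<le> (norm q + (M * exp (\<mu> * r) + K1 * exp (\<mu> * r) / \<mu>) * norm u + c / \<mu>) * exp (\<mu> * \<bar>t\<bar>)" for u t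
    unfolding Q_def
  proof (rule weighted_step[OF Xc Gc[OF Xc] \<mu> K1 Xb])
    fix s
    show "norm (G s (seg (X u) s)) \<le> K1 * norm (seg (X u) s) + c * exp (\<mu> * \<bar>s\<bar>)"
      using lip[OF seg_V[OF Xc] V0, of s u s] G0[of s] norm_triangle_ineq2[of "G s (seg (X u) s)" "G s 0"] by simp
  qed
  have Qd: "norm (Q (X u) t - Q (X v) t) \<le> \<kappa> * norm (u - v) * exp (\<mu> * \<bar>t\<bar>)" for u v t
  proof -
    let ?d = "\<lambda>t. X u t - X v t"
    have Xuv: "?d = X (u - v)" by (auto simp: X_def minus_bcontfun.rep_eq scaleR_diff_right)
    have "Q (X u) t - Q (X v) t = 0 + L t (seg ?d t) + antideriv (\<lambda>s. G s (seg (X u) s) - G s (seg (X v) s)) t"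
      by (simp add: Q_def antideriv_diff Gc Xc seg_diff[OF r0] L_diff seg_V)
    also have "norm \<dots> \<le> (norm (0::'a) + (M * exp (\<mu> * r) + K1 * exp (\<mu> * r) / \<mu>) * norm (u - v) + 0 / \<mu>) * exp (\<mu> * \<bar>t\<bar>)"
    proof (rule weighted_step[OF _ _ \<mu> K1])
      show "continuous_on UNIV ?d" "continuous_on UNIV (\<lambda>s. G s (seg (X u) s) - G s (seg (X v) s))"
        using Xc Gc by (auto intro!: continuous_on_diff)
      show "norm (?d t) \<le> norm (u - v) * exp (\<mu> * \<bar>t\<bar>)" for t using Xb[of "u - v" t] Xuv by metis
      show "norm (G s (seg (X u) s) - G s (seg (X v) s)) \<le> K1 * norm (seg ?d s) + 0 * exp (\<mu> * \<bar>s\<bar>)" for s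
        using lip[OF seg_V[OF Xc] seg_V[OF Xc], of s u s v s] Xc by (simp add: seg_diff[OF r0])
    qed
    also have "\<dots> \<le> \<kappa> * norm (u - v) * exp (\<mu> * \<bar>t\<bar>)"
      using \<kappa> by (auto intro!: mult_right_mono)
    finally show ?thesis .
  qed
  define T where "T = (\<lambda>u. Bcontfun (\<lambda>t. Q (X u) t /\<^sub>R e t))"
  have Ta: "apply_bcontfun (T u) t = Q (X u) t /\<^sub>R e t" for u t
  proof -
    have "(\<lambda>t. Q (X u) t /\<^sub>R e t) \<in> bcontfun"
    proof (rule bcontfun_normI)
      show "continuous_on UNIV (\<lambda>t. Q (X u) t /\<^sub>R e t)"
        using e0 unfolding e_def by (intro continuous_intros Qc Xc) auto
      show "norm (Q (X u) t /\<^sub>R e t) \<le> norm q + (M * exp (\<mu> * r) + K1 * exp (\<mu> * r) / \<mu>) * norm u + c / \<mu>" for t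
        using Qb[of u t] e0[of t] by (simp add: e_def field_simps)
    qed
    then show ?thesis unfolding T_def by (simp add: Bcontfun_inverse)
  qed
  have "\<exists>!u. T u = u"
  proof (rule banach_fix_type[of "max \<kappa> 0"])
    show "\<forall>u v. dist (T u) (T v) \<le> max \<kappa> 0 * dist u v"
    proof (intro allI)
      fix u v
      have "norm (T u - T v) \<le> max \<kappa> 0 * norm (u - v)"
      proof (rule norm_bound)
        fix t
        have "apply_bcontfun (T u - T v) t = (Q (X u) t - Q (X v) t) /\<^sub>R e t"
          by (simp add: minus_bcontfun.rep_eq Ta scaleR_diff_right)
        then have "norm (apply_bcontfun (T u - T v) t) \<le> \<kappa> * norm (u - v)"
          using Qd[of u t v] e0[of t] by (simp add: e_def pos_divide_le_eq divide_inverse_commute[symmetric])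
        also have "\<dots> \<le> max \<kappa> 0 * norm (u - v)" by (intro mult_right_mono) auto
        finally show "norm (apply_bcontfun (T u - T v) t) \<le> max \<kappa> 0 * norm (u - v)" .
      qed
      then show "dist (T u) (T v) \<le> max \<kappa> 0 * dist u v" by (simp add: dist_norm)
    qed
  qed (use \<kappa> in auto)
  then obtain u where u: "T u = u" by blast
  have fixp: "X u t = Q (X u) t" for t
  proof -
    have "X u t = e t *\<^sub>R apply_bcontfun (T u) t" by (simp add: u X_def)
    also have "\<dots> = Q (X u) t" using e0[of t] by (simp add: Ta)
    finally show ?thesis .
  qed
  have "sol (X u) q (\<lambda>s. G s (seg (X u) s))"
    by (rule solI[OF Xc Gc[OF Xc] fixp[unfolded Q_def]])
  then show ?thesis using Xb by blast
qed

end

section \<open>Consequences of k-fold differentiability\<close>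

lemma Ck_mlin: "Ck_with V k f D \<Longrightarrow> j \<le> k \<Longrightarrow> x \<in> V \<Longrightarrow> mlin V j (D j x)"
  by (simp add: Ck_with_def bounded_multilinear_on_iff)

text \<open>
  Evaluated at fixed arguments and restricted to a line, a higher derivative becomes a function of
  one real variable, to which the mean value inequality applies.
\<close>

lemma Ck_path_derivative:
  assumes V: "subspace V" and C: "Ck_with V k f D" and j: "j < k" and \<phi>: "\<phi> \<in> V" and v: "v \<in> V"
    and hs: "length hs = j" "set hs \<subseteq> V"
  shows "((\<lambda>c. D j (\<phi> + c *\<^sub>R v) hs) has_vector_derivative D (Suc j) (\<phi> + c *\<^sub>R v) (v # hs)) (at c)"
proof -
  define x where "x = \<phi> + c *\<^sub>R v"
  have in_V: "\<phi> + c *\<^sub>R v \<in> V" for c using V \<phi> v by (intro subspace_add subspace_scale)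
  then have x: "x \<in> V" by (simp add: x_def)
  have ml: "mlin V (Suc j) (D (Suc j) x)" using C j x by (intro Ck_mlin) auto
  have scale: "D (Suc j) x ((a *\<^sub>R v) # hs) = a *\<^sub>R D (Suc j) x (v # hs)" for a
  proof -
    have "D (Suc j) x ((a *\<^sub>R v + 0 *\<^sub>R v) # hs) = a *\<^sub>R D (Suc j) x (v # hs) + 0 *\<^sub>R D (Suc j) x (v # hs)"
      using ml hs v by (auto simp only: mlin.simps)
    then show ?thesis by simp
  qed
  have est: "norm (D j y hs - D j x hs - D (Suc j) x ((y - x) # hs)) \<le> \<epsilon> * norm (y - x) * nprod hs"
    if y: "y \<in> V" and e: "0 < \<epsilon>"
      and b: "ml_norm V j (\<lambda>hs. D j y hs - D j x hs - D (Suc j) x ((y - x) # hs)) \<le> ennreal (\<epsilon> * norm (y - x))"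
    for y \<epsilon>
  proof (rule ml_norm_boundD[OF V _ b _ hs])
    have "y - x \<in> V" using V x y by (simp add: subspace_diff)
    then have "mlin V j (\<lambda>hs. D (Suc j) x ((y - x) # hs))" using ml by simp
    then show "mlin V j (\<lambda>hs. D j y hs - D j x hs - D (Suc j) x ((y - x) # hs))"
      using Ck_mlin[OF C _ x, of j] Ck_mlin[OF C _ y, of j] j by (intro mlin_diff) auto
  qed (use e in auto)
  have "((\<lambda>c. D j (\<phi> + c *\<^sub>R v) hs) has_derivative (\<lambda>h. h *\<^sub>R D (Suc j) x (v # hs))) (at c)"
    unfolding has_derivative_at_alt
  proof (intro conjI allI impI)
    show "bounded_linear (\<lambda>h. h *\<^sub>R D (Suc j) x (v # hs))" by (rule bounded_linear_scaleR_left)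
    fix e :: real assume e: "0 < e"
    define \<epsilon> where "\<epsilon> = e / ((norm v + 1) * (nprod hs + 1))"
    have e': "0 < \<epsilon>" using e nprod_nonneg[of hs] by (auto simp: \<epsilon>_def add_nonneg_pos intro!: divide_pos_pos mult_pos_pos)
    have le: "\<epsilon> * (norm v * nprod hs) \<le> e"
    proof -
      have "\<epsilon> * (norm v * nprod hs) \<le> \<epsilon> * ((norm v + 1) * (nprod hs + 1))"
        using e' nprod_nonneg[of hs] by (intro mult_left_mono mult_mono) auto
      also have "\<dots> = e" using nprod_nonneg[of hs] norm_ge_zero[of v] by (simp add: \<epsilon>_def add_nonneg_pos del: norm_ge_zero)
      finally show ?thesis .
    qed
    have "\<forall>\<^sub>F y in at x within V. ml_norm V j (\<lambda>hs. D j y hs - D j x hs - D (Suc j) x ((y - x) # hs)) \<le> ennreal (\<epsilon> * norm (y - x))"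
      using C j x e' unfolding Ck_with_def by blast
    then obtain d where d: "0 < d" and db: "\<And>y. y \<in> V \<Longrightarrow> y \<noteq> x \<Longrightarrow> dist y x < d \<Longrightarrow>
        ml_norm V j (\<lambda>hs. D j y hs - D j x hs - D (Suc j) x ((y - x) # hs)) \<le> ennreal (\<epsilon> * norm (y - x))"
      unfolding eventually_at by blast
    show "\<exists>d>0. \<forall>y. norm (y - c) < d \<longrightarrow>
       norm (D j (\<phi> + y *\<^sub>R v) hs - D j (\<phi> + c *\<^sub>R v) hs - (y - c) *\<^sub>R D (Suc j) x (v # hs)) \<le> e * norm (y - c)"
    proof (intro exI[of _ "d / (norm v + 1)"] conjI allI impI)
      show "0 < d / (norm v + 1)" using d by (simp add: add_nonneg_pos)
      fix c' assume c': "norm (c' - c) < d / (norm v + 1)"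
      define y where "y = \<phi> + c' *\<^sub>R v"
      have yx: "y - x = (c' - c) *\<^sub>R v" by (simp add: x_def y_def scaleR_diff_left)
      have y: "y \<in> V" using in_V by (simp add: y_def)
      have "norm (D j y hs - D j x hs - (c' - c) *\<^sub>R D (Suc j) x (v # hs)) \<le> e * norm (c' - c)"
      proof (cases "y = x")
        case True
        then have "(c' - c) *\<^sub>R v = 0" using yx by simp
        then have "(c' - c) *\<^sub>R D (Suc j) x (v # hs) = D (Suc j) x ((0 *\<^sub>R v) # hs)"
          by (simp only: scale[symmetric] scaleR_zero_left)
        also have "\<dots> = 0" unfolding scale by simp
        finally have "D j y hs - D j x hs - (c' - c) *\<^sub>R D (Suc j) x (v # hs) = 0" using True by simp
        then show ?thesis using e by simp
      next
        case False
        have "norm (c' - c) * (norm v + 1) < d" using c' by (simp add: pos_less_divide_eq add_nonneg_pos)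
        then have "dist y x < d" unfolding dist_norm yx norm_scaleR
          by (simp add: algebra_simps)
        then have "norm (D j y hs - D j x hs - D (Suc j) x ((y - x) # hs)) \<le> \<epsilon> * norm (y - x) * nprod hs"
          using False by (intro est[OF y e'] db[OF y])
        also have "\<dots> = (\<epsilon> * (norm v * nprod hs)) * norm (c' - c)" by (simp add: yx mult_ac)
        also have "\<dots> \<le> e * norm (c' - c)" using le by (intro mult_right_mono) auto
        finally show ?thesis by (simp add: yx scale)
      qed
      then show "norm (D j (\<phi> + c' *\<^sub>R v) hs - D j (\<phi> + c *\<^sub>R v) hs - (c' - c) *\<^sub>R D (Suc j) x (v # hs)) \<le> e * norm (c' - c)"
        by (simp add: y_def x_def)
    qed
  qed
  then show ?thesis by (simp add: has_vector_derivative_def x_def)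
qed

lemma Ck_lipschitz:
  assumes V: "subspace V" and C: "Ck_with V k f D" and j: "j < k" and \<phi>: "\<phi> \<in> V" "\<psi> \<in> V"
    and hs: "length hs = j" "set hs \<subseteq> V"
    and B: "\<And>x vs. x \<in> V \<Longrightarrow> length vs = Suc j \<Longrightarrow> set vs \<subseteq> V \<Longrightarrow> norm (D (Suc j) x vs) \<le> B * nprod vs"
  shows "norm (D j \<psi> hs - D j \<phi> hs) \<le> B * norm (\<psi> - \<phi>) * nprod hs"
proof -
  define v where "v = \<psi> - \<phi>"
  have v: "v \<in> V" unfolding v_def using V \<phi> by (simp add: subspace_diff)
  have "norm (D j (\<phi> + 1 *\<^sub>R v) hs - D j (\<phi> + 0 *\<^sub>R v) hs) \<le> (B * norm v * nprod hs) * norm (1 - 0 :: real)"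
  proof (rule differentiable_bound[where S = UNIV and f = "\<lambda>c. D j (\<phi> + c *\<^sub>R v) hs" and f' = "\<lambda>c h. h *\<^sub>R D (Suc j) (\<phi> + c *\<^sub>R v) (v # hs)"])
    show "((\<lambda>c. D j (\<phi> + c *\<^sub>R v) hs) has_derivative (\<lambda>h. h *\<^sub>R D (Suc j) (\<phi> + c *\<^sub>R v) (v # hs))) (at c)" for c
      using Ck_path_derivative[OF V C j \<phi>(1) v hs, of c] by (simp add: has_vector_derivative_def)
    show "onorm (\<lambda>h. h *\<^sub>R D (Suc j) (\<phi> + c *\<^sub>R v) (v # hs)) \<le> B * norm v * nprod hs" for c
    proof (rule onorm_le)
      fix h :: real
      have "norm (D (Suc j) (\<phi> + c *\<^sub>R v) (v # hs)) \<le> B * nprod (v # hs)"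
        using V \<phi> v hs by (intro B subspace_add subspace_scale) auto
      then show "norm (h *\<^sub>R D (Suc j) (\<phi> + c *\<^sub>R v) (v # hs)) \<le> B * norm v * nprod hs * norm h"
        using mult_left_mono[of _ _ "\<bar>h\<bar>"] by (fastforce simp: mult_ac)
    qed
  qed auto
  then show ?thesis by (simp add: v_def)
qed

lemma Ck_taylor:
  assumes V: "subspace V" and C: "Ck_with V k f D" and j: "j < k" and \<phi>: "\<phi> \<in> V" "\<psi> \<in> V"
    and hs: "length hs = j" "set hs \<subseteq> V"
    and B: "\<And>x y vs. x \<in> V \<Longrightarrow> y \<in> V \<Longrightarrow> length vs = Suc j \<Longrightarrow> set vs \<subseteq> V \<Longrightarrow>
       norm (D (Suc j) y vs - D (Suc j) x vs) \<le> B * norm (y - x) * nprod vs" and B0: "0 \<le> B"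
  shows "norm (D j \<psi> hs - D j \<phi> hs - D (Suc j) \<phi> ((\<psi> - \<phi>) # hs)) \<le> B * (norm (\<psi> - \<phi>))\<^sup>2 * nprod hs"
proof -
  define v where "v = \<psi> - \<phi>"
  have v: "v \<in> V" unfolding v_def using V \<phi> by (simp add: subspace_diff)
  let ?f' = "\<lambda>c. D (Suc j) (\<phi> + c *\<^sub>R v) (v # hs)"
  have "norm (D j (\<phi> + 1 *\<^sub>R v) hs - D j (\<phi> + 0 *\<^sub>R v) hs - (1 - 0) *\<^sub>R ?f' 0) \<le> norm (1 - 0 :: real) * (B * (norm v)\<^sup>2 * nprod hs)"
  proof (rule vector_differentiable_bound_linearization[where S = "{0..1}" and f = "\<lambda>c. D j (\<phi> + c *\<^sub>R v) hs" and f' = "?f'"])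
    show "((\<lambda>c. D j (\<phi> + c *\<^sub>R v) hs) has_vector_derivative ?f' c) (at c within {0..1})" for c
      using Ck_path_derivative[OF V C j \<phi>(1) v hs, of c] by (rule has_vector_derivative_at_within)
    show "norm (?f' c - ?f' 0) \<le> B * (norm v)\<^sup>2 * nprod hs" if "c \<in> {0..1}" for c :: real
    proof -
      have "norm (?f' c - ?f' 0) \<le> B * norm ((\<phi> + c *\<^sub>R v) - (\<phi> + 0 *\<^sub>R v)) * nprod (v # hs)"
        using V \<phi> v hs by (intro B subspace_add subspace_scale) auto
      also have "\<dots> = c * (B * (norm v)\<^sup>2 * nprod hs)" using that by (simp add: power2_eq_square mult_ac)
      also have "\<dots> \<le> B * (norm v)\<^sup>2 * nprod hs"
        using that B0 nprod_nonneg[of hs] by (intro mult_left_le_one_le mult_nonneg_nonneg) auto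
      finally show ?thesis .
    qed
  qed (auto simp: closed_segment_eq_real_ivl)
  then show ?thesis by (simp add: v_def)
qed

text \<open>
  A bound for the derivative of order \<open>j + 1\<close> makes the one of order \<open>j\<close> Lipschitz, and a Lipschitz
  bound for it makes the Taylor remainder of order \<open>j\<close> quadratic.
\<close>

lemma tower_from_Ck:
  assumes V: "subspace V" and C: "Ck_with V k f D" and k: "1 \<le> k" and K: "0 \<le> K" "0 \<le> K1"
    and b: "\<And>j \<phi>. 1 \<le> j \<Longrightarrow> j \<le> k \<Longrightarrow> \<phi> \<in> V \<Longrightarrow> ml_norm V j (D j \<phi>) \<le> ennreal K"
    and b1: "\<And>\<phi>. \<phi> \<in> V \<Longrightarrow> ml_norm V 1 (D 1 \<phi>) \<le> ennreal K1"
    and l: "\<And>\<phi> \<psi>. \<phi> \<in> V \<Longrightarrow> \<psi> \<in> V \<Longrightarrow> ml_norm V k (\<lambda>hs. D k \<phi> hs - D k \<psi> hs) \<le> ennreal (K * norm (\<phi> - \<psi>))"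
  shows "tower V k D K K1"
proof -
  have bounded_mlin: "bounded_mlin V m K (D m \<phi>)" if "1 \<le> m" "m \<le> k" "\<phi> \<in> V" for m \<phi>
    unfolding bounded_mlin_def
  proof (intro conjI allI impI; (elim conjE)?)
    show "mlin V m (D m \<phi>)" by (rule Ck_mlin[OF C that(2,3)])
    then show "norm (D m \<phi> vs) \<le> K * nprod vs" if "length vs = m" "set vs \<subseteq> V" for vs
      by (rule ml_norm_boundD[OF V _ b K(1)]) (use that \<open>1 \<le> m\<close> \<open>m \<le> k\<close> \<open>\<phi> \<in> V\<close> in auto)
  qed
  have lip: "norm (D m \<psi> vs - D m \<phi> vs) \<le> K * norm (\<psi> - \<phi>) * nprod vs"
    if m: "1 \<le> m" "m \<le> k" "\<phi> \<in> V" "\<psi> \<in> V" "length vs = m" "set vs \<subseteq> V" for m \<phi> \<psi> vs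
  proof (cases "m < k")
    case True
    show ?thesis by (rule Ck_lipschitz[OF V C True]) (use m True bounded_mlin_bound[OF bounded_mlin] in auto)
  next
    case False
    then have "m = k" using m by simp
    then show ?thesis using m K l[OF m(4,3)] Ck_mlin[OF C _ m(3), of k] Ck_mlin[OF C _ m(4), of k]
      by (intro ml_norm_boundD[OF V mlin_diff]) auto
  qed
  have bound1: "norm (D 1 \<phi> vs) \<le> K1 * nprod vs" if "\<phi> \<in> V" "length vs = Suc 0" "set vs \<subseteq> V" for \<phi> vs
    using that k K b1[OF that(1)] Ck_mlin[OF C _ that(1), of 1] by (intro ml_norm_boundD[OF V, of 1]) auto
  show ?thesis
  proof
    show "norm (D 1 \<phi> [v]) \<le> K1 * norm v" if "\<phi> \<in> V" "v \<in> V" for \<phi> v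
      using bound1[of \<phi> "[v]"] that by auto
    show "norm (D 0 \<psi> [] - D 0 \<phi> []) \<le> K1 * norm (\<psi> - \<phi>)" if "\<phi> \<in> V" "\<psi> \<in> V" for \<phi> \<psi>
      using Ck_lipschitz[OF V C _ that, of 0 "[]" K1] bound1 k by auto
    show "norm (D m \<psi> vs - D m \<phi> vs - D (Suc m) \<phi> ((\<psi> - \<phi>) # vs)) \<le> K * (norm (\<psi> - \<phi>))\<^sup>2 * nprod vs"
      if "m < k" "\<phi> \<in> V" "\<psi> \<in> V" "length vs = m" "set vs \<subseteq> V" for m \<phi> \<psi> vs
      using that lip K by (intro Ck_taylor[OF V C]) auto
  qed (use V k K bounded_mlin lip in auto)
qed

lemma faa_di_bruno_rest_cong:
  assumes "hs \<noteq> []" "\<And>b. length b < length hs \<Longrightarrow> g b = g' b"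
  shows "faa_di_bruno_rest D g hs = faa_di_bruno_rest D g' hs"
  unfolding faa_di_bruno_rest_def
proof (intro arg_cong[where f = sum_list] map_cong refl)
  fix p assume p: "p \<in> set (proper_partitions hs)"
  have "map g p = map g' p" using proper_partitions_props[OF p] assms(2) by (intro map_cong) auto
  moreover have "g [] = g' []" using assms by simp
  ultimately show "D (length p) (g []) (map g p) = D (length p) (g' []) (map g' p)" by (simp only:)
qed

lemma faa_di_bruno_cong:
  assumes "\<And>b. length b \<le> length hs \<Longrightarrow> g b = g' b"
  shows "faa_di_bruno D g hs = faa_di_bruno D g' hs"
  using assms faa_di_bruno_rest_cong[of hs g g' D] by (auto simp: faa_di_bruno_def)

section \<open>Construction of the derivatives of the solution map\<close>

text \<open>
  The derivatives of the identity map, that is of the term \<open>\<xi>\<close> in the integrated equation.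
\<close>

fun id_jet :: "'a::zero \<Rightarrow> 'a list \<Rightarrow> 'a" where
  "id_jet \<xi> [] = \<xi>"
| "id_jet \<xi> [h] = h"
| "id_jet \<xi> (_ # _ # _) = 0"

text \<open>
  \<open>DF t m\<close> is the \<open>m\<close>-th derivative of \<open>F t\<close>, and \<open>\<nu>\<close> is the basic growth rate.  Derivatives of order \<open>j\<close>
  live in the weight \<open>j \<nu>\<close>; a single \<open>\<kappa> < 1\<close> is the contraction constant for all the weights
  up to \<open>k + 1\<close>.
\<close>

locale delay_eq = delay_op r M L for r M :: real and L :: "real \<Rightarrow> (real \<Rightarrow>\<^sub>C 'a::banach) \<Rightarrow> 'a" +
  fixes k :: nat and DF :: "real \<Rightarrow> nat \<Rightarrow> (real \<Rightarrow>\<^sub>C 'a) \<Rightarrow> (real \<Rightarrow>\<^sub>C 'a) list \<Rightarrow> 'a" and K K1 \<nu> \<kappa> F0 :: real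
  assumes tw: "tower V k (DF t) K K1"
    and DF0_cont: "\<phi> \<in> V \<Longrightarrow> continuous_on UNIV (\<lambda>t. DF t 0 \<phi> [])"
    and DF0_0: "norm (DF t 0 0 []) \<le> F0 * exp (\<nu> * \<bar>t\<bar>)"
    and lam: "0 < \<nu>"
    and kap: "1 \<le> j \<Longrightarrow> j \<le> k + 1 \<Longrightarrow> M * exp (real j * \<nu> * r) + K1 * exp (real j * \<nu> * r) / (real j * \<nu>) \<le> \<kappa>" "\<kappa> < 1"
begin

lemmas tower_constants = tower.k1[OF tw] tower.K0[OF tw]

lemma sub: "subspace V" by (rule subspace_phase_space)

text \<open>
  \<open>e\<close> is the weight for values at time \<open>t\<close> and \<open>w\<close> the one for segments ending at time \<open>t\<close>.  The
  powers that occur differ at most by the factor \<open>E\<close>.  \<open>A0\<close> is the amplification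
  from data to solution in \<open>weighted_bound_pow\<close>.
\<close>

definition e :: "real \<Rightarrow> real" where "e t = exp (\<nu> * \<bar>t\<bar>)"
definition w :: "real \<Rightarrow> real" where "w t = exp (\<nu> * (\<bar>t\<bar> + r))"
definition E :: real where "E = exp (real (k + 1) * \<nu> * r)"
definition A0 :: real where "A0 = (1 + E / \<nu>) / (1 - \<kappa>)"

lemma e_ge1: "1 \<le> e t" and w0: "0 \<le> w t" using lam by (auto simp: e_def w_def)

lemma e_pow: "e t ^ j = exp (real j * \<nu> * \<bar>t\<bar>)"
  by (simp add: e_def mult_ac flip: exp_of_nat_mult)

lemma w_pow: "w t ^ j = exp (real j * \<nu> * (\<bar>t\<bar> + r))"
  by (simp add: w_def mult_ac flip: exp_of_nat_mult)

lemma w_e: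
  assumes "j \<le> k + 1"
  shows "w t ^ j \<le> E * e t ^ j"
proof -
  have "real j * (\<nu> * r) \<le> real (k + 1) * (\<nu> * r)"
    using assms lam r by (intro mult_right_mono) auto
  then show ?thesis unfolding w_pow e_pow E_def exp_add[symmetric] exp_le_cancel_iff
    by (simp only: distrib_left mult.assoc)
qed

lemma e_mono: "i \<le> j \<Longrightarrow> e t ^ i \<le> e t ^ j" using e_ge1 by (intro power_increasing)

lemma norm_seg_w:
  assumes "continuous_on UNIV z" "\<And>s. norm (z s) \<le> C * e s ^ j" "0 \<le> C"
  shows "norm (seg z t) \<le> C * w t ^ j"
  unfolding w_pow using assms lam by (intro norm_seg_le r0) (auto simp: e_pow)

lemma weighted_bound_pow:
  assumes j: "1 \<le> j" "j \<le> k + 1" and s: "sol z q g" and B: "\<exists>B. \<forall>t. norm (z t) \<le> B * e t ^ j"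
    and q: "norm q \<le> c" and g: "\<And>s. norm (g s) \<le> K1 * norm (seg z s) + c * w s ^ j"
  shows "norm (z t) \<le> A0 * c * e t ^ j"
proof -
  have c: "0 \<le> c" using q norm_ge_zero[of q] by linarith
  have E: "0 < E" by (simp add: E_def)
  have jl: "\<nu> \<le> real j * \<nu>" using j lam by simp
  have "norm (z t) \<le> (norm q + (c * E) / (real j * \<nu>)) / (1 - \<kappa>) * exp (real j * \<nu> * \<bar>t\<bar>)"
  proof (rule weighted_bound[OF s _ tower_constants(3)])
    show "0 < real j * \<nu>" using j lam by simp
    show "\<exists>B. \<forall>t. norm (z t) \<le> B * exp (real j * \<nu> * \<bar>t\<bar>)" using B unfolding e_pow .
    show "norm (g s) \<le> K1 * norm (seg z s) + c * E * exp (real j * \<nu> * \<bar>s\<bar>)" for s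
      using g[of s] mult_left_mono[OF w_e[OF j(2), of s] c] by (simp add: e_pow mult_ac)
  qed (use kap j in auto)
  also have "\<dots> \<le> (c + (c * E) / \<nu>) / (1 - \<kappa>) * exp (real j * \<nu> * \<bar>t\<bar>)"
    using q c E lam kap(2) jl j
    by (intro mult_right_mono divide_right_mono add_mono divide_left_mono mult_nonneg_nonneg) auto
  also have "\<dots> = A0 * c * e t ^ j" by (simp add: A0_def e_pow algebra_simps)
  finally show ?thesis .
qed

text \<open>
  Continuity in time passes from \<open>F\<close> to its derivatives in the second variable: the difference
  quotients converge uniformly in \<open>t\<close>, because the constant in the Taylor estimate does not depend on \<open>t\<close>.
\<close>

lemma DF_cont:
  assumes "m \<le> k" "\<phi> \<in> V" "length vs = m" "set vs \<subseteq> V"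
  shows "continuous_on UNIV (\<lambda>t. DF t m \<phi> vs)"
  using assms
proof (induction m arbitrary: \<phi> vs)
  case 0
  then show ?case using DF0_cont by simp
next
  case (Suc m)
  then obtain v hs where vs: "vs = v # hs" by (cases vs) auto
  have v: "v \<in> V" and hs: "length hs = m" "set hs \<subseteq> V" using Suc.prems vs by auto
  define f where "f = (\<lambda>(c::real) t. (DF t m (\<phi> + c *\<^sub>R v) hs - DF t m \<phi> hs) /\<^sub>R c)"
  have inV: "\<phi> + c *\<^sub>R v \<in> V" for c using sub Suc.prems v by (intro subspace_add subspace_scale)
  define B where "B = K * (norm v)\<^sup>2 * nprod hs"
  have B0: "0 \<le> B" using tower_constants nprod_nonneg[of hs] by (auto simp: B_def)
  have est: "norm (f c t - DF t (Suc m) \<phi> vs) \<le> B * \<bar>c\<bar>" if c: "c \<noteq> 0" for c t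
  proof -
    have ml: "mlin V (Suc m) (DF t (Suc m) \<phi>)"
      using tower.bounded_mlin[OF tw, of "Suc m" \<phi>] Suc.prems by (simp add: bounded_mlin_def)
    have "DF t (Suc m) \<phi> ((c *\<^sub>R v + 0 *\<^sub>R v) # hs) = c *\<^sub>R DF t (Suc m) \<phi> (v # hs) + 0 *\<^sub>R DF t (Suc m) \<phi> (v # hs)"
      using ml hs v by (auto simp only: mlin.simps)
    then have s: "DF t (Suc m) \<phi> ((c *\<^sub>R v) # hs) = c *\<^sub>R DF t (Suc m) \<phi> vs" by (simp add: vs)
    have "norm (DF t m (\<phi> + c *\<^sub>R v) hs - DF t m \<phi> hs - DF t (Suc m) \<phi> (((\<phi> + c *\<^sub>R v) - \<phi>) # hs))
       \<le> K * (norm ((\<phi> + c *\<^sub>R v) - \<phi>))\<^sup>2 * nprod hs"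
      using Suc.prems hs inV by (intro tower.tay[OF tw]) auto
    then have 1: "norm (DF t m (\<phi> + c *\<^sub>R v) hs - DF t m \<phi> hs - c *\<^sub>R DF t (Suc m) \<phi> vs) \<le> B * c\<^sup>2"
      by (simp add: s B_def power_mult_distrib mult_ac)
    have "f c t - DF t (Suc m) \<phi> vs = (DF t m (\<phi> + c *\<^sub>R v) hs - DF t m \<phi> hs - c *\<^sub>R DF t (Suc m) \<phi> vs) /\<^sub>R c"
      using c by (simp add: f_def scaleR_diff_right)
    then have "norm (f c t - DF t (Suc m) \<phi> vs) \<le> B * c\<^sup>2 / \<bar>c\<bar>"
      using divide_right_mono[OF 1, of "\<bar>c\<bar>"] by (simp add: divide_inverse_commute)
    also have "\<dots> = B * \<bar>c\<bar>" using c by (simp add: power2_eq_square abs_if field_simps)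
    finally show ?thesis .
  qed
  show ?case
  proof (rule uniform_limit_theorem[where F = "at (0::real)" and f = f])
    show "\<forall>\<^sub>F c in at 0. continuous_on UNIV (f c)"
      unfolding f_def using Suc.prems hs inV
      by (intro always_eventually allI continuous_intros Suc.IH) auto
    show "uniform_limit UNIV f (\<lambda>t. DF t (Suc m) \<phi> vs) (at 0)"
    proof (rule uniform_limitI)
      fix \<epsilon> :: real assume \<epsilon>: "0 < \<epsilon>"
      show "\<forall>\<^sub>F c in at 0. \<forall>t\<in>UNIV. dist (f c t) (DF t (Suc m) \<phi> vs) < \<epsilon>"
        unfolding eventually_at
      proof (intro exI[of _ "\<epsilon> / (B + 1)"] conjI ballI impI; (elim conjE)?)
        show "0 < \<epsilon> / (B + 1)" using \<epsilon> B0 by simp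
        fix c t assume c: "c \<noteq> (0::real)" "dist c 0 < \<epsilon> / (B + 1)"
        then have "\<bar>c\<bar> * (B + 1) < \<epsilon>" using B0 by (simp add: pos_less_divide_eq)
        then have "B * \<bar>c\<bar> < \<epsilon>" by (simp add: algebra_simps)
        then show "dist (f c t) (DF t (Suc m) \<phi> vs) < \<epsilon>" using est[OF c(1), of t] by (simp add: dist_norm)
      qed
    qed
  qed simp
qed

lemma DF_seg_cont:
  assumes m: "m \<le> k" and x: "continuous_on UNIV x" and vs: "length vs = m" "set vs \<subseteq> V"
  shows "continuous_on UNIV (\<lambda>t. DF t m (seg x t) vs)"
proof (rule continuous_lipschitz_family[where V = V and K = "max (K * nprod vs) K1" and G = "\<lambda>t \<phi>. DF t m \<phi> vs"])
  show "norm (DF t m \<phi> vs - DF t m \<psi> vs) \<le> max (K * nprod vs) K1 * norm (\<phi> - \<psi>)" if "\<phi> \<in> V" "\<psi> \<in> V" for t \<phi> \<psi>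
  proof (cases "m = 0")
    case True
    then have "norm (DF t m \<phi> vs - DF t m \<psi> vs) \<le> K1 * norm (\<phi> - \<psi>)"
      using tower.lip0[OF tw that(2,1)] vs by simp
    also have "\<dots> \<le> max (K * nprod vs) K1 * norm (\<phi> - \<psi>)" by (intro mult_right_mono) auto
    finally show ?thesis .
  next
    case False
    then have "norm (DF t m \<phi> vs - DF t m \<psi> vs) \<le> K * norm (\<phi> - \<psi>) * nprod vs"
      using tower.lip[OF tw _ m that(2,1) vs] by simp
    also have "\<dots> = K * nprod vs * norm (\<phi> - \<psi>)" by simp
    also have "\<dots> \<le> max (K * nprod vs) K1 * norm (\<phi> - \<psi>)" by (intro mult_right_mono) auto
    finally show ?thesis .
  qed
qed (use assms DF_cont continuous_seg[OF r0] seg_V in auto)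

lemma DF_term_cont:
  assumes m: "1 \<le> length p" "length p \<le> k" and x: "continuous_on UNIV x" and y: "\<And>b. b \<in> set p \<Longrightarrow> continuous_on UNIV (y b)"
  shows "continuous_on UNIV (\<lambda>t. DF t (length p) (seg x t) (map (\<lambda>b. seg (y b) t) p))"
proof -
  have "((\<lambda>t. DF t (length p) (seg x t) (map (\<lambda>f. f t) (map (\<lambda>b. seg (y b)) p)))
     \<longlongrightarrow> DF t0 (length p) (seg x t0) (map (\<lambda>f. f t0) (map (\<lambda>b. seg (y b)) p))) (at t0)" for t0
  proof (rule bounded_mlin_tendsto[OF sub, where K = K])
    show "bounded_mlin V (length (map (\<lambda>b. seg (y b)) p)) K (DF s (length p) (seg x s))" for s
      using m seg_V[OF x] by (auto intro: tower.bounded_mlin[OF tw])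
    show "((\<lambda>s. DF s (length p) (seg x s) vs) \<longlongrightarrow> DF t0 (length p) (seg x t0) vs) (at t0)"
      if "length vs = length (map (\<lambda>b. seg (y b)) p)" "set vs \<subseteq> V" for vs
      using DF_seg_cont[OF m(2) x, of vs] that by (simp add: continuous_on_def)
    show "(f \<longlongrightarrow> f t0) (at t0)" if f: "f \<in> set (map (\<lambda>b. seg (y b)) p)" for f
    proof -
      obtain b where b: "b \<in> set p" "f = seg (y b)" using f by auto
      then have "continuous_on UNIV f" using continuous_seg[OF r0 y] by simp
      then show ?thesis by (simp add: continuous_on_def)
    qed
  qed (use y seg_V in auto)
  then show ?thesis by (simp add: continuous_on_def comp_def)
qed

lemma continuous_on_sum_list:
  fixes f :: "'p \<Rightarrow> real \<Rightarrow> 'c::real_normed_vector"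
  shows "(\<And>p. p \<in> set ps \<Longrightarrow> continuous_on S (f p)) \<Longrightarrow> continuous_on S (\<lambda>t. \<Sum>p\<leftarrow>ps. f p t)"
  by (induction ps) (auto intro!: continuous_intros)

lemma faa_di_bruno_rest_cont:
  assumes hs: "length hs \<le> k" "hs \<noteq> []" and Y: "\<And>b. length b < length hs \<Longrightarrow> continuous_on UNIV (Y b)"
  shows "continuous_on UNIV (\<lambda>t. faa_di_bruno_rest (DF t) (\<lambda>b. seg (Y b) t) hs)"
proof -
  have "continuous_on UNIV (\<lambda>t. DF t (length p) (seg (Y []) t) (map (\<lambda>b. seg (Y b) t) p))" if "p \<in> set (proper_partitions hs)" for p
    using proper_partitions_props[OF that] hs Y by (intro DF_term_cont) auto
  then show ?thesis unfolding faa_di_bruno_rest_def by (rule continuous_on_sum_list)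
qed

text \<open>
  The equation that the derivative in the directions \<open>hs\<close> has to satisfy, with its growth bound.  The
  bound for the solution itself depends on \<open>\<xi>\<close>, the ones for its derivatives do not.
\<close>

definition is_jet :: "real \<Rightarrow> ('a \<Rightarrow> 'a list \<Rightarrow> real \<Rightarrow> 'a) \<Rightarrow> 'a \<Rightarrow> 'a list \<Rightarrow> bool" where
  "is_jet C Y \<xi> hs \<longleftrightarrow> sol (Y \<xi> hs) (id_jet \<xi> hs) (\<lambda>t. faa_di_bruno (DF t) (\<lambda>b. seg (Y \<xi> b) t) hs) \<and>
     (if hs = [] then \<exists>B. \<forall>t. norm (Y \<xi> hs t) \<le> B * e t else \<forall>t. norm (Y \<xi> hs t) \<le> C * wprod (e t) hs)"

text \<open>
  Order by order: the solution is the fixed point of the nonlinear equation, and each further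
  derivative solves a linear equation whose inhomogeneity \<open>R\<close> is built from lower orders.  The bound of
  \<open>R\<close> is homogeneous in \<open>hs\<close>, and \<open>weighted_bound_pow\<close> hands this on to the new derivative.
\<close>

lemma jet_exists:
  "n \<le> k \<Longrightarrow> \<exists>C\<ge>1. \<exists>Y. \<forall>\<xi> hs. length hs \<le> n \<longrightarrow> is_jet C Y \<xi> hs"
proof (induction n)
  case 0
  have "\<exists>z. sol z \<xi> (\<lambda>s. DF s 0 (seg z s) []) \<and> (\<exists>B. \<forall>t. norm (z t) \<le> B * exp (\<nu> * \<bar>t\<bar>))" for \<xi>
    using kap(1)[of 1] DF0_cont DF0_0
    by (intro solution_exists[OF lam tower_constants(3) _ _ _ _ kap(2)] tower.lip0[OF tw]) auto
  then obtain Z where "\<And>\<xi>. sol (Z \<xi>) \<xi> (\<lambda>s. DF s 0 (seg (Z \<xi>) s) [])" "\<And>\<xi>. \<exists>B. \<forall>t. norm (Z \<xi> t) \<le> B * exp (\<nu> * \<bar>t\<bar>)"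
    by metis
  then have "\<forall>\<xi> hs. length hs \<le> 0 \<longrightarrow> is_jet 1 (\<lambda>\<xi> hs. Z \<xi>) \<xi> hs"
    by (auto simp: is_jet_def faa_di_bruno_def e_def)
  then show ?case by (intro exI[of _ 1] conjI) auto
next
  case (Suc n)
  then obtain C Y where C: "1 \<le> C" and Y: "\<And>\<xi> hs. length hs \<le> n \<Longrightarrow> is_jet C Y \<xi> hs" by auto
  have Yc: "continuous_on UNIV (Y \<xi> b)" if "length b \<le> n" for \<xi> b
    using Y[OF that, of \<xi>] solD(1) by (auto simp: is_jet_def)
  have YW: "norm (Y \<xi> b t) \<le> C * wprod (e t) b" if "length b \<le> n" "b \<noteq> []" for \<xi> b t
    using Y[OF that(1), of \<xi>] that(2) by (auto simp: is_jet_def)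
  have YwW: "norm (seg (Y \<xi> b) t) \<le> C * wprod (w t) b" if "length b \<le> n" "b \<noteq> []" for \<xi> b t
  proof -
    have "norm (seg (Y \<xi> b) t) \<le> (C * nprod b) * w t ^ length b"
      using YW[OF that] C nprod_nonneg[of b] by (intro norm_seg_w Yc that) (auto simp: wprod_eq mult_ac)
    then show ?thesis by (simp add: wprod_eq mult_ac)
  qed
  define c0 where "c0 = num_partitions (Suc n) * (K * C ^ k)"
  have c0: "0 \<le> c0" using tower_constants C by (simp add: c0_def num_partitions_def)
  define R where "R = (\<lambda>\<xi> hs t. faa_di_bruno_rest (DF t) (\<lambda>b. seg (Y \<xi> b) t) hs)"
  have Rb: "norm (R \<xi> hs t) \<le> c0 * nprod hs * w t ^ Suc n" if "length hs = Suc n" for \<xi> hs t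
  proof -
    have "norm (R \<xi> hs t) \<le> num_partitions (length hs) * (K * C ^ k * wprod (w t) hs)"
      unfolding R_def using that Suc.prems YwW C w0 by (intro tower.rest_bound[OF tw]) (auto intro!: seg_V Yc)
    then show ?thesis by (simp add: that c0_def wprod_eq mult_ac)
  qed
  have "\<exists>z. sol z (id_jet \<xi> hs) (\<lambda>s. DF s 1 (seg (Y \<xi> []) s) [seg z s] + R \<xi> hs s) \<and>
      (\<forall>t. norm (z t) \<le> A0 * ((1 + c0) * nprod hs) * e t ^ Suc n)" if hs: "length hs = Suc n" for \<xi> hs
  proof -
    let ?G = "\<lambda>s \<phi>. DF s 1 (seg (Y \<xi> []) s) [\<phi>] + R \<xi> hs s"
    have x: "continuous_on UNIV (Y \<xi> [])" by (intro Yc) auto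
    have D1: "DF s 1 (seg (Y \<xi> []) s) [\<phi>] - DF s 1 (seg (Y \<xi> []) s) [\<psi>] = DF s 1 (seg (Y \<xi> []) s) [\<phi> - \<psi>]"
      if "\<phi> \<in> V" "\<psi> \<in> V" for s \<phi> \<psi> using tower.D1_diff[OF tw seg_V[OF x] that] by simp
    have D1b: "norm (DF s 1 (seg (Y \<xi> []) s) [\<phi>]) \<le> K1 * norm \<phi>" if "\<phi> \<in> V" for s \<phi>
      by (rule tower.bound1[OF tw seg_V[OF x] that])
    have D10: "DF s 1 (seg (Y \<xi> []) s) [0] = 0" for s using D1b[of 0 s] sub by (simp add: subspace_0)
    have "\<exists>z. sol z (id_jet \<xi> hs) (\<lambda>s. ?G s (seg z s)) \<and> (\<exists>B. \<forall>t. norm (z t) \<le> B * exp (real (Suc n) * \<nu> * \<bar>t\<bar>))"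
    proof (rule solution_exists[OF _ tower_constants(3) _ _ _ kap])
      show "norm (?G t \<phi> - ?G t \<psi>) \<le> K1 * norm (\<phi> - \<psi>)" if "\<phi> \<in> V" "\<psi> \<in> V" for t \<phi> \<psi>
        using D1[OF that, of t] D1b[of "\<phi> - \<psi>" t] subspace_diff[OF sub that] by simp
      show "continuous_on UNIV (\<lambda>t. ?G t \<phi>)" if "\<phi> \<in> V" for \<phi>
        unfolding R_def using that tower_constants hs Suc.prems
        by (intro continuous_intros faa_di_bruno_rest_cont Yc DF_seg_cont) auto
      show "norm (?G t 0) \<le> c0 * nprod hs * E * exp (real (Suc n) * \<nu> * \<bar>t\<bar>)" for t
      proof -
        have "norm (?G t 0) \<le> c0 * nprod hs * w t ^ Suc n" using Rb[OF hs, of \<xi> t] by (simp only: D10 add_0)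
        also have "\<dots> \<le> c0 * nprod hs * (E * e t ^ Suc n)"
          using c0 nprod_nonneg[of hs] Suc.prems by (intro mult_left_mono w_e mult_nonneg_nonneg) auto
        finally show ?thesis unfolding e_pow by (simp only: mult_ac)
      qed
    qed (use lam Suc.prems in auto)
    then obtain z where z: "sol z (id_jet \<xi> hs) (\<lambda>s. ?G s (seg z s))" "\<exists>B. \<forall>t. norm (z t) \<le> B * e t ^ Suc n"
      unfolding e_pow by blast
    have "norm (z t) \<le> A0 * ((1 + c0) * nprod hs) * e t ^ Suc n" for t
    proof (rule weighted_bound_pow[OF _ _ z])
      show "norm (id_jet \<xi> hs) \<le> (1 + c0) * nprod hs"
        using c0 hs nprod_nonneg[of hs] by (cases "(\<xi>, hs)" rule: id_jet.cases) (auto simp: algebra_simps)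
      show "norm (?G s (seg z s)) \<le> K1 * norm (seg z s) + (1 + c0) * nprod hs * w s ^ Suc n" for s
      proof -
        have "c0 * nprod hs * w s ^ Suc n \<le> (1 + c0) * nprod hs * w s ^ Suc n"
          using nprod_nonneg[of hs] w0 by (intro mult_right_mono) auto
        then show ?thesis
          using norm_triangle_ineq[of "DF s 1 (seg (Y \<xi> []) s) [seg z s]" "R \<xi> hs s"] Rb[OF hs, of \<xi> s]
            D1b[OF seg_V[OF solD(1)[OF z(1)], of s], of s] by linarith
      qed
    qed (use Suc.prems in auto)
    then show ?thesis using z(1) by blast
  qed
  note ex = this
  define P where "P = (\<lambda>\<xi> hs z. sol z (id_jet \<xi> hs) (\<lambda>s. DF s 1 (seg (Y \<xi> []) s) [seg z s] + R \<xi> hs s) \<and>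
      (\<forall>t. norm (z t) \<le> A0 * ((1 + c0) * nprod hs) * e t ^ Suc n))"
  define Z where "Z = (\<lambda>\<xi> hs. SOME z. P \<xi> hs z)"
  have "P \<xi> hs (Z \<xi> hs)" if "length hs = Suc n" for \<xi> hs
  proof -
    have "\<exists>z. P \<xi> hs z" unfolding P_def by (rule ex[OF that])
    then show ?thesis unfolding Z_def by (rule someI_ex)
  qed
  then have Z: "sol (Z \<xi> hs) (id_jet \<xi> hs) (\<lambda>s. DF s 1 (seg (Y \<xi> []) s) [seg (Z \<xi> hs) s] + R \<xi> hs s)"
      and Zb: "\<And>t. norm (Z \<xi> hs t) \<le> A0 * ((1 + c0) * nprod hs) * e t ^ Suc n"
    if "length hs = Suc n" for \<xi> hs
    using that unfolding P_def by blast+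
  define Y' where "Y' = (\<lambda>\<xi> hs. if length hs = Suc n then Z \<xi> hs else Y \<xi> hs)"
  define C' where "C' = max C (A0 * (1 + c0))"
  have "is_jet C' Y' \<xi> hs" if "length hs \<le> Suc n" for \<xi> hs
  proof (cases "length hs = Suc n")
    case True
    then have ne: "hs \<noteq> []" by auto
    have "faa_di_bruno (DF t) (\<lambda>b. seg (Y' \<xi> b) t) hs = DF t 1 (seg (Y \<xi> []) t) [seg (Z \<xi> hs) t] + R \<xi> hs t" for t
    proof -
      have "faa_di_bruno_rest (DF t) (\<lambda>b. seg (Y' \<xi> b) t) hs = R \<xi> hs t"
        unfolding R_def using ne True by (intro faa_di_bruno_rest_cong) (auto simp: Y'_def)
      then show ?thesis using ne True by (simp add: faa_di_bruno_def Y'_def)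
    qed
    moreover have "norm (Z \<xi> hs t) \<le> C' * wprod (e t) hs" for t
    proof -
      have "norm (Z \<xi> hs t) \<le> (A0 * (1 + c0)) * wprod (e t) hs" using Zb[OF True, of \<xi> t] by (simp add: wprod_eq True mult_ac)
      also have "\<dots> \<le> C' * wprod (e t) hs" using e_ge1[of t] by (intro mult_right_mono wprod_nonneg) (auto simp: C'_def)
      finally show ?thesis .
    qed
    ultimately show ?thesis using Z[OF True, of \<xi>] ne True unfolding is_jet_def by (simp add: Y'_def)
  next
    case False
    then have l: "length hs \<le> n" using that by simp
    have faa_di_bruno_eq: "faa_di_bruno (DF t) (\<lambda>b. seg (Y' \<xi> b) t) hs = faa_di_bruno (DF t) (\<lambda>b. seg (Y \<xi> b) t) hs" for t
      using l by (intro faa_di_bruno_cong) (auto simp: Y'_def)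
    have "C * wprod (e t) hs \<le> C' * wprod (e t) hs" for t
      using e_ge1[of t] by (intro mult_right_mono wprod_nonneg) (auto simp: C'_def)
    then have "\<forall>t. norm (Y \<xi> hs t) \<le> C' * wprod (e t) hs" if "hs \<noteq> []"
      using YW[OF l that, of \<xi>] by (blast intro: order_trans)
    then have is_jet_C': "is_jet C' Y \<xi> hs" using Y[OF l, of \<xi>] unfolding is_jet_def by (cases "hs = []") simp_all
    have Y'_eq: "Y' \<xi> hs = Y \<xi> hs" using False by (simp add: Y'_def)
    show ?thesis using is_jet_C' unfolding is_jet_def faa_di_bruno_eq Y'_eq .
  qed
  moreover have "1 \<le> C'" using C by (simp add: C'_def)
  ultimately show ?case by blast
qed

end

section \<open>The constructed functions are derivatives\<close>

lemma map_nth_update_notin: "i \<notin> set b \<Longrightarrow> map ((!) (hs[i := x])) b = map ((!) hs) b"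
  by (intro map_cong refl nth_list_update_neq) auto

lemma split_by_member:
  assumes "distinct (concat p)" "i \<in> set (concat p)"
  shows "\<exists>p1 b1 b2 p2. p = p1 @ (b1 @ i # b2) # p2 \<and> i \<notin> set b1 \<and> i \<notin> set b2 \<and> (\<forall>b\<in>set p1 \<union> set p2. i \<notin> set b)"
proof -
  obtain b where b: "b \<in> set p" "i \<in> set b" using assms(2) by auto
  obtain p1 p2 where p: "p = p1 @ b # p2" using split_list[OF b(1)] by blast
  obtain b1 b2 where bb: "b = b1 @ i # b2" using split_list[OF b(2)] by blast
  show ?thesis using assms(1) unfolding p bb by (intro exI[of _ p1] exI[of _ b1] exI[of _ b2] exI[of _ p2]) auto
qed

text \<open>
  A position of the list belongs to exactly one block of a partition and occurs there once.  So
  changing the entry at that position changes one argument of the outer derivative, which is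
  linear in it, and this argument depends linearly on the entry.
\<close>

lemma (in tower) rest_slot_linear:
  assumes n: "length hs \<le> k" and g0: "g [] \<in> V"
    and gV: "\<And>b. length b < length hs \<Longrightarrow> g b \<in> V"
    and lin: "\<And>b j u v \<alpha> \<beta>. length b < length hs \<Longrightarrow> j < length b \<Longrightarrow>
        g (b[j := \<alpha> *\<^sub>R u + \<beta> *\<^sub>R v]) = \<alpha> *\<^sub>R g (b[j := u]) + \<beta> *\<^sub>R g (b[j := v])"
    and i: "i < length hs"
  shows "faa_di_bruno_rest D g (hs[i := \<alpha> *\<^sub>R u + \<beta> *\<^sub>R v]) = \<alpha> *\<^sub>R faa_di_bruno_rest D g (hs[i := u]) + \<beta> *\<^sub>R faa_di_bruno_rest D g (hs[i := v])"
proof -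
  define N where "N = proper_partitions [0..<length hs]"
  define T where "T = (\<lambda>x p. D (length p) (g []) (map (\<lambda>b. g (map ((!) (hs[i := x])) b)) p))"
  have rest: "faa_di_bruno_rest D g (hs[i := x]) = (\<Sum>p\<leftarrow>N. T x p)" for x
  proof -
    have "hs[i := x] = map ((!) (hs[i := x])) [0..<length (hs[i := x])]" by (rule map_nth[symmetric])
    then have "proper_partitions (hs[i := x]) = map (map (map ((!) (hs[i := x])))) N"
      unfolding N_def by (metis length_list_update map_proper_partitions)
    then show ?thesis by (simp add: faa_di_bruno_rest_def T_def comp_def)
  qed
  have T: "T (\<alpha> *\<^sub>R u + \<beta> *\<^sub>R v) p = \<alpha> *\<^sub>R T u p + \<beta> *\<^sub>R T v p" if p: "p \<in> set N" for p
  proof -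
    note pp = proper_partitions_props[OF p[unfolded N_def]]
    have d: "distinct (concat p)" and s: "set (concat p) = {0..<length hs}"
      using pp by (metis distinct_upt mset_eq_imp_distinct_iff, metis atLeastLessThan_upt mset_eq_setD pp)
    then obtain p1 b1 b2 p2 where sp: "p = p1 @ (b1 @ i # b2) # p2" "i \<notin> set b1" "i \<notin> set b2" "\<forall>b\<in>set p1 \<union> set p2. i \<notin> set b"
      using split_by_member[of p i] i by auto
    define B where "B = map ((!) hs) (b1 @ i # b2)"
    define P1 where "P1 = map (\<lambda>b. g (map ((!) hs) b)) p1"
    define P2 where "P2 = map (\<lambda>b. g (map ((!) hs) b)) p2"
    have len: "length B < length hs" using pp sp by (auto simp: B_def)
    have j: "length b1 < length B" by (simp add: B_def)
    have block: "map ((!) (hs[i := x])) (b1 @ i # b2) = B[length b1 := x]" for x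
      using sp i by (simp add: B_def map_nth_update_notin list_update_append)
    have Tx: "T x p = D (length p) (g []) ((P1 @ g B # P2)[length p1 := g (B[length b1 := x])])" for x
    proof -
      have "map (\<lambda>b. g (map ((!) (hs[i := x])) b)) p1 = P1" "map (\<lambda>b. g (map ((!) (hs[i := x])) b)) p2 = P2"
        using sp by (auto simp: P1_def P2_def map_nth_update_notin)
      moreover have "map (\<lambda>b. g (map ((!) (hs[i := x])) b)) p = map (\<lambda>b. g (map ((!) (hs[i := x])) b)) p1 @
          g (map ((!) (hs[i := x])) (b1 @ i # b2)) # map (\<lambda>b. g (map ((!) (hs[i := x])) b)) p2"
        unfolding sp(1) by simp
      ultimately have "map (\<lambda>b. g (map ((!) (hs[i := x])) b)) p = P1 @ g (B[length b1 := x]) # P2"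
        by (simp only: block)
      also have "\<dots> = (P1 @ g B # P2)[length p1 := g (B[length b1 := x])]" by (simp add: P1_def list_update_append)
      finally show ?thesis by (simp add: T_def)
    qed
    have gB: "g (B[length b1 := x]) \<in> V" for x using len by (intro gV) simp
    have "mlin V (length p) (D (length p) (g []))"
      using bounded_mlin[of "length p" "g []"] pp n g0 by (simp add: bounded_mlin_def)
    moreover have "length (P1 @ g B # P2) = length p" "set (P1 @ g B # P2) \<subseteq> V" "length p1 < length p"
      using pp sp(1) gV len by (auto simp: P1_def P2_def intro!: gV)
    ultimately show ?thesis
      unfolding Tx lin[OF len j] mlin_iff_slots using gB by simp
  qed
  have "(\<Sum>p\<leftarrow>N. T (\<alpha> *\<^sub>R u + \<beta> *\<^sub>R v) p) = \<alpha> *\<^sub>R (\<Sum>p\<leftarrow>N. T u p) + \<beta> *\<^sub>R (\<Sum>p\<leftarrow>N. T v p)"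
    using T by (induction N) (auto simp: algebra_simps)
  then show ?thesis by (simp only: rest)
qed

lemma id_jet_slot_linear: "i < length hs \<Longrightarrow>
   id_jet \<xi> (hs[i := \<alpha> *\<^sub>R u + \<beta> *\<^sub>R v]) = \<alpha> *\<^sub>R id_jet \<xi> (hs[i := u]) + \<beta> *\<^sub>R id_jet \<xi> (hs[i := v])"
  for \<xi> u v :: "'a::real_normed_vector"
  by (cases "(\<xi>, hs)" rule: id_jet.cases) (auto split: nat.split)

locale delay_jet = delay_eq r M L k DF K K1 \<nu> \<kappa> F0
  for r M :: real and L :: "real \<Rightarrow> (real \<Rightarrow>\<^sub>C 'a::banach) \<Rightarrow> 'a"
    and k :: nat and DF :: "real \<Rightarrow> nat \<Rightarrow> (real \<Rightarrow>\<^sub>C 'a) \<Rightarrow> (real \<Rightarrow>\<^sub>C 'a) list \<Rightarrow> 'a" and K K1 \<nu> \<kappa> F0 :: real +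
  fixes C :: real and Y :: "'a \<Rightarrow> 'a list \<Rightarrow> real \<Rightarrow> 'a"
  assumes C1: "1 \<le> C" and Y_is_jet: "length hs \<le> k \<Longrightarrow> is_jet C Y \<xi> hs"
begin

lemma Y_sol: "length hs \<le> k \<Longrightarrow> sol (Y \<xi> hs) (id_jet \<xi> hs) (\<lambda>t. faa_di_bruno (DF t) (\<lambda>b. seg (Y \<xi> b) t) hs)"
  using Y_is_jet unfolding is_jet_def by blast

lemma Y_cont: "length hs \<le> k \<Longrightarrow> continuous_on UNIV (Y \<xi> hs)"
  using Y_sol solD(1) by blast

lemma Y_bound: "length hs \<le> k \<Longrightarrow> hs \<noteq> [] \<Longrightarrow> norm (Y \<xi> hs t) \<le> C * nprod hs * e t ^ length hs"
  using Y_is_jet[of hs \<xi>] by (simp add: is_jet_def wprod_eq mult_ac)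

lemma Y_apriori: "length hs \<le> k \<Longrightarrow> max 1 (length hs) \<le> j \<Longrightarrow> \<exists>B. \<forall>t. norm (Y \<xi> hs t) \<le> B * e t ^ j"
proof (cases "hs = []")
  case True
  assume "max 1 (length hs) \<le> j"
  obtain B where B: "\<And>t. norm (Y \<xi> hs t) \<le> B * e t ^ 1"
    using Y_is_jet[of hs \<xi>] True by (auto simp: is_jet_def)
  then have B0: "0 \<le> B" using norm_ge_zero[of "Y \<xi> hs 0"] by (smt (verit) e_ge1 mult_neg_pos power_one_right)
  have "norm (Y \<xi> hs t) \<le> B * e t ^ j" for t
    using B[of t] mult_left_mono[OF e_mono[of 1 j t] B0] \<open>max 1 (length hs) \<le> j\<close> by simp
  then show ?thesis by blast
next
  case False
  assume l: "length hs \<le> k" "max 1 (length hs) \<le> j"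
  have "norm (Y \<xi> hs t) \<le> C * nprod hs * e t ^ j" for t
  proof -
    have "C * nprod hs * e t ^ length hs \<le> C * nprod hs * e t ^ j"
      using l(2) C1 nprod_nonneg[of hs] by (intro mult_left_mono e_mono mult_nonneg_nonneg) auto
    then show ?thesis using Y_bound[OF l(1) False, of \<xi> t] by linarith
  qed
  then show ?thesis by blast
qed

lemma seg_Y_V: "length hs \<le> k \<Longrightarrow> seg (Y \<xi> hs) t \<in> V"
  by (intro seg_V Y_cont)

lemma seg_Y_bound: "length hs \<le> k \<Longrightarrow> hs \<noteq> [] \<Longrightarrow> norm (seg (Y \<xi> hs) t) \<le> C * wprod (w t) hs"
  using norm_seg_w[OF Y_cont Y_bound, of hs \<xi> t] C1 nprod_nonneg[of hs] by (simp add: wprod_eq mult_ac)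

lemma seg_Y_diff: "length b \<le> k \<Longrightarrow> length c \<le> k \<Longrightarrow> seg (\<lambda>t. Y \<xi>' b t - Y \<xi> c t) t = seg (Y \<xi>' b) t - seg (Y \<xi> c) t"
  by (intro seg_diff[OF r0] Y_cont)

lemma seg_Y_taylor: "length b < k \<Longrightarrow> seg (\<lambda>t. Y \<xi>' b t - Y \<xi> b t - Y \<xi> (u # b) t) t = seg (Y \<xi>' b) t - seg (Y \<xi> b) t - seg (Y \<xi> (u # b)) t"
  using seg_diff[OF r0, of "\<lambda>t. Y \<xi>' b t - Y \<xi> b t" "Y \<xi> (u # b)" t]
  by (simp add: Y_cont continuous_on_diff seg_Y_diff)

lemma diff_bounded:
  fixes f g :: "real \<Rightarrow> 'a"
  assumes "\<exists>B. \<forall>t. norm (f t) \<le> B * e t ^ j" "\<exists>B. \<forall>t. norm (g t) \<le> B * e t ^ j"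
  shows "\<exists>B. \<forall>t. norm (f t - g t) \<le> B * e t ^ j"
proof -
  obtain A B where "\<And>t. norm (f t) \<le> A * e t ^ j" "\<And>t. norm (g t) \<le> B * e t ^ j" using assms by blast
  then have "norm (f t - g t) \<le> (A + B) * e t ^ j" for t
    using norm_triangle_ineq4[of "f t" "g t"] by (simp add: algebra_simps) (smt (verit))
  then show ?thesis by blast
qed

text \<open>
  Induction on the order.  The lower orders being Lipschitz, \<open>faa_di_bruno_lipschitz\<close> gives the
  increment of order \<open>j\<close> an equation to which \<open>weighted_bound_pow\<close> applies.  The increment of \<open>\<xi>\<close> carries
  one more factor \<open>e t\<close>, hence the power \<open>j + 1\<close>, which is at most \<open>k + 1\<close>.
\<close>

lemma Y_lipschitz_aux:
  "n \<le> k + 1 \<Longrightarrow> \<exists>C2\<ge>C. \<forall>hs. length hs < n \<longrightarrow> (\<forall>\<xi> \<xi>' t.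
     norm (Y \<xi>' hs t - Y \<xi> hs t) \<le> C2 * norm (\<xi>' - \<xi>) * nprod hs * e t ^ (length hs + 1))"
proof (induction n)
  case 0
  then show ?case by auto
next
  case (Suc n)
  then obtain C2 where C2: "C \<le> C2" and IH: "\<And>hs \<xi> \<xi>' t. length hs < n \<Longrightarrow>
     norm (Y \<xi>' hs t - Y \<xi> hs t) \<le> C2 * norm (\<xi>' - \<xi>) * nprod hs * e t ^ (length hs + 1)" by auto
  have C2_1: "1 \<le> C2" using C1 C2 by simp
  define c0 where "c0 = (num_partitions n + 1) * (K * (real k + 1) * C2 ^ (k + 1))"
  have c0: "0 \<le> c0" unfolding c0_def using tower_constants C2_1
    by (intro mult_nonneg_nonneg add_nonneg_nonneg zero_le_power) (auto simp: num_partitions_def)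
  define C3 where "C3 = max C2 (A0 * (1 + c0))"
  have new: "norm (Y \<xi>' hs t - Y \<xi> hs t) \<le> A0 * ((1 + c0) * norm (\<xi>' - \<xi>) * nprod hs) * e t ^ (length hs + 1)"
    if hs: "length hs = n" for hs \<xi> \<xi>' t
  proof (rule weighted_bound_pow)
    have hk: "length hs \<le> k" using hs Suc.prems by simp
    show "1 \<le> length hs + 1" "length hs + 1 \<le> k + 1" using hk by auto
    show "sol (\<lambda>t. Y \<xi>' hs t - Y \<xi> hs t) (id_jet \<xi>' hs - id_jet \<xi> hs)
      (\<lambda>t. faa_di_bruno (DF t) (\<lambda>b. seg (Y \<xi>' b) t) hs - faa_di_bruno (DF t) (\<lambda>b. seg (Y \<xi> b) t) hs)"
      by (intro sol_diff Y_sol hk)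
    show "\<exists>B. \<forall>t. norm (Y \<xi>' hs t - Y \<xi> hs t) \<le> B * e t ^ (length hs + 1)"
      using hk by (intro diff_bounded Y_apriori) auto
    show "norm (id_jet \<xi>' hs - id_jet \<xi> hs) \<le> (1 + c0) * norm (\<xi>' - \<xi>) * nprod hs"
    proof -
      have "norm (id_jet \<xi>' hs - id_jet \<xi> hs) \<le> norm (\<xi>' - \<xi>) * nprod hs"
        by (cases "(\<xi>, hs)" rule: id_jet.cases) (auto intro!: mult_nonneg_nonneg nprod_nonneg)
      also have "\<dots> \<le> (1 + c0) * (norm (\<xi>' - \<xi>) * nprod hs)"
        using c0 nprod_nonneg[of hs] by (intro mult_right_mono[of 1 "1 + c0", simplified mult_1] mult_nonneg_nonneg) auto
      finally show ?thesis by (simp only: mult.assoc)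
    qed
    fix s
    have "norm (faa_di_bruno (DF s) (\<lambda>b. seg (Y \<xi>' b) s) hs - faa_di_bruno (DF s) (\<lambda>b. seg (Y \<xi> b) s) hs)
       \<le> K1 * norm (seg (Y \<xi>' hs) s - seg (Y \<xi> hs) s) +
     (num_partitions (length hs) + 1) * (K * (real k + 1) * C2 ^ (k + 1)) * ((w s * norm (\<xi>' - \<xi>)) * wprod (w s) hs)"
    proof (rule tower.faa_di_bruno_lipschitz[OF tw C2_1 w0 hk])
      show "norm (seg (Y \<xi> b) s) \<le> C2 * wprod (w s) b \<and> norm (seg (Y \<xi>' b) s) \<le> C2 * wprod (w s) b"
        if "b \<noteq> []" "length b \<le> length hs" for b
        using that hk seg_Y_bound[of b _ s] mult_right_mono[OF C2 wprod_nonneg[OF w0[of s], of b]]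
        by (meson order_trans)
      show "norm (seg (Y \<xi>' b) s - seg (Y \<xi> b) s) \<le> w s * norm (\<xi>' - \<xi>) * (C2 * wprod (w s) b)"
        if b: "length b < length hs" for b
      proof -
        have "norm (seg (\<lambda>t. Y \<xi>' b t - Y \<xi> b t) s) \<le> (C2 * norm (\<xi>' - \<xi>) * nprod b) * w s ^ (length b + 1)"
          using b hs hk C2_1 nprod_nonneg[of b] by (intro norm_seg_w IH continuous_on_diff Y_cont) auto
        then show ?thesis using b hk by (simp add: seg_Y_diff wprod_eq mult_ac)
      qed
    qed (use hk w0 in \<open>auto intro!: seg_Y_V mult_nonneg_nonneg\<close>)
    also have "\<dots> = K1 * norm (seg (\<lambda>t. Y \<xi>' hs t - Y \<xi> hs t) s) + c0 * norm (\<xi>' - \<xi>) * nprod hs * w s ^ (length hs + 1)"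
      using hk by (simp add: seg_Y_diff c0_def hs wprod_eq mult_ac)
    also have "\<dots> \<le> K1 * norm (seg (\<lambda>t. Y \<xi>' hs t - Y \<xi> hs t) s) + (1 + c0) * norm (\<xi>' - \<xi>) * nprod hs * w s ^ (length hs + 1)"
      using w0 nprod_nonneg[of hs] by (intro add_left_mono mult_right_mono mult_nonneg_nonneg zero_le_power) auto
    finally show "norm (faa_di_bruno (DF s) (\<lambda>b. seg (Y \<xi>' b) s) hs - faa_di_bruno (DF s) (\<lambda>b. seg (Y \<xi> b) s) hs)
       \<le> K1 * norm (seg (\<lambda>t. Y \<xi>' hs t - Y \<xi> hs t) s) + (1 + c0) * norm (\<xi>' - \<xi>) * nprod hs * w s ^ (length hs + 1)" .
  qed
  have mono: "x * norm (\<xi>' - \<xi>) * nprod hs * e t ^ m \<le> C3 * norm (\<xi>' - \<xi>) * nprod hs * e t ^ m" if "x \<le> C3"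
    for x and hs :: "'a list" and \<xi> \<xi>' :: 'a and t m
    using that e_ge1[of t] nprod_nonneg[of hs] by (intro mult_right_mono) auto
  have "norm (Y \<xi>' hs t - Y \<xi> hs t) \<le> C3 * norm (\<xi>' - \<xi>) * nprod hs * e t ^ (length hs + 1)"
    if "length hs < Suc n" for hs \<xi> \<xi>' t
  proof (cases "length hs = n")
    case True
    show ?thesis using new[OF True, of \<xi>' t \<xi>] mono[of "A0 * (1 + c0)" \<xi>' \<xi> hs t "length hs + 1"]
      by (simp add: C3_def mult.assoc)
  next
    case False
    then have "length hs < n" using that by simp
    from IH[OF this, of \<xi>' t \<xi>] show ?thesis using mono[of C2 \<xi>' \<xi> hs t "length hs + 1"]
      by (simp add: C3_def)
  qed
  moreover have "C \<le> C3" using C2 by (simp add: C3_def)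
  ultimately show ?case by blast
qed

lemma Y_lipschitz:
  "\<exists>C2\<ge>C. \<forall>hs. length hs \<le> k \<longrightarrow> (\<forall>\<xi> \<xi>' t.
     norm (Y \<xi>' hs t - Y \<xi> hs t) \<le> C2 * norm (\<xi>' - \<xi>) * nprod hs * e t ^ (length hs + 1))"
  using Y_lipschitz_aux[of "k + 1"] by (simp add: less_Suc_eq_le)

text \<open>
  As for the increments, now with \<open>faa_di_bruno_taylor\<close>.  The two factors \<open>u\<close> lead to the power \<open>j + 2\<close>, and
  this stays within the weights available because \<open>j < k\<close>.
\<close>

lemma Y_taylor_aux:
  "n \<le> k \<Longrightarrow> \<exists>C3\<ge>C. \<forall>hs. length hs < n \<longrightarrow> (\<forall>\<xi> u t.
     norm (Y (\<xi> + u) hs t - Y \<xi> hs t - Y \<xi> (u # hs) t) \<le> C3 * (norm u)\<^sup>2 * nprod hs * e t ^ (length hs + 2))"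
proof (induction n)
  case 0
  then show ?case by auto
next
  case (Suc n)
  then obtain C3 where C3: "C \<le> C3" and IH: "\<And>hs \<xi> u t. length hs < n \<Longrightarrow>
     norm (Y (\<xi> + u) hs t - Y \<xi> hs t - Y \<xi> (u # hs) t) \<le> C3 * (norm u)\<^sup>2 * nprod hs * e t ^ (length hs + 2)" by auto
  obtain C2 where C2: "C \<le> C2" and lip: "\<And>hs \<xi> \<xi>' t. length hs \<le> k \<Longrightarrow>
     norm (Y \<xi>' hs t - Y \<xi> hs t) \<le> C2 * norm (\<xi>' - \<xi>) * nprod hs * e t ^ (length hs + 1)"
    using Y_lipschitz by blast
  define B where "B = max C2 C3"
  have B: "1 \<le> B" "C \<le> B" "C2 \<le> B" "C3 \<le> B" "0 \<le> C2" "0 \<le> C3" using C1 C2 C3 by (auto simp: B_def)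
  define c0 where "c0 = (num_partitions n + 1) * (K * (real k + 2)\<^sup>2 * B ^ (k + 2))"
  have c0: "0 \<le> c0" unfolding c0_def using tower_constants B
    by (intro mult_nonneg_nonneg add_nonneg_nonneg zero_le_power) (auto simp: num_partitions_def)
  define C4 where "C4 = max C3 (A0 * c0)"
  have new: "norm (Y (\<xi> + u) hs t - Y \<xi> hs t - Y \<xi> (u # hs) t) \<le> A0 * (c0 * (norm u)\<^sup>2 * nprod hs) * e t ^ (length hs + 2)"
    if hs: "length hs = n" for hs \<xi> u t
  proof (rule weighted_bound_pow)
    let ?\<xi>' = "\<xi> + u"
    have hk: "length hs < k" using hs Suc.prems by simp
    show "1 \<le> length hs + 2" "length hs + 2 \<le> k + 1" using hk by auto
    show "sol (\<lambda>t. Y ?\<xi>' hs t - Y \<xi> hs t - Y \<xi> (u # hs) t) (id_jet ?\<xi>' hs - id_jet \<xi> hs - id_jet \<xi> (u # hs))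
      (\<lambda>t. faa_di_bruno (DF t) (\<lambda>b. seg (Y ?\<xi>' b) t) hs - faa_di_bruno (DF t) (\<lambda>b. seg (Y \<xi> b) t) hs - faa_di_bruno (DF t) (\<lambda>b. seg (Y \<xi> b) t) (u # hs))"
      using hk by (intro sol_diff Y_sol) auto
    show "\<exists>B. \<forall>t. norm (Y ?\<xi>' hs t - Y \<xi> hs t - Y \<xi> (u # hs) t) \<le> B * e t ^ (length hs + 2)"
      using hk by (intro diff_bounded Y_apriori) auto
    \<comment> \<open>The identity map equals its first-order expansion, so there is no constant term.\<close>
    have "id_jet ?\<xi>' hs - id_jet \<xi> hs - id_jet \<xi> (u # hs) = 0"
      by (cases "(\<xi>, hs)" rule: id_jet.cases) auto
    then show "norm (id_jet ?\<xi>' hs - id_jet \<xi> hs - id_jet \<xi> (u # hs)) \<le> c0 * (norm u)\<^sup>2 * nprod hs"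
      using c0 nprod_nonneg[of hs] by simp
    fix s
    note Wm = mult_right_mono[OF _ wprod_nonneg[OF w0[of s]]]
    have "norm (faa_di_bruno (DF s) (\<lambda>b. seg (Y ?\<xi>' b) s) hs - faa_di_bruno (DF s) (\<lambda>b. seg (Y \<xi> b) s) hs - faa_di_bruno (DF s) (\<lambda>b. seg (Y \<xi> b) s) (u # hs))
       \<le> K1 * norm (seg (Y ?\<xi>' hs) s - seg (Y \<xi> hs) s - seg (Y \<xi> (u # hs)) s) +
     (num_partitions (length hs) + 1) * (K * (real k + 2)\<^sup>2 * B ^ (k + 2)) * ((w s * norm u)\<^sup>2 * wprod (w s) hs)"
    proof (rule tower.faa_di_bruno_taylor[OF tw B(1) w0 hk])
      have bd: "norm (seg (Y \<zeta> b) s) \<le> B * wprod (w s) b" if "b \<noteq> []" "length b \<le> k" for b \<zeta>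
        using that seg_Y_bound[of b \<zeta> s] Wm[OF B(2), of b] by simp
      show "norm (seg (Y \<xi> b) s) \<le> B * wprod (w s) b \<and> norm (seg (Y ?\<xi>' b) s) \<le> B * wprod (w s) b"
        if "b \<noteq> []" "length b \<le> length hs" for b
        using that hk bd by auto
      show "norm (seg (Y \<xi> (u # b)) s) \<le> w s * norm u * (B * wprod (w s) b)" if "length b \<le> length hs" for b
        using bd[of "u # b" \<xi>] that hk by (simp add: mult_ac)
      show "norm (seg (Y ?\<xi>' b) s - seg (Y \<xi> b) s) \<le> w s * norm u * (B * wprod (w s) b)"
        if b: "length b \<le> length hs" for b
      proof -
        have "norm (seg (\<lambda>t. Y ?\<xi>' b t - Y \<xi> b t) s) \<le> (C2 * norm u * nprod b) * w s ^ (length b + 1)"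
          using b hs hk B nprod_nonneg[of b] lip[of b ?\<xi>' _ \<xi>] by (intro norm_seg_w continuous_on_diff Y_cont) auto
        also have "\<dots> \<le> (B * norm u * nprod b) * w s ^ (length b + 1)"
          using B w0[of s] nprod_nonneg[of b] by (intro mult_right_mono) auto
        finally show ?thesis using b hk by (simp add: seg_Y_diff wprod_eq mult_ac)
      qed
      show "norm (seg (Y ?\<xi>' b) s - seg (Y \<xi> b) s - seg (Y \<xi> (u # b)) s) \<le> (w s * norm u)\<^sup>2 * (B * wprod (w s) b)"
        if b: "length b < length hs" for b
      proof -
        have "norm (seg (\<lambda>t. Y ?\<xi>' b t - Y \<xi> b t - Y \<xi> (u # b) t) s) \<le> (C3 * (norm u)\<^sup>2 * nprod b) * w s ^ (length b + 2)"
          using b hs hk B nprod_nonneg[of b] IH[of b \<xi> u] by (intro norm_seg_w continuous_on_diff Y_cont) auto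
        also have "\<dots> \<le> (B * (norm u)\<^sup>2 * nprod b) * w s ^ (length b + 2)"
          using B w0[of s] nprod_nonneg[of b] by (intro mult_right_mono) auto
        finally show ?thesis using b hk by (simp add: seg_Y_taylor wprod_eq power2_eq_square mult_ac)
      qed
    qed (use hk w0 in \<open>auto intro!: seg_Y_V mult_nonneg_nonneg\<close>)
    also have "\<dots> = K1 * norm (seg (\<lambda>t. Y ?\<xi>' hs t - Y \<xi> hs t - Y \<xi> (u # hs) t) s) + c0 * (norm u)\<^sup>2 * nprod hs * w s ^ (length hs + 2)"
      using hk by (simp add: seg_Y_taylor c0_def hs wprod_eq power_mult_distrib power2_eq_square mult_ac)
    finally show "norm (faa_di_bruno (DF s) (\<lambda>b. seg (Y ?\<xi>' b) s) hs - faa_di_bruno (DF s) (\<lambda>b. seg (Y \<xi> b) s) hs - faa_di_bruno (DF s) (\<lambda>b. seg (Y \<xi> b) s) (u # hs))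
       \<le> K1 * norm (seg (\<lambda>t. Y ?\<xi>' hs t - Y \<xi> hs t - Y \<xi> (u # hs) t) s) + c0 * (norm u)\<^sup>2 * nprod hs * w s ^ (length hs + 2)" .
  qed
  have mono: "x * (norm u)\<^sup>2 * nprod hs * e t ^ m \<le> C4 * (norm u)\<^sup>2 * nprod hs * e t ^ m" if "x \<le> C4"
    for x and hs :: "'a list" and u :: 'a and t m
    using that e_ge1[of t] nprod_nonneg[of hs] by (intro mult_right_mono) auto
  have "norm (Y (\<xi> + u) hs t - Y \<xi> hs t - Y \<xi> (u # hs) t) \<le> C4 * (norm u)\<^sup>2 * nprod hs * e t ^ (length hs + 2)"
    if "length hs < Suc n" for hs \<xi> u t
  proof (cases "length hs = n")
    case True
    show ?thesis using new[OF True, of \<xi> u t] mono[of "A0 * c0" u hs t "length hs + 2"]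
      by (simp add: C4_def mult.assoc)
  next
    case False
    then have "length hs < n" using that by simp
    from IH[OF this, of \<xi> u t] show ?thesis using mono[of C3 u hs t "length hs + 2"]
      by (simp add: C4_def)
  qed
  moreover have "C \<le> C4" using C3 by (simp add: C4_def)
  ultimately show ?case by blast
qed

text \<open>
  The defect of linearity solves the homogeneous linear equation once the lower orders are known to be
  linear, and by \<open>weighted_bound_pow\<close> with \<open>c = 0\<close> this equation has only the zero solution.
\<close>

lemma Y_slot_linear:
  "length hs \<le> k \<Longrightarrow> i < length hs \<Longrightarrow>
    Y \<xi> (hs[i := \<alpha> *\<^sub>R u + \<beta> *\<^sub>R v]) t = \<alpha> *\<^sub>R Y \<xi> (hs[i := u]) t + \<beta> *\<^sub>R Y \<xi> (hs[i := v]) t"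
proof (induction "length hs" arbitrary: hs i u v \<alpha> \<beta> t rule: less_induct)
  case less
  let ?x = "hs[i := \<alpha> *\<^sub>R u + \<beta> *\<^sub>R v]" and ?u = "hs[i := u]" and ?v = "hs[i := v]"
  let ?f = "\<lambda>hs t. faa_di_bruno (DF t) (\<lambda>b. seg (Y \<xi> b) t) hs"
  let ?z = "\<lambda>t. Y \<xi> ?x t - \<alpha> *\<^sub>R Y \<xi> ?u t - \<beta> *\<^sub>R Y \<xi> ?v t"
  have ne: "?x \<noteq> []" "?u \<noteq> []" "?v \<noteq> []" using less.prems by auto
  have c: "continuous_on UNIV (Y \<xi> ?x)" "continuous_on UNIV (Y \<xi> ?u)" "continuous_on UNIV (Y \<xi> ?v)"
    using less.prems by (auto intro: Y_cont)
  have lin_seg: "seg (Y \<xi> (b[j := a *\<^sub>R p + a' *\<^sub>R q])) s = a *\<^sub>R seg (Y \<xi> (b[j := p])) s + a' *\<^sub>R seg (Y \<xi> (b[j := q])) s"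
    if "length b < length hs" "j < length b" for b j a p a' q s
  proof (rule bcontfun_eqI)
    fix \<theta>
    have "length b \<le> k" using that less.prems by simp
    then show "apply_bcontfun (seg (Y \<xi> (b[j := a *\<^sub>R p + a' *\<^sub>R q])) s) \<theta> =
        apply_bcontfun (a *\<^sub>R seg (Y \<xi> (b[j := p])) s + a' *\<^sub>R seg (Y \<xi> (b[j := q])) s) \<theta>"
      by (simp add: seg_apply[OF r0] Y_cont plus_bcontfun.rep_eq scaleR_bcontfun.rep_eq)
         (rule less.hyps[OF that(1) _ that(2)])
  qed
  have segz: "seg ?z s = seg (Y \<xi> ?x) s - \<alpha> *\<^sub>R seg (Y \<xi> ?u) s - \<beta> *\<^sub>R seg (Y \<xi> ?v) s" for s
    using c by (simp add: seg_diff[OF r0] seg_scale[OF r0] continuous_on_diff continuous_on_scaleR)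
  have V: "seg (Y \<xi> ?x) s \<in> V" "seg (Y \<xi> ?u) s \<in> V" "seg (Y \<xi> ?v) s \<in> V" for s using c by (auto intro: seg_V)
  have f: "?f ?x s - \<alpha> *\<^sub>R ?f ?u s - \<beta> *\<^sub>R ?f ?v s = DF s 1 (seg (Y \<xi> []) s) [seg ?z s]" for s
  proof -
    let ?D = "\<lambda>\<phi>. DF s 1 (seg (Y \<xi> []) s) [\<phi>]"
    have x0: "seg (Y \<xi> []) s \<in> V" by (intro seg_Y_V) simp
    have r: "faa_di_bruno_rest (DF s) (\<lambda>b. seg (Y \<xi> b) s) ?x = \<alpha> *\<^sub>R faa_di_bruno_rest (DF s) (\<lambda>b. seg (Y \<xi> b) s) ?u + \<beta> *\<^sub>R faa_di_bruno_rest (DF s) (\<lambda>b. seg (Y \<xi> b) s) ?v"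
      using less.prems x0 by (intro tower.rest_slot_linear[OF tw] lin_seg) (auto intro: seg_Y_V)
    have ml: "mlin V 1 (DF s 1 (seg (Y \<xi> []) s))"
      using tower.bounded_mlin[OF tw _ _ x0, of 1] tower_constants by (simp add: bounded_mlin_def)
    have d: "?D (p - q) = ?D p - ?D q" if "p \<in> V" "q \<in> V" for p q
      by (rule tower.D1_diff[OF tw x0 that])
    have sc: "?D (a *\<^sub>R p) = a *\<^sub>R ?D p" if "p \<in> V" for a p
    proof -
      have "?D (a *\<^sub>R p + 0 *\<^sub>R p) = a *\<^sub>R ?D p + 0 *\<^sub>R ?D p"
        using ml that by (auto simp del: scaleR_zero_left)
      then show ?thesis by simp
    qed
    have "?D (seg ?z s) = ?D (seg (Y \<xi> ?x) s) - \<alpha> *\<^sub>R ?D (seg (Y \<xi> ?u) s) - \<beta> *\<^sub>R ?D (seg (Y \<xi> ?v) s)"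
      unfolding segz using V sub by (simp only: d sc subspace_diff subspace_scale)
    then show ?thesis unfolding faa_di_bruno_def using ne r by (simp add: algebra_simps)
  qed
  have "norm (?z t) \<le> A0 * 0 * e t ^ length hs"
  proof (rule weighted_bound_pow)
    show "1 \<le> length hs" "length hs \<le> k + 1" using less.prems by auto
    show "sol ?z (id_jet \<xi> ?x - \<alpha> *\<^sub>R id_jet \<xi> ?u - \<beta> *\<^sub>R id_jet \<xi> ?v) (\<lambda>t. ?f ?x t - \<alpha> *\<^sub>R ?f ?u t - \<beta> *\<^sub>R ?f ?v t)"
      using less.prems by (intro sol_diff sol_scale Y_sol) auto
    show "norm (id_jet \<xi> ?x - \<alpha> *\<^sub>R id_jet \<xi> ?u - \<beta> *\<^sub>R id_jet \<xi> ?v) \<le> 0"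
      using id_jet_slot_linear[OF less.prems(2), of \<xi> \<alpha> u \<beta> v] by simp
    show "norm (?f ?x s - \<alpha> *\<^sub>R ?f ?u s - \<beta> *\<^sub>R ?f ?v s) \<le> K1 * norm (seg ?z s) + 0 * w s ^ length hs" for s
    proof -
      have "seg ?z s \<in> V"
        using c by (intro seg_V continuous_intros)
      then show ?thesis using tower.bound1[OF tw seg_Y_V[of "[]" \<xi> s], of "seg ?z s" s] unfolding f by simp
    qed
    have b: "norm (Y \<xi> p t) \<le> C * nprod p * e t ^ length hs" if "length p = length hs" "p \<noteq> []" for p t
      using Y_bound[of p \<xi> t] that less.prems by simp
    have "norm (?z t) \<le> (C * nprod ?x + \<bar>\<alpha>\<bar> * (C * nprod ?u) + \<bar>\<beta>\<bar> * (C * nprod ?v)) * e t ^ length hs" for t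
    proof -
      have "norm (?z t) \<le> norm (Y \<xi> ?x t) + \<bar>\<alpha>\<bar> * norm (Y \<xi> ?u t) + \<bar>\<beta>\<bar> * norm (Y \<xi> ?v t)"
        using norm_triangle_ineq4[of "Y \<xi> ?x t - \<alpha> *\<^sub>R Y \<xi> ?u t" "\<beta> *\<^sub>R Y \<xi> ?v t"]
          norm_triangle_ineq4[of "Y \<xi> ?x t" "\<alpha> *\<^sub>R Y \<xi> ?u t"] by simp
      also have "\<dots> \<le> C * nprod ?x * e t ^ length hs + \<bar>\<alpha>\<bar> * (C * nprod ?u * e t ^ length hs) + \<bar>\<beta>\<bar> * (C * nprod ?v * e t ^ length hs)"
        using ne by (intro add_mono mult_left_mono b) auto
      finally show ?thesis by (simp add: algebra_simps)
    qed
    then show "\<exists>B. \<forall>t. norm (?z t) \<le> B * e t ^ length hs" by blast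
  qed
  then show ?case by (simp add: algebra_simps)
qed

lemma Y_mlin: "j \<le> k \<Longrightarrow> mlin UNIV j (\<lambda>hs. Y \<xi> hs t)"
  unfolding mlin_iff_slots using Y_slot_linear by auto

lemma Y_Ck1: "Ck1 UNIV k (\<lambda>\<xi>. Y \<xi> [] t)"
proof -
  obtain C2 where C2: "C \<le> C2" and lip: "\<And>hs \<xi> \<xi>' t. length hs \<le> k \<Longrightarrow>
     norm (Y \<xi>' hs t - Y \<xi> hs t) \<le> C2 * norm (\<xi>' - \<xi>) * nprod hs * e t ^ (length hs + 1)"
    using Y_lipschitz by blast
  obtain C3 where C3: "C \<le> C3" and tay: "\<And>hs \<xi> u t. length hs < k \<Longrightarrow>
     norm (Y (\<xi> + u) hs t - Y \<xi> hs t - Y \<xi> (u # hs) t) \<le> C3 * (norm u)\<^sup>2 * nprod hs * e t ^ (length hs + 2)"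
    using Y_taylor_aux[of k] by auto
  have e0: "0 \<le> e t" using e_ge1[of t] by simp
  define B where "B = C2 * e t ^ (k + 1)"
  have B0: "0 \<le> B" using C1 C2 e0 by (simp add: B_def)
  have L: "ml_norm UNIV k (\<lambda>hs. Y x hs t - Y y hs t) \<le> ennreal (B * norm (x - y))" for x y
  proof (rule ml_norm_le)
    fix hs :: "'a list" assume "length hs = k"
    then show "norm (Y x hs t - Y y hs t) \<le> B * norm (x - y) * nprod hs"
      using lip[of hs x t y] by (simp add: B_def mult_ac)
  qed (use B0 in auto)
  have "Ck_with UNIV k (\<lambda>\<xi>. Y \<xi> [] t) (\<lambda>j \<xi> hs. Y \<xi> hs t)"
    unfolding Ck_with_def
  proof (intro conjI allI impI ballI)
    show "bounded_multilinear_on UNIV j (\<lambda>hs. Y x hs t)" if j: "j \<le> k" for j x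
    proof -
      have "norm (Y x hs t) \<le> (C * e t ^ j + norm (Y x [] t)) * nprod hs" if "length hs = j" for hs
      proof (cases "hs = []")
        case True
        then show ?thesis using C1 e0 by simp
      next
        case False
        have "norm (Y x hs t) \<le> C * e t ^ j * nprod hs"
          using Y_bound[of hs x t] False that j by (simp add: mult_ac)
        also have "\<dots> \<le> (C * e t ^ j + norm (Y x [] t)) * nprod hs"
          using nprod_nonneg[of hs] by (intro mult_right_mono) auto
        finally show ?thesis .
      qed
      then have "ml_norm UNIV j (\<lambda>hs. Y x hs t) \<le> ennreal (C * e t ^ j + norm (Y x [] t))"
        using C1 e0 by (intro ml_norm_le) auto
      also have "\<dots> < \<infinity>" by simp
      finally show ?thesis using Y_mlin[OF j] by (simp add: bounded_multilinear_on_iff)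
    qed
  next
    fix j and x :: 'a and \<epsilon> :: real assume j: "j < k" and \<epsilon>: "0 < \<epsilon>"
    define A where "A = C3 * e t ^ (j + 2)"
    have A: "0 \<le> A" using C1 C3 e0 by (simp add: A_def)
    show "\<forall>\<^sub>F y in at x. ml_norm UNIV j (\<lambda>hs. Y y hs t - Y x hs t - Y x ((y - x) # hs) t) \<le> ennreal (\<epsilon> * norm (y - x))"
      unfolding eventually_at
    proof (intro exI[of _ "\<epsilon> / (A + 1)"] conjI ballI impI; (elim conjE)?)
      show "0 < \<epsilon> / (A + 1)" using \<epsilon> A by simp
      fix y assume "dist y x < \<epsilon> / (A + 1)"
      then have "norm (y - x) * (A + 1) < \<epsilon>" using A by (simp add: pos_less_divide_eq dist_norm)
      then have le: "A * norm (y - x) \<le> \<epsilon>" by (simp add: algebra_simps) (smt (verit) norm_ge_zero)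
      show "ml_norm UNIV j (\<lambda>hs. Y y hs t - Y x hs t - Y x ((y - x) # hs) t) \<le> ennreal (\<epsilon> * norm (y - x))"
      proof (rule ml_norm_le)
        fix hs :: "'a list" assume hs: "length hs = j"
        have "norm (Y y hs t - Y x hs t - Y x ((y - x) # hs) t) \<le> A * norm (y - x) * (norm (y - x) * nprod hs)"
          using tay[of hs x "y - x" t] hs j by (simp add: A_def power2_eq_square mult_ac)
        also have "\<dots> \<le> \<epsilon> * (norm (y - x) * nprod hs)"
          using le nprod_nonneg[of hs] by (intro mult_right_mono) auto
        finally show "norm (Y y hs t - Y x hs t - Y x ((y - x) # hs) t) \<le> \<epsilon> * norm (y - x) * nprod hs"
          by (simp add: mult_ac)
      qed (use \<epsilon> in auto)
    qed
  next
    fix x :: 'a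
    have "((\<lambda>y. ennreal (B * norm (y - x))) \<longlongrightarrow> ennreal 0) (at x)"
      by (rule tendsto_ennrealI) (auto intro!: tendsto_eq_intros LIM_zero)
    then have "((\<lambda>y. ennreal (B * norm (y - x))) \<longlongrightarrow> 0) (at x)" by simp
    then show "((\<lambda>y. ml_norm UNIV k (\<lambda>hs. Y y hs t - Y x hs t)) \<longlongrightarrow> 0) (at x)"
      by (rule tendsto_sandwich[OF _ _ tendsto_const, rotated 2]) (use L in auto)
  qed auto
  then show ?thesis unfolding Ck1_def using L by blast
qed

lemma Y_jointly_continuous: "continuous_on UNIV (\<lambda>(t, \<xi>). Y \<xi> [] t)"
proof -
  obtain C2 where lip: "\<And>hs \<xi> \<xi>' t. length hs \<le> k \<Longrightarrow>
     norm (Y \<xi>' hs t - Y \<xi> hs t) \<le> C2 * norm (\<xi>' - \<xi>) * nprod hs * e t ^ (length hs + 1)"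
    using Y_lipschitz by blast
  have "((\<lambda>p. Y (snd p) [] (fst p)) \<longlongrightarrow> Y \<xi>0 [] t0) (at (t0, \<xi>0))" for t0 \<xi>0
  proof -
    have "((\<lambda>p. Y (snd p) [] (fst p) - Y \<xi>0 [] (fst p)) \<longlongrightarrow> 0) (at (t0, \<xi>0))"
    proof (rule Lim_null_comparison)
      show "\<forall>\<^sub>F p in at (t0, \<xi>0). norm (Y (snd p) [] (fst p) - Y \<xi>0 [] (fst p)) \<le> C2 * norm (snd p - \<xi>0) * e (fst p)"
        using lip[of "[]"] by (intro always_eventually) auto
      have "((\<lambda>p. C2 * norm (snd p - \<xi>0) * e (fst p)) \<longlongrightarrow> C2 * norm (snd (t0, \<xi>0) - \<xi>0) * e (fst (t0, \<xi>0))) (at (t0, \<xi>0))"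
        unfolding e_def by (intro tendsto_intros)
      then show "((\<lambda>p. C2 * norm (snd p - \<xi>0) * e (fst p)) \<longlongrightarrow> 0) (at (t0, \<xi>0))" by simp
    qed
    moreover have "((\<lambda>p. Y \<xi>0 [] (fst p)) \<longlongrightarrow> Y \<xi>0 [] (fst (t0, \<xi>0))) (at (t0, \<xi>0))"
    proof (rule isCont_tendsto_compose[where g = "Y \<xi>0 []"])
      show "isCont (Y \<xi>0 []) (fst (t0, \<xi>0))"
        using Y_cont[of "[]" \<xi>0] by (simp add: continuous_on_eq_continuous_at)
    qed (intro tendsto_intros)
    ultimately show ?thesis using tendsto_add by fastforce
  qed
  then show ?thesis by (simp add: continuous_on_def case_prod_unfold split_paired_all)
qed

lemma Y_is_solution:
  assumes F: "\<And>t \<phi>. \<phi> \<in> V \<Longrightarrow> DF t 0 \<phi> [] = F t \<phi>"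
  shows "is_solution r L F (Y \<xi> [])" and "Y \<xi> [] 0 - L 0 (seg (Y \<xi> []) 0) = \<xi>"
proof -
  have s: "sol (Y \<xi> []) \<xi> (\<lambda>t. F t (seg (Y \<xi> []) t))"
    using Y_sol[of "[]" \<xi>] F[OF seg_Y_V[of "[]"]] by (simp add: faa_di_bruno_def)
  have eq: "Y \<xi> [] t - L t (seg (Y \<xi> []) t) = \<xi> + antideriv (\<lambda>t. F t (seg (Y \<xi> []) t)) t" for t
    using solD(3)[OF s, of t] by (simp add: algebra_simps)
  have d: "((\<lambda>t. Y \<xi> [] t - L t (seg (Y \<xi> []) t)) has_vector_derivative F t (seg (Y \<xi> []) t)) (at t)" for t
    unfolding eq using antideriv_derivative[OF solD(2)[OF s], of t] by (auto intro!: derivative_eq_intros)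
  show "is_solution r L F (Y \<xi> [])"
    unfolding is_solution_def C1_differentiable_on_def
    by (intro conjI exI[of _ "\<lambda>t. F t (seg (Y \<xi> []) t)"] ballI allI solD(1,2)[OF s] d)
  show "Y \<xi> [] 0 - L 0 (seg (Y \<xi> []) 0) = \<xi>" using eq[of 0] by simp
qed

end

section \<open>The roots of H\<close>

lemma H_deriv: "(H M has_real_derivative (1 - x) * exp (- x) - M) (at x)"
  unfolding H_def by (auto intro!: derivative_eq_intros simp: algebra_simps)

text \<open>
  By Rolle, three roots would yield two zeros of the derivative, i.e. two points \<open>a < b\<close> with
  \<open>(1 - a) exp(-a) = (1 - b) exp(-b) = M\<close>; as \<open>M\<close> is positive, both lie below one, where
  \<open>(1 - x) exp(-x)\<close> is strictly decreasing.
\<close>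

lemma H_no_three_roots:
  assumes "0 < M" "0 < x" "x < y" "y < z" "H M x = c" "H M y = c" "H M z = c"
  shows False
proof -
  have "\<exists>a>p. a < q \<and> (1 - a) * exp (- a) = M" if pq: "p < q" "H M p = H M q" for p q
  proof -
    have cont: "continuous_on {p..q} (H M)"
      unfolding H_def by (intro continuous_intros)
    obtain a where a: "p < a" "a < q" "(\<lambda>h. ((1 - a) * exp (- a) - M) * h) = (\<lambda>h. 0)"
      using Rolle_deriv[OF pq cont, of "\<lambda>a h. ((1 - a) * exp (- a) - M) * h"] H_deriv
      by (auto simp: has_field_derivative_def)
    from fun_cong[OF a(3), of 1] have "(1 - a) * exp (- a) = M" by simp
    then show ?thesis using a by blast
  qed
  then obtain a b where a: "x < a" "a < y" "(1 - a) * exp (- a) = M"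
    and b: "y < b" "b < z" "(1 - b) * exp (- b) = M"
    using assms by metis
  have "0 < (1 - b) * exp (- b)" using b assms(1) by simp
  then have b1: "b < 1" by (simp add: zero_less_mult_iff)
  have "(1 - b) * exp (- b) < (1 - a) * exp (- a)"
    using a b b1 by (intro mult_strict_mono) auto
  then show False using a b by simp
qed

text \<open>
  Finiteness of the set of roots turns \<open>Min\<close> and \<open>Max\<close> in the definitions into genuine roots.  The value
  at \<open>b\<close> exceeds \<open>c\<close> and the value at \<open>-ln M\<close> is zero, so there is a root to the right of \<open>b\<close>.
\<close>

lemma H_roots:
  assumes M: "0 < M" "M < 1" and c: "0 < c" "c < H M b" and b: "0 < b" "b < - ln M"
  shows "0 < H_root1 M c" and "b < H_root2 M c"
proof -
  define S where "S = {x. 0 < x \<and> H M x = c}"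
  have fin: "finite S"
  proof (rule ccontr)
    assume "infinite S"
    then obtain B where B: "card B = 3" "B \<subseteq> S" using infinite_arbitrarily_large by blast
    then obtain x y z where "B = {x, y, z}" "x \<noteq> y" "y \<noteq> z" "x \<noteq> z" by (auto simp: card_3_iff)
    with B(2) have "x \<in> S" "y \<in> S" "z \<in> S" "x \<noteq> y" "y \<noteq> z" "x \<noteq> z" by auto
    then show False unfolding S_def
      using H_no_three_roots[OF M(1)] by (metis (mono_tags, lifting) linorder_less_linear mem_Collect_eq)
  qed
  have "H M (- ln M) = 0" using M by (simp add: H_def)
  then obtain x where x: "b \<le> x" "x \<le> - ln M" "H M x = c"
    using IVT2[of "H M" "- ln M" c b] c b DERIV_isCont[OF H_deriv] by auto
  have bx: "b < x" using x c by (cases "x = b") auto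
  have xS: "x \<in> S" using x bx b by (simp add: S_def)
  have "Min S \<in> S" using fin xS by (intro Min_in) auto
  then show "0 < H_root1 M c" by (simp add: H_root1_def S_def)
  have "x \<le> Max S" using fin xS by simp
  then show "b < H_root2 M c" using bx by (simp add: H_root2_def S_def)
qed

section \<open>Admissible operators\<close>

lemma has_RS_integral_axpy:
  assumes "has_RS_integral g f a b I" "has_RS_integral g f' a b I'"
  shows "has_RS_integral g (\<lambda>s. f s + c *\<^sub>R f' s) a b (I + c *\<^sub>R I')"
  unfolding has_RS_integral_def
proof (intro allI impI)
  fix \<epsilon> :: real assume \<epsilon>: "0 < \<epsilon>"
  define \<epsilon>' where "\<epsilon>' = \<epsilon> / 2 / (\<bar>c\<bar> + 1)"
  have \<epsilon>': "0 < \<epsilon>'" using \<epsilon> by (simp add: \<epsilon>'_def add_nonneg_pos)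
  have split: "\<epsilon>' + \<bar>c\<bar> * \<epsilon>' < \<epsilon>"
  proof -
    have "\<bar>c\<bar> + 1 \<noteq> 0" by linarith
    then have "\<epsilon>' * (\<bar>c\<bar> + 1) = \<epsilon> / 2" unfolding \<epsilon>'_def by (rule nonzero_eq_divide_eq[THEN iffD1, OF _ refl])
    then have "\<epsilon>' + \<bar>c\<bar> * \<epsilon>' = \<epsilon> / 2" by (simp add: algebra_simps)
    then show ?thesis using \<epsilon> by simp
  qed
  let ?S = "\<lambda>\<D> f. \<Sum>(s, K)\<in>\<D>. blinfun_apply (g (Sup K) - g (Inf K)) (f s)"
  obtain d where d: "0 < d" "\<And>\<D>. \<D> tagged_division_of {a..b} \<Longrightarrow> (\<lambda>s. ball s d) fine \<D> \<Longrightarrow> norm (?S \<D> f - I) < \<epsilon>'"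
    using assms(1)[unfolded has_RS_integral_def, rule_format, OF \<epsilon>'] by blast
  obtain d' where d': "0 < d'" "\<And>\<D>. \<D> tagged_division_of {a..b} \<Longrightarrow> (\<lambda>s. ball s d') fine \<D> \<Longrightarrow> norm (?S \<D> f' - I') < \<epsilon>'"
    using assms(2)[unfolded has_RS_integral_def, rule_format, OF \<epsilon>'] by blast
  show "\<exists>d>0. \<forall>\<D>. \<D> tagged_division_of {a..b} \<and> (\<lambda>s. ball s d) fine \<D> \<longrightarrow>
     norm (?S \<D> (\<lambda>s. f s + c *\<^sub>R f' s) - (I + c *\<^sub>R I')) < \<epsilon>"
  proof (intro exI[of _ "min d d'"] conjI allI impI; (elim conjE)?)
    fix \<D> assume D: "\<D> tagged_division_of {a..b}" "(\<lambda>s. ball s (min d d')) fine \<D>"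
    have fine: "(\<lambda>s. ball s d) fine \<D>" "(\<lambda>s. ball s d') fine \<D>"
      using D(2) unfolding fine_def by fastforce+
    have "?S \<D> (\<lambda>s. f s + c *\<^sub>R f' s) = ?S \<D> f + c *\<^sub>R ?S \<D> f'"
      by (simp add: blinfun.add_right blinfun.scaleR_right sum.distrib scaleR_sum_right case_prod_unfold)
    then have "?S \<D> (\<lambda>s. f s + c *\<^sub>R f' s) - (I + c *\<^sub>R I') = (?S \<D> f - I) + c *\<^sub>R (?S \<D> f' - I')"
      by (simp add: algebra_simps)
    also have "norm \<dots> \<le> norm (?S \<D> f - I) + \<bar>c\<bar> * norm (?S \<D> f' - I')"
      using norm_triangle_ineq[of "?S \<D> f - I" "c *\<^sub>R (?S \<D> f' - I')"] by simp
    also have "\<dots> \<le> \<epsilon>' + \<bar>c\<bar> * \<epsilon>'"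
      using d(2)[OF D(1) fine(1)] d'(2)[OF D(1) fine(2)] by (intro add_mono mult_left_mono) auto
    finally show "norm (?S \<D> (\<lambda>s. f s + c *\<^sub>R f' s) - (I + c *\<^sub>R I')) < \<epsilon>" using split by linarith
  qed (use d d' in auto)
qed

lemma has_RS_integral_unique:
  assumes "has_RS_integral g f a b I" "has_RS_integral g f a b I'"
  shows "I = I'"
proof (rule ccontr)
  assume "I \<noteq> I'"
  define \<epsilon> where "\<epsilon> = norm (I - I') / 2"
  have \<epsilon>: "0 < \<epsilon>" using \<open>I \<noteq> I'\<close> by (simp add: \<epsilon>_def)
  let ?S = "\<lambda>\<D> f. \<Sum>(s, K)\<in>\<D>. blinfun_apply (g (Sup K) - g (Inf K)) (f s)"
  obtain d where d: "0 < d" "\<And>\<D>. \<D> tagged_division_of {a..b} \<Longrightarrow> (\<lambda>s. ball s d) fine \<D> \<Longrightarrow> norm (?S \<D> f - I) < \<epsilon>"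
    using assms(1)[unfolded has_RS_integral_def, rule_format, OF \<epsilon>] by blast
  obtain d' where d': "0 < d'" "\<And>\<D>. \<D> tagged_division_of {a..b} \<Longrightarrow> (\<lambda>s. ball s d') fine \<D> \<Longrightarrow> norm (?S \<D> f - I') < \<epsilon>"
    using assms(2)[unfolded has_RS_integral_def, rule_format, OF \<epsilon>] by blast
  obtain \<D> where D: "\<D> tagged_division_of {a..b}" "(\<lambda>s. ball s (min d d')) fine \<D>"
    using fine_division_exists_real[of "\<lambda>s. ball s (min d d')" a b] d d' by (auto simp: gauge_def)
  have fine: "(\<lambda>s. ball s d) fine \<D>" "(\<lambda>s. ball s d') fine \<D>"
    using D(2) unfolding fine_def by fastforce+
  have "norm (I - I') < \<epsilon> + \<epsilon>"
    using d(2)[OF D(1) fine(1)] d'(2)[OF D(1) fine(2)] norm_triangle_ineq4[of "?S \<D> f - I'" "?S \<D> f - I"] by simp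
  then show False by (simp add: \<epsilon>_def)
qed

lemma admissible_delay_op:
  fixes L :: "real \<Rightarrow> (real \<Rightarrow>\<^sub>C 'a::banach) \<Rightarrow> 'a"
  assumes r: "0 < r" and M: "0 \<le> M" and adm: "admissible r L"
    and norm_L: "(SUP t. op_norm_on (phase_space r) (L t)) = ennreal M"
  shows "delay_op r M L"
proof -
  let ?V = "phase_space r :: (real \<Rightarrow>\<^sub>C 'a) set"
  have sub: "subspace ?V" by (rule subspace_phase_space)
  obtain \<eta> :: "real \<Rightarrow> real \<Rightarrow> 'a \<Rightarrow>\<^sub>L 'a" where
    RS: "\<And>t \<phi>. \<phi> \<in> ?V \<Longrightarrow> has_RS_integral (\<eta> t) (apply_bcontfun \<phi>) (-r) 0 (L t \<phi>)"
    using adm unfolding admissible_def by blast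
  have lin: "L t (\<phi> + c *\<^sub>R \<psi>) = L t \<phi> + c *\<^sub>R L t \<psi>" if "\<phi> \<in> ?V" "\<psi> \<in> ?V" for t \<phi> \<psi> c
  proof (rule has_RS_integral_unique[OF RS])
    show "\<phi> + c *\<^sub>R \<psi> \<in> ?V" using that sub by (intro subspace_add subspace_scale)
    have "apply_bcontfun (\<phi> + c *\<^sub>R \<psi>) = (\<lambda>s. apply_bcontfun \<phi> s + c *\<^sub>R apply_bcontfun \<psi> s)"
      by (auto simp: plus_bcontfun.rep_eq scaleR_bcontfun.rep_eq)
    then show "has_RS_integral (\<eta> t) (apply_bcontfun (\<phi> + c *\<^sub>R \<psi>)) (- r) 0 (L t \<phi> + c *\<^sub>R L t \<psi>)"
      using has_RS_integral_axpy[OF RS[OF that(1)] RS[OF that(2)]] by simp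
  qed
  have diff: "L t (\<phi> - \<psi>) = L t \<phi> - L t \<psi>" if "\<phi> \<in> ?V" "\<psi> \<in> ?V" for t \<phi> \<psi>
    using lin[OF that, of t "-1"] by simp
  have L0: "L t 0 = 0" for t using diff[of 0 0 t] sub by (simp add: subspace_0)
  have scale: "L t (c *\<^sub>R \<phi>) = c *\<^sub>R L t \<phi>" if "\<phi> \<in> ?V" for t c \<phi>
    using lin[OF subspace_0[OF sub] that, of t c] L0 by simp
  show ?thesis
  proof
    show "norm (L t \<phi>) \<le> M * norm \<phi>" if "\<phi> \<in> ?V" for t \<phi>
    proof (cases "\<phi> = 0")
      case False
      let ?\<psi> = "inverse (norm \<phi>) *\<^sub>R \<phi>"
      have "ennreal (norm (L t ?\<psi>)) \<le> op_norm_on ?V (L t)"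
        unfolding op_norm_on_def using that sub False by (intro SUP_upper) (auto intro: subspace_scale)
      also have "\<dots> \<le> ennreal M" unfolding norm_L[symmetric] by (rule SUP_upper) simp
      finally have "norm (L t ?\<psi>) \<le> M" using M by (simp add: ennreal_le_iff)
      then show ?thesis using False unfolding scale[OF that] by (simp add: field_simps)
    qed (simp add: L0)
    show "continuous_on UNIV (\<lambda>t. L t \<phi>)" if "\<phi> \<in> ?V" for \<phi>
      using adm that unfolding admissible_def by blast
  qed (use r M diff scale in auto)
qed

section \<open>Existence and smoothness of the solution map\<close>

lemma weighted_contraction_constant:
  assumes M: "0 \<le> M" and x: "0 < x" and r: "0 < r" and M1: "0 \<le> M1" and j: "1 \<le> j" "j \<le> k + 1"
  shows "M * exp (real j * (x / r) * r) + M1 * exp (real j * (x / r) * r) / (real j * (x / r))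
     \<le> M * exp (real (k + 1) * x) + M1 * r * exp (real (k + 1) * x) / x"
proof -
  have e: "exp (real j * (x / r) * r) \<le> exp (real (k + 1) * x)"
    using j x r by (simp add: mult_right_mono)
  have "M1 * exp (real j * (x / r) * r) / (real j * (x / r)) \<le> M1 * exp (real (k + 1) * x) / (x / r)"
  proof (rule frac_le)
    have "1 * (x / r) \<le> real j * (x / r)" using j x r by (intro mult_right_mono) auto
    then show "x / r \<le> real j * (x / r)" by simp
  qed (use e x r M1 in \<open>auto intro: mult_left_mono\<close>)
  also have "\<dots> = M1 * r * exp (real (k + 1) * x) / x" by simp
  finally show ?thesis using mult_left_mono[OF e M] by linarith
qed

theorem theorem2p1:
  fixes n k :: nat and M r0 xs :: real and Mc :: "nat \<Rightarrow> real"
  assumes "1 \<le> n" and "1 \<le> k"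
    and "dim (UNIV :: 'a::banach set) = n"
    and "0 < M" and "M < 1" and "\<forall>j\<le>k + 1. 0 < Mc j"
    and "0 < r0"
    and "0 < Mc 1 * r0" and "Mc 1 * r0 < H M (- ln M / real (k + 1))"
    and "xs \<in> {H_root1 M (Mc 1 * r0) <..< - ln M / real (k + 1)}"
  shows "{H_root1 M (Mc 1 * r0) <..< - ln M / real (k + 1)}
           \<subseteq> {H_root1 M (Mc 1 * r0) <..< H_root2 M (Mc 1 * r0)} \<and>
    (\<exists>\<delta>. 0 < \<delta> \<and> \<delta> \<le> r0 \<and>
      (\<forall>r (L :: real \<Rightarrow> (real \<Rightarrow>\<^sub>C 'a) \<Rightarrow> 'a) (F :: real \<Rightarrow> (real \<Rightarrow>\<^sub>C 'a) \<Rightarrow> 'a) DF.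
        0 < r \<and> r < \<delta> \<and>
        admissible r L \<and>
        (SUP t. op_norm_on (phase_space r) (L t)) = ennreal M \<and>
        continuous_on (UNIV \<times> phase_space r) (\<lambda>(t, \<phi>). F t \<phi>) \<and>
        (\<forall>t. Ck_with (phase_space r) k (F t) (DF t)) \<and>
        (\<forall>t. norm (F t 0) \<le> Mc 0 * exp (xs / r * \<bar>t\<bar>)) \<and>
        (\<forall>t. \<forall>\<phi>\<in>phase_space r. \<forall>j\<in>{1..k}. ml_norm (phase_space r) j (DF t j \<phi>) \<le> ennreal (Mc j)) \<and>
        (\<forall>t. \<forall>\<phi>\<in>phase_space r. \<forall>\<psi>\<in>phase_space r.
           ml_norm (phase_space r) k (\<lambda>hs. DF t k \<phi> hs - DF t k \<psi> hs)
             \<le> ennreal (Mc (k + 1) * norm (\<phi> - \<psi>)))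
        \<longrightarrow>
        (\<exists>\<Psi> :: real \<Rightarrow> 'a \<Rightarrow> 'a.
           continuous_on UNIV (\<lambda>(t, \<xi>). \<Psi> t \<xi>) \<and>
           (\<forall>\<xi>. is_solution r L F (\<lambda>t. \<Psi> t \<xi>) \<and>
                \<Psi> 0 \<xi> - L 0 (segment_at r (\<lambda>t. \<Psi> t \<xi>) 0) = \<xi>) \<and>
           (\<forall>t. Ck1 UNIV k (\<Psi> t)))))"
proof -
  define b where "b = - ln M / real (k + 1)"
  define x1 where "x1 = H_root1 M (Mc 1 * r0)"
  have lnM: "ln M < 0" using \<open>0 < M\<close> \<open>M < 1\<close> by simp
  have b: "0 < b" "b < - ln M"
    using lnM \<open>1 \<le> k\<close> mult_pos_neg[of "real k" "ln M"] by (auto simp: b_def field_simps)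
  have roots: "0 < x1" "b < H_root2 M (Mc 1 * r0)"
    unfolding x1_def using H_roots[OF assms(4,5,8) assms(9)[folded b_def] b] by blast+
  have xs: "0 < xs" "xs < b" using assms(10) roots(1) by (auto simp: x1_def b_def)
  define q where "q = exp (real (k + 1) * xs)"
  have q0: "0 < q" by (simp add: q_def)
  \<comment> \<open>This is where the upper end of the interval for \<open>xs\<close> enters.\<close>
  have Mq: "M * q < 1"
  proof -
    have "xs * real (k + 1) < - ln M"
      using xs(2) unfolding b_def by (rule iffD1[OF pos_less_divide_eq, rotated]) simp
    then have "real (k + 1) * xs < - ln M" by (simp only: mult.commute)
    then have "q < exp (- ln M)" unfolding q_def exp_less_cancel_iff .
    then have "M * q < M * exp (- ln M)" using \<open>0 < M\<close> by simp
    then show ?thesis using \<open>0 < M\<close> by (simp add: exp_minus)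
  qed
  have Mc: "0 < Mc j" if "j \<le> k + 1" for j using assms(6) that by blast
  have Mc1: "0 < Mc 1" by (intro Mc) simp
  \<comment> \<open>Chosen such that \<open>M * q + Mc 1 * r * q / xs < 1\<close> for \<open>r < \<delta>\<close>.\<close>
  define \<delta> where "\<delta> = min r0 (xs * (1 - M * q) / (Mc 1 * q))"
  have \<delta>: "0 < \<delta>" "\<delta> \<le> r0" using \<open>0 < r0\<close> xs Mq Mc1 q0 by (auto simp: \<delta>_def)
  \<comment> \<open>Any common upper bound of the constants will do.\<close>
  define K where "K = (\<Sum>j\<le>k+1. Mc j)"
  have McK: "Mc j \<le> K" if "j \<le> k + 1" for j
    unfolding K_def using that Mc by (intro member_le_sum) (auto intro: less_imp_le)
  have K0: "0 \<le> K" using McK[of 0] Mc[of 0] by simp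
  show ?thesis
  proof (intro conjI exI[of _ \<delta>] allI impI; (elim conjE)?)
    show "{H_root1 M (Mc 1 * r0)<..<- ln M / real (k + 1)} \<subseteq> {H_root1 M (Mc 1 * r0)<..<H_root2 M (Mc 1 * r0)}"
      using roots(2) by (auto simp: b_def)
    show "0 < \<delta>" "\<delta> \<le> r0" by fact+
    fix r and L F :: "real \<Rightarrow> (real \<Rightarrow>\<^sub>C 'a) \<Rightarrow> 'a" and DF
    let ?V = "phase_space r :: (real \<Rightarrow>\<^sub>C 'a) set"
    assume rd: "0 < r" "r < \<delta>" and adm: "admissible r L"
      and norm_L: "(SUP t. op_norm_on ?V (L t)) = ennreal M"
      and Fc: "continuous_on (UNIV \<times> ?V) (\<lambda>(t, \<phi>). F t \<phi>)"
      and Ck: "\<forall>t. Ck_with ?V k (F t) (DF t)"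
      and F0: "\<forall>t. norm (F t 0) \<le> Mc 0 * exp (xs / r * \<bar>t\<bar>)"
      and Db: "\<forall>t. \<forall>\<phi>\<in>?V. \<forall>j\<in>{1..k}. ml_norm ?V j (DF t j \<phi>) \<le> ennreal (Mc j)"
      and Dl: "\<forall>t. \<forall>\<phi>\<in>?V. \<forall>\<psi>\<in>?V. ml_norm ?V k (\<lambda>hs. DF t k \<phi> hs - DF t k \<psi> hs) \<le> ennreal (Mc (k + 1) * norm (\<phi> - \<psi>))"
    have sub: "subspace ?V" by (rule subspace_phase_space)
    have V0: "0 \<in> ?V" using sub by (rule subspace_0)
    have DF0: "DF t 0 \<phi> [] = F t \<phi>" if "\<phi> \<in> ?V" for t \<phi>
      using Ck that unfolding Ck_with_def by blast
    interpret delay_op r M L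
      using rd adm norm_L \<open>0 < M\<close> by (intro admissible_delay_op) auto
    have tower: "tower ?V k (DF t) K (Mc 1)" for t
    proof (rule tower_from_Ck[OF sub Ck[rule_format] \<open>1 \<le> k\<close> K0])
      show "ml_norm ?V j (DF t j \<phi>) \<le> ennreal K" if "1 \<le> j" "j \<le> k" "\<phi> \<in> ?V" for j \<phi>
        using Db[rule_format, OF that(3), of j t] McK[of j] that by (auto intro: order_trans ennreal_leI)
      show "ml_norm ?V 1 (DF t 1 \<phi>) \<le> ennreal (Mc 1)" if "\<phi> \<in> ?V" for \<phi>
        using Db[rule_format, OF that, of 1 t] \<open>1 \<le> k\<close> by simp
      show "ml_norm ?V k (\<lambda>hs. DF t k \<phi> hs - DF t k \<psi> hs) \<le> ennreal (K * norm (\<phi> - \<psi>))" if "\<phi> \<in> ?V" "\<psi> \<in> ?V" for \<phi> \<psi>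
        using Dl[rule_format, OF that, of t] McK[of "k + 1"]
        by (auto intro!: order_trans[OF Dl[rule_format, OF that, of t]] ennreal_leI mult_right_mono)
    qed (use Mc1 in auto)
    define \<kappa> where "\<kappa> = M * q + Mc 1 * r * q / xs"
    have "r < xs * (1 - M * q) / (Mc 1 * q)" using rd(2) by (simp add: \<delta>_def)
    then have "\<kappa> < 1" using Mc1 q0 xs by (simp add: \<kappa>_def field_simps)
    interpret delay_eq r M L k DF K "Mc 1" "xs / r" \<kappa> "Mc 0"
    proof (rule delay_eq.intro[OF delay_op_axioms delay_eq_axioms.intro])
      show "tower ?V k (DF t) K (Mc 1)" for t by (rule tower)
      show "continuous_on UNIV (\<lambda>t. DF t 0 \<phi> [])" if "\<phi> \<in> ?V" for \<phi>
      proof -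
        have "continuous_on UNIV (\<lambda>t. (\<lambda>(t, \<phi>). F t \<phi>) (t, \<phi>))"
          using that by (intro continuous_on_compose2[OF Fc] continuous_intros) auto
        then show ?thesis using that by (simp add: DF0)
      qed
      show "M * exp (real j * (xs / r) * r) + Mc 1 * exp (real j * (xs / r) * r) / (real j * (xs / r)) \<le> \<kappa>"
        if "1 \<le> j" "j \<le> k + 1" for j
        unfolding \<kappa>_def q_def using that xs rd Mc1 \<open>0 < M\<close> by (intro weighted_contraction_constant) auto
    qed (use F0 DF0 V0 xs rd \<open>\<kappa> < 1\<close> in auto)
    obtain C Y where "1 \<le> C" "\<And>\<xi> hs. length hs \<le> k \<Longrightarrow> is_jet C Y \<xi> hs"
      using jet_exists[OF order_refl] by blast
    then interpret delay_jet r M L k DF K "Mc 1" "xs / r" \<kappa> "Mc 0" C Y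
      by unfold_locales
    show "\<exists>\<Psi> :: real \<Rightarrow> 'a \<Rightarrow> 'a.
           continuous_on UNIV (\<lambda>(t, \<xi>). \<Psi> t \<xi>) \<and>
           (\<forall>\<xi>. is_solution r L F (\<lambda>t. \<Psi> t \<xi>) \<and>
                \<Psi> 0 \<xi> - L 0 (segment_at r (\<lambda>t. \<Psi> t \<xi>) 0) = \<xi>) \<and>
           (\<forall>t. Ck1 UNIV k (\<Psi> t))"
      using Y_jointly_continuous Y_is_solution[OF DF0] Y_Ck1
      by (intro exI[of _ "\<lambda>t \<xi>. Y \<xi> [] t"] conjI allI) auto
  qed
qed

end
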